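(* Let $(\omega,\psi^+)$ be a half-flat $\mathrm{SU}^\varepsilon(p,q)$-structure, $p+q=3$, on a six-manifold $M$, i.e. $d\psi^+=0$ and $d(\omega\wedge\omega)=0$. Then the Nijenhuis tensor $N$ of the induced almost $\varepsilon$-complex structure $J$ is totally skew-symmetric (i.e. $g(N(X,Y),Z)$ is a three-form, with $g$ the induced metric) if and only if $(\omega,\psi^-)$ is nearly half-flat, i.e. $d\psi^-=\nu\,\omega\wedge\omega$ for a real constant $\nu$.
   Context: Let $V$ be a real six-dimensional oriented vector space and let $\kappa:\Lambda^5V^*\to V\otimes\Lambda^6V^*$ be the canonical isomorphism, $\kappa(x\lrcorner\,\mathrm{vol})=x\otimes\mathrm{vol}$. For $\rho\in\Lambda^3V^*$ put $K_\rho(v)=\kappa((v\lrcorner\rho)\wedge\rho)$ and $\lambda(\rho)=\frac16\mathrm{tr}(K_\rho^2)\in(\Lambda^6V^* )^{\otimes2}$. The form $\rho$ is stable (has open $\mathrm{GL}(V)$-orbit) iff $\lambda(\rho)\neq0$; then $\phi(\rho)=\sqrt{|\lambda(\rho)|}$ is the associated positively oriented volume form, $J_\rho=\frac1{\phi(\rho)}K_\rho$, and $J_\rho^2=\varepsilon\,\mathrm{id}$ with $\varepsilon\in\{\pm1\}$ the sign of $\lambda(\rho)$. A two-form $\omega$ is stable iff it is non-degenerate; then $V$ is oriented by $\omega^3$. A pair $(\omega,\rho)$ of stable forms is compatible if $\omega\wedge\rho=0$; it induces the pseudo-Euclidean metric $g=\varepsilon\,\omega(\cdot,J_\rho\cdot)$,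 which satisfies $g(J_\rho\cdot,J_\rho\cdot)=-\varepsilon g$ and $\omega=g(\cdot,J_\rho\cdot)$. An $\mathrm{SU}^\varepsilon(p,q)$-structure, $p+q=3$, on a six-manifold $M$ is a pair $(\omega,\psi^+)\in\Omega^2M\times\Omega^3M$ of everywhere stable and compatible forms, with $\varepsilon$ the sign of $\lambda(\psi^+)$, such that $\Psi=\psi^++\mathrm i_\varepsilon\psi^-$ (with $\mathrm i_\varepsilon^2=\varepsilon$), where $J=J_{\psi^+}$, $\psi^-=J^*\psi^+$, $J^*\psi^+(X,Y,Z)=\psi^+(JX,JY,JZ)$, has constant non-zero length with respect to the induced metric $g$; equivalently $\psi^-\wedge\psi^+=c\,\omega^3$ for a non-zero constant $c$. The Nijenhuis tensor is $N(X,Y)=-\varepsilon[X,Y]-[JX,JY]+J[JX,Y]+J[X,JY]$.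
   Formalization: The six-manifold M is assumed connected; on a disjoint union of two differently scaled nearly Kähler six-spheres N is totally skew-symmetric, but the real constant ν differs between the components, so the claim fails there. *)

theory Defs
  imports "HOL-Analysis.Analysis"
begin

section \<open>Alternating forms\<close>

text \<open>
  A \<open>k\<close>-form on \<open>'v\<close> is a function of a sequence of vectors which only depends on the entries
  with index below \<open>k\<close>, so that equality of forms is equality of functions.  Wedge product and
  exterior derivative follow the convention in which
  \<open>(e\<^sup>1 \<and> \<dots> \<and> e\<^sup>k)(e\<^sub>1, \<dots>, e\<^sub>k) = 1\<close>.
\<close>

type_synonym 'v form = "(nat \<Rightarrow> 'v) \<Rightarrow> real"

definition alt_form :: "nat \<Rightarrow> 'v::real_vector form \<Rightarrow> bool" where
  "alt_form k \<alpha> \<longleftrightarrow>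
     (\<forall>v w. (\<forall>i<k. v i = w i) \<longrightarrow> \<alpha> v = \<alpha> w) \<and>
     (\<forall>v. \<forall>i<k. linear (\<lambda>x. \<alpha> (v(i := x)))) \<and>
     (\<forall>v. \<forall>i<k. \<forall>j<k. i \<noteq> j \<and> v i = v j \<longrightarrow> \<alpha> v = 0)"

definition pullback :: "('v \<Rightarrow> 'w) \<Rightarrow> 'w form \<Rightarrow> 'v form" where
  "pullback A \<alpha> = (\<lambda>v. \<alpha> (\<lambda>i. A (v i)))"

definition wedge :: "nat \<Rightarrow> nat \<Rightarrow> 'v form \<Rightarrow> 'v form \<Rightarrow> 'v form" where
  "wedge k l \<alpha> \<beta> = (\<lambda>v. (1 / (fact k * fact l)) *
     (\<Sum>p | p permutes {..<k + l}.
        of_int (sign p) * \<alpha> (\<lambda>i. v (p i)) * \<beta> (\<lambda>i. v (p (k + i)))))"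

definition contract :: "'v \<Rightarrow> 'v form \<Rightarrow> 'v form" where
  "contract x \<alpha> = (\<lambda>v. \<alpha> (case_nat x v))"

text \<open>
  A form is stable if its \<open>GL(V)\<close>-orbit is open in \<open>\<Lambda>\<^sup>kV\<^sup>*\<close>.  The topology is that of
  pointwise convergence, which on this finite-dimensional space is the usual one.
\<close>

definition stable :: "nat \<Rightarrow> 'v::real_vector form \<Rightarrow> bool" where
  "stable k \<alpha> \<longleftrightarrow> alt_form k \<alpha> \<and>
     openin (top_of_set {\<beta>. alt_form k \<beta>}) {pullback A \<alpha> | A :: 'v \<Rightarrow> 'v. linear A \<and> bij A}"

section \<open>Linear algebra of a pair \<open>(\<omega>, \<rho>)\<close> in dimension six\<close>

text \<open>
  \<open>\<Lambda>\<^sup>6V\<^sup>*\<close> is trivialised by a nonzero six-form \<open>vol\<close>: \<open>Kmap vol \<rho>\<close> is the endomorphism with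
  \<open>K\<^sub>\<rho> = Kmap vol \<rho> \<otimes> vol\<close>, and \<open>\<lambda>(\<rho>) = lam vol \<rho> \<cdot> vol\<^sup>2\<close>.  Rescaling \<open>vol\<close> multiplies \<open>lam\<close>
  by a positive number.
\<close>

type_synonym V = "real ^ 6"

definition kappa :: "V form \<Rightarrow> V form \<Rightarrow> V" where
  "kappa vol \<sigma> = (THE x. contract x vol = \<sigma>)"

definition Kmap :: "V form \<Rightarrow> V form \<Rightarrow> V \<Rightarrow> V" where
  "Kmap vol \<rho> v = kappa vol (wedge 2 3 (contract v \<rho>) \<rho>)"

definition lam :: "V form \<Rightarrow> V form \<Rightarrow> real" where
  "lam vol \<rho> = (1 / 6) * trace (matrix (Kmap vol \<rho> \<circ> Kmap vol \<rho>))"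

definition cube :: "V form \<Rightarrow> V form" where
  "cube \<omega> = wedge 4 2 (wedge 2 2 \<omega> \<omega>) \<omega>"

text \<open>
  The orientation is that of \<open>\<omega>\<^sup>3\<close>, so \<open>\<phi>(\<rho>) = sqrt \<bar>lam (\<omega>\<^sup>3) \<rho>\<bar> \<cdot> \<omega>\<^sup>3\<close>
  and \<open>J\<^sub>\<rho> = K\<^sub>\<rho> / \<phi>(\<rho>)\<close>.
\<close>

definition Jmap :: "V form \<Rightarrow> V form \<Rightarrow> V \<Rightarrow> V" where
  "Jmap \<omega> \<rho> v = (1 / sqrt \<bar>lam (cube \<omega>) \<rho>\<bar>) *\<^sub>R Kmap (cube \<omega>) \<rho> v"

definition metric :: "real \<Rightarrow> V form \<Rightarrow> V form \<Rightarrow> V \<Rightarrow> V \<Rightarrow> real" where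
  "metric \<epsilon> \<omega> \<rho> u v = \<epsilon> * \<omega> ((!) [u, Jmap \<omega> \<rho> v])"

definition has_signature :: "(V \<Rightarrow> V \<Rightarrow> real) \<Rightarrow> nat \<Rightarrow> nat \<Rightarrow> bool" where
  "has_signature g a b \<longleftrightarrow>
     (\<exists>(e :: 6 \<Rightarrow> V) I.
        (\<forall>i j. g (e i) (e j) = (if i = j then (if i \<in> I then 1 else - 1) else 0)) \<and>
        card I = a \<and> card (- I) = b)"

text \<open>The bilinear form induced on \<open>\<Lambda>\<^sup>kV\<^sup>*\<close>, via the inverse Gram matrix \<open>g\<^sup>i\<^sup>j\<close>.\<close>

definition form_inner :: "(V \<Rightarrow> V \<Rightarrow> real) \<Rightarrow> nat \<Rightarrow> V form \<Rightarrow> V form \<Rightarrow> real" where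
  "form_inner g k \<alpha> \<beta> =
     (let G = matrix_inv (\<chi> i j. g (axis i 1) (axis j 1));
          F = ({..<k} \<rightarrow>\<^sub>E (UNIV :: 6 set))
      in (1 / fact k) *
         (\<Sum>f\<in>F. \<Sum>h\<in>F. (\<Prod>i<k. G $ f i $ h i) *
            \<alpha> (\<lambda>i. axis (f i) 1) * \<beta> (\<lambda>i. axis (h i) 1)))"

text \<open>
  The squared length \<open>g(\<Psi>, \<Psi>\<^sup>*)\<close> of \<open>\<Psi> = \<alpha> + i\<^sub>\<epsilon> \<beta>\<close>, where \<open>\<Psi>\<^sup>* = \<alpha> - i\<^sub>\<epsilon> \<beta>\<close> is the conjugate
  and \<open>i\<^sub>\<epsilon>\<^sup>2 = \<epsilon>\<close>.
\<close>

definition sq_length :: "real \<Rightarrow> (V \<Rightarrow> V \<Rightarrow> real) \<Rightarrow> nat \<Rightarrow> V form \<Rightarrow> V form \<Rightarrow> real" where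
  "sq_length \<epsilon> g k \<alpha> \<beta> = form_inner g k \<alpha> \<alpha> - \<epsilon> * form_inner g k \<beta> \<beta>"

section \<open>Calculus on open subsets of Euclidean space\<close>

primrec Ck_on :: "nat \<Rightarrow> 'a::real_normed_vector set \<Rightarrow> ('a \<Rightarrow> 'b::real_normed_vector) \<Rightarrow> bool" where
  "Ck_on 0 S f \<longleftrightarrow> continuous_on S f"
| "Ck_on (Suc k) S f \<longleftrightarrow>
     (\<forall>x\<in>S. f differentiable (at x)) \<and> (\<forall>v. Ck_on k S (\<lambda>x. frechet_derivative f (at x) v))"

definition smooth_on :: "'a::real_normed_vector set \<Rightarrow> ('a \<Rightarrow> 'b::real_normed_vector) \<Rightarrow> bool" where
  "smooth_on S f \<longleftrightarrow> (\<forall>k. Ck_on k S f)"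

definition form_on :: "'v::real_normed_vector set \<Rightarrow> nat \<Rightarrow> ('v \<Rightarrow> 'v form) \<Rightarrow> bool" where
  "form_on S k \<alpha> \<longleftrightarrow> (\<forall>x\<in>S. alt_form k (\<alpha> x)) \<and> (\<forall>v. smooth_on S (\<lambda>x. \<alpha> x v))"

definition ext_deriv ::
  "nat \<Rightarrow> ('v::real_normed_vector \<Rightarrow> 'v form) \<Rightarrow> 'v \<Rightarrow> 'v form" where
  "ext_deriv k \<alpha> x = (\<lambda>v. \<Sum>i\<le>k. (- 1) ^ i *
     frechet_derivative (\<lambda>y. \<alpha> y (\<lambda>j. if j < i then v j else v (Suc j))) (at x) (v i))"

definition lie_bracket ::
  "('v::real_normed_vector \<Rightarrow> 'v) \<Rightarrow> ('v \<Rightarrow> 'v) \<Rightarrow> 'v \<Rightarrow> 'v" where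
  "lie_bracket X Y x = frechet_derivative Y (at x) (X x) - frechet_derivative X (at x) (Y x)"

definition nijenhuis ::
  "real \<Rightarrow> ('v::real_normed_vector \<Rightarrow> 'v \<Rightarrow> 'v) \<Rightarrow> ('v \<Rightarrow> 'v) \<Rightarrow> ('v \<Rightarrow> 'v) \<Rightarrow> 'v \<Rightarrow> 'v" where
  "nijenhuis \<epsilon> J X Y x =
     - \<epsilon> *\<^sub>R lie_bracket X Y x
     - lie_bracket (\<lambda>y. J y (X y)) (\<lambda>y. J y (Y y)) x
     + J x (lie_bracket (\<lambda>y. J y (X y)) Y x)
     + J x (lie_bracket X (\<lambda>y. J y (Y y)) x)"

section \<open>Six-manifolds and differential forms on them\<close>

text \<open>
  A chart is a pair of its domain and a map whose values outside the domain are irrelevant.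
  A differential form is the family of its local representations, which must be related by
  pullback along the transition maps.
\<close>

type_synonym 'a chart = "'a set \<times> ('a \<Rightarrow> V)"
type_synonym 'a mform = "'a chart \<Rightarrow> V \<Rightarrow> V form"

definition chart_image :: "'a chart \<Rightarrow> V set" where
  "chart_image C = snd C ` fst C"

definition transition :: "'a chart \<Rightarrow> 'a chart \<Rightarrow> V \<Rightarrow> V" where
  "transition C D = snd D \<circ> inv_into (fst C) (snd C)"

definition smooth_atlas :: "'a topology \<Rightarrow> 'a chart set \<Rightarrow> bool" where
  "smooth_atlas M \<A> \<longleftrightarrow>
     (\<Union>C\<in>\<A>. fst C) = topspace M \<and>
     (\<forall>C\<in>\<A>. openin M (fst C) \<and> open (chart_image C) \<and>
        homeomorphic_map (subtopology M (fst C)) (top_of_set (chart_image C)) (snd C)) \<and>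
     (\<forall>C\<in>\<A>. \<forall>D\<in>\<A>. smooth_on (snd C ` (fst C \<inter> fst D)) (transition C D))"

definition six_manifold :: "'a topology \<Rightarrow> 'a chart set \<Rightarrow> bool" where
  "six_manifold M \<A> \<longleftrightarrow> Hausdorff_space M \<and> second_countable M \<and> smooth_atlas M \<A>"

definition diff_form :: "'a chart set \<Rightarrow> nat \<Rightarrow> 'a mform \<Rightarrow> bool" where
  "diff_form \<A> k \<alpha> \<longleftrightarrow>
     (\<forall>C\<in>\<A>. form_on (chart_image C) k (\<alpha> C)) \<and>
     (\<forall>C\<in>\<A>. \<forall>D\<in>\<A>. \<forall>p\<in>fst C \<inter> fst D.
        \<alpha> C (snd C p) =
          pullback (frechet_derivative (transition C D) (at (snd C p))) (\<alpha> D (snd D p)))"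

definition form_eq :: "'a chart set \<Rightarrow> 'a mform \<Rightarrow> 'a mform \<Rightarrow> bool" where
  "form_eq \<A> \<alpha> \<beta> \<longleftrightarrow> (\<forall>C\<in>\<A>. \<forall>x\<in>chart_image C. \<alpha> C x = \<beta> C x)"

definition mzero :: "'a mform" where
  "mzero = (\<lambda>C x v. 0)"

definition mscale :: "real \<Rightarrow> 'a mform \<Rightarrow> 'a mform" where
  "mscale c \<alpha> = (\<lambda>C x v. c * \<alpha> C x v)"

definition mwedge :: "nat \<Rightarrow> nat \<Rightarrow> 'a mform \<Rightarrow> 'a mform \<Rightarrow> 'a mform" where
  "mwedge k l \<alpha> \<beta> = (\<lambda>C x. wedge k l (\<alpha> C x) (\<beta> C x))"

definition mderiv :: "nat \<Rightarrow> 'a mform \<Rightarrow> 'a mform" where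
  "mderiv k \<alpha> = (\<lambda>C. ext_deriv k (\<alpha> C))"

section \<open>\<open>SU\<^sup>\<epsilon>(p,q)\<close>-structures\<close>

definition psi_minus :: "'a mform \<Rightarrow> 'a mform \<Rightarrow> 'a mform" where
  "psi_minus \<omega> \<psi> = (\<lambda>C x. pullback (Jmap (\<omega> C x) (\<psi> C x)) (\<psi> C x))"

text \<open>
  The labels \<open>p\<close>, \<open>q\<close> record the signature of the induced metric: \<open>(2p,2q)\<close> if \<open>\<epsilon> = -1\<close>, while
  for \<open>\<epsilon> = 1\<close> the structure group is \<open>SL(3,\<real>)\<close> and the metric is neutral.
\<close>

definition SU_structure ::
  "'a chart set \<Rightarrow> real \<Rightarrow> nat \<Rightarrow> nat \<Rightarrow> 'a mform \<Rightarrow> 'a mform \<Rightarrow> bool" where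
  "SU_structure \<A> \<epsilon> p q \<omega> \<psi> \<longleftrightarrow>
     (\<epsilon> = 1 \<or> \<epsilon> = - 1) \<and> p + q = 3 \<and>
     diff_form \<A> 2 \<omega> \<and> diff_form \<A> 3 \<psi> \<and>
     (\<forall>C\<in>\<A>. \<forall>x\<in>chart_image C. stable 2 (\<omega> C x) \<and> stable 3 (\<psi> C x)) \<and>
     form_eq \<A> (mwedge 2 3 \<omega> \<psi>) mzero \<and>
     (\<forall>C\<in>\<A>. \<forall>x\<in>chart_image C. sgn (lam (cube (\<omega> C x)) (\<psi> C x)) = \<epsilon>) \<and>
     (\<forall>C\<in>\<A>. \<forall>x\<in>chart_image C.
        if \<epsilon> = - 1 then has_signature (metric \<epsilon> (\<omega> C x) (\<psi> C x)) (2 * p) (2 * q)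
        else has_signature (metric \<epsilon> (\<omega> C x) (\<psi> C x)) 3 3) \<and>
     (\<exists>c. c \<noteq> 0 \<and> (\<forall>C\<in>\<A>. \<forall>x\<in>chart_image C.
        sq_length \<epsilon> (metric \<epsilon> (\<omega> C x) (\<psi> C x)) 3 (\<psi> C x) (psi_minus \<omega> \<psi> C x) = c))"

definition half_flat :: "'a chart set \<Rightarrow> 'a mform \<Rightarrow> 'a mform \<Rightarrow> bool" where
  "half_flat \<A> \<omega> \<psi> \<longleftrightarrow>
     form_eq \<A> (mderiv 3 \<psi>) mzero \<and> form_eq \<A> (mderiv 4 (mwedge 2 2 \<omega> \<omega>)) mzero"

definition nearly_half_flat :: "'a chart set \<Rightarrow> 'a mform \<Rightarrow> 'a mform \<Rightarrow> bool" where
  "nearly_half_flat \<A> \<omega> \<sigma> \<longleftrightarrow>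
     (\<exists>\<nu>. form_eq \<A> (mderiv 3 \<sigma>) (mscale \<nu> (mwedge 2 2 \<omega> \<omega>)))"

text \<open>
  Being a three-form is a local condition, so \<open>g(N(X,Y),Z)\<close> is tested on all smooth vector
  fields over each chart domain.
\<close>

definition nijenhuis_skew :: "'a chart set \<Rightarrow> real \<Rightarrow> 'a mform \<Rightarrow> 'a mform \<Rightarrow> bool" where
  "nijenhuis_skew \<A> \<epsilon> \<omega> \<psi> \<longleftrightarrow>
     (\<forall>C\<in>\<A>. \<exists>\<tau>. form_on (chart_image C) 3 \<tau> \<and>
        (\<forall>X Y Z. smooth_on (chart_image C) X \<and> smooth_on (chart_image C) Y \<and>
             smooth_on (chart_image C) Z \<longrightarrow>
           (\<forall>x\<in>chart_image C.
              metric \<epsilon> (\<omega> C x) (\<psi> C x)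
                (nijenhuis \<epsilon> (\<lambda>y. Jmap (\<omega> C y) (\<psi> C y)) X Y x) (Z x)
              = \<tau> x ((!) [X x, Y x, Z x]))))"

end

theory Submission
  imports Defs
begin

text \<open>
  Write \<open>\<Psi> = \<psi>\<^sup>+ + i\<^sub>\<epsilon> \<psi>\<^sup>-\<close>, a form of type \<open>(3,0)\<close>.  The \<open>(2,2)\<close> part of \<open>d\<Psi>\<close> is \<open>N\<close> contracted into \<open>\<Psi>\<close>,
  and \<open>d\<psi>\<^sup>+ = 0\<close> forces \<open>d\<Psi> = i\<^sub>\<epsilon> d\<psi>\<^sup>-\<close> to be of pure type \<open>(2,2)\<close>.  Hence \<open>N\<close> and \<open>d\<psi>\<^sup>-\<close> determine each other
  pointwise, and under this correspondence the skew-symmetric \<open>N\<close> match the multiples of \<open>\<omega>\<^sup>2\<close>.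
  If \<open>d\<psi>\<^sup>- = \<nu> \<omega>\<^sup>2\<close> with a function \<open>\<nu>\<close>, then
  \<open>d(\<omega>\<^sup>2) = 0\<close> gives \<open>d\<nu> \<and> \<omega>\<^sup>2 = 0\<close>, so \<open>\<nu>\<close> is locally constant.

  Types are never split off by complexification: statements about them are replaced by real identities with
  \<open>J\<close> inserted in some slots, which treats \<open>\<epsilon> = \<plusminus>1\<close> uniformly.
\<close>

section \<open>Wedge product and contraction\<close>

text \<open>Why N and d psi^- correspond: the form \<open>tw\<close> is psi^+ with J in one slot.
  Inserting J into the first and into the second slot of its exterior derivative and adding collects
  all derivatives of psi^+ into two values of d psi^+, which vanish; the derivatives of J that
  remain are exactly those in N. The obstacle is that J comes from a definite description and a
  trace, so even J^2 = \<epsilon> must be derived. No normal form of psi is used. Two facts about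
  dimension six replace it: contracting a vanishing seven-form gives relations between six-forms,
  and a trace-free endomorphism acting as a derivation kills six-forms. K is trace-free because the
  metric is symmetric, which makes K skew for omega. For skew N, the form \<omega>(N(X,Y),Z) has
  type (3,0) + (0,3), hence lies in a plane spanned by psi and its twist. One direction of this
  plane yields the multiples of \<omega>^2; the other contradicts the symmetry of a four-form under
  exchange of pairs of slots. The coefficient \<nu> first exists separately at each point of each
  chart; naturality of d and of J makes it a function on M.\<close>

abbreviation vcons :: "'v \<Rightarrow> (nat \<Rightarrow> 'v) \<Rightarrow> nat \<Rightarrow> 'v" (infixr \<open>##\<close> 65) where
  "x ## v \<equiv> case_nat x v"

lemma vcons_head_tail: "v 0 ## (\<lambda>i. v (Suc i)) = v"
  by (auto split: nat.split)

lemma nth_Cons_vcons: "(!) (x # xs) = x ## (!) xs"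
  by (auto simp: nth_Cons)

lemma vcons_upd_0: "(x ## v)(0 := y) = y ## v"
  by (auto split: nat.split)

lemma vcons_upd_Suc: "(x ## v)(Suc i := y) = x ## v(i := y)"
  by (auto split: nat.split)

lemma contract_apply [simp]: "contract x \<alpha> v = \<alpha> (x ## v)"
  by (simp add: contract_def)

lemma pullback_apply [simp]: "pullback A \<alpha> v = \<alpha> (\<lambda>i. A (v i))"
  by (simp add: pullback_def)

lemma alt_form_cong:
  assumes "alt_form k \<alpha>" "\<And>i. i < k \<Longrightarrow> v i = w i"
  shows "\<alpha> v = \<alpha> w"
  using assms(1)[unfolded alt_form_def, THEN conjunct1, rule_format, of v w] assms(2) by simp

lemma alt_form_linear:
  assumes "alt_form k \<alpha>" "i < k"
  shows "linear (\<lambda>x. \<alpha> (v(i := x)))"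
  using assms unfolding alt_form_def by blast

lemma alt_form_eq_0:
  assumes "alt_form k \<alpha>" "i < k" "j < k" "i \<noteq> j" "v i = v j"
  shows "\<alpha> v = 0"
  using assms unfolding alt_form_def by blast

lemma alt_form_linear_head:
  assumes "alt_form (Suc k) \<alpha>"
  shows "linear (\<lambda>x. \<alpha> (x ## v))"
  using alt_form_linear[OF assms, of 0 "0 ## v"] by (simp add: vcons_upd_0)

lemma alt_form_linear_second:
  assumes "alt_form (Suc (Suc k)) \<alpha>"
  shows "linear (\<lambda>x. \<alpha> (y ## x ## v))"
  using alt_form_linear[OF assms, of 1 "y ## 0 ## v"] by (simp add: vcons_upd_0 vcons_upd_Suc)

lemma alt_form_linear_third:
  assumes "alt_form (Suc (Suc (Suc k))) \<alpha>"
  shows "linear (\<lambda>x. \<alpha> (y ## z ## x ## v))"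
  using alt_form_linear[OF assms, of 2 "y ## z ## 0 ## v"]
  by (simp add: vcons_upd_0 vcons_upd_Suc numeral_2_eq_2)

lemma alt_form_contract:
  assumes "alt_form (Suc k) \<alpha>"
  shows "alt_form k (contract x \<alpha>)"
  unfolding alt_form_def
proof (intro conjI allI impI)
  fix v w :: "nat \<Rightarrow> 'a"
  assume "\<forall>i<k. v i = w i"
  then show "contract x \<alpha> v = contract x \<alpha> w"
    using alt_form_cong[OF assms, of "x ## v" "x ## w"] by (auto split: nat.split)
next
  fix v :: "nat \<Rightarrow> 'a" and i assume "i < k"
  then show "linear (\<lambda>y. contract x \<alpha> (v(i := y)))"
    using alt_form_linear[OF assms, of "Suc i" "x ## v"] by (simp add: vcons_upd_Suc)
next
  fix v :: "nat \<Rightarrow> 'a" and i j assume "i < k" "j < k" "i \<noteq> j \<and> v i = v j"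
  then show "contract x \<alpha> v = 0"
    using alt_form_eq_0[OF assms, of "Suc i" "Suc j" "x ## v"] by simp
qed

lemma alt_form_swap:
  assumes \<alpha>: "alt_form k \<alpha>" and ij: "i < k" "j < k" "i \<noteq> j"
  shows "\<alpha> (\<lambda>m. v (Transposition.transpose i j m)) = - \<alpha> v"
proof -
  define f where "f = (\<lambda>x y. \<alpha> (v(i := x, j := y)))"
  have l1: "f (x + x') y = f x y + f x' y" for x x' y
  proof -
    have "f x y = \<alpha> ((v(j := y))(i := x))" for x
      unfolding f_def using ij by (simp add: fun_upd_twist)
    then show ?thesis
      using linear_add[OF alt_form_linear[OF \<alpha> ij(1), of "v(j := y)"]] by simp
  qed
  have l2: "f x (y + y') = f x y + f x y'" for x y y'
    unfolding f_def using linear_add[OF alt_form_linear[OF \<alpha> ij(2), of "v(i := x)"]] by simp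
  have l3: "f x x = 0" for x
    unfolding f_def using alt_form_eq_0[OF \<alpha> ij] by simp
  have "f (v i + v j) (v i + v j) = f (v i) (v i) + f (v i) (v j) + f (v j) (v i) + f (v j) (v j)"
    unfolding l1 l2 by simp
  then have "f (v i) (v j) + f (v j) (v i) = 0" by (simp add: l3)
  moreover have "f (v i) (v j) = \<alpha> v" unfolding f_def by simp
  moreover have "f (v j) (v i) = \<alpha> (\<lambda>m. v (Transposition.transpose i j m))"
    unfolding f_def by (rule arg_cong[of _ _ \<alpha>]) (auto simp: Transposition.transpose_def)
  ultimately show ?thesis by linarith
qed

lemma alt_form_head_swap:
  assumes "alt_form (Suc (Suc k)) \<alpha>"
  shows "\<alpha> (x ## y ## v) = - \<alpha> (y ## x ## v)"
proof -
  have "x ## y ## v = (\<lambda>m. (y ## x ## v) (Transposition.transpose 0 1 m))"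
    by (auto simp: Transposition.transpose_def split: nat.split)
  then show ?thesis using alt_form_swap[OF assms, of 0 1 "y ## x ## v"] by simp
qed

lemma alt_form_permute:
  assumes \<alpha>: "alt_form k \<alpha>" and p: "p permutes {..<k}"
  shows "\<alpha> (\<lambda>i. v (p i)) = of_int (sign p) * \<alpha> v"
proof -
  have "\<forall>v. \<alpha> (\<lambda>i. v (p i)) = of_int (sign p) * \<alpha> v"
    using finite_lessThan[of k] p
  proof (induction rule: permutes_rev_induct)
    case id show ?case by simp
  next
    case (swap a b p)
    have pp: "permutation p" using swap permutes_imp_permutation by blast
    have s: "sign (p \<circ> Transposition.transpose a b) = - sign p"
      using pp swap by (simp add: sign_compose permutation_swap_id sign_swap_id)
    have "\<alpha> (\<lambda>i. v ((p \<circ> Transposition.transpose a b) i))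
        = of_int (sign (p \<circ> Transposition.transpose a b)) * \<alpha> v" for v
      unfolding s using alt_form_swap[OF \<alpha>, of a b "\<lambda>i. v (p i)"] swap by simp
    then show ?case by blast
  qed
  then show ?thesis by blast
qed

text \<open>Permutations of \<open>{..<Suc n}\<close> with \<open>p j = 0\<close> are of the form \<open>perm_up q \<circ> cyc j\<close>.\<close>

definition perm_up :: "(nat \<Rightarrow> nat) \<Rightarrow> nat \<Rightarrow> nat" where
  "perm_up q = 0 ## (\<lambda>i. Suc (q i))"

definition cyc :: "nat \<Rightarrow> nat \<Rightarrow> nat" where
  "cyc j i = (if i = j then 0 else if i < j then Suc i else i)"

lemma perm_up_permutes_sign:
  assumes "q permutes {..<n}"
  shows "perm_up q permutes {..<Suc n} \<and> sign (perm_up q) = sign q"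
  using assms finite_lessThan
proof (induction rule: permutes_induct)
  case id
  have "perm_up id = id" by (auto simp: perm_up_def split: nat.split)
  then show ?case by (metis permutes_id sign_id)
next
  case (swap a b p)
  have e: "perm_up (Transposition.transpose a b \<circ> p)
      = Transposition.transpose (Suc a) (Suc b) \<circ> perm_up p"
    by (auto simp: perm_up_def Transposition.transpose_def split: nat.split)
  have 1: "permutation p" "permutation (perm_up p)"
    using swap permutes_imp_permutation by blast+
  have "Transposition.transpose (Suc a) (Suc b) permutes {..<Suc n}"
    by (rule permutes_swap_id) (use swap in auto)
  then have "perm_up (Transposition.transpose a b \<circ> p) permutes {..<Suc n}"
    unfolding e using swap by (blast intro: permutes_compose)
  moreover have "sign (perm_up (Transposition.transpose a b \<circ> p)) = sign (Transposition.transpose a b \<circ> p)"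
    unfolding e sign_compose[OF permutation_swap_id 1(1)] sign_compose[OF permutation_swap_id 1(2)]
    using swap by (simp add: sign_swap_id)
  ultimately show ?case by blast
qed

lemma cyc_permutes_sign:
  assumes "j < n"
  shows "cyc j permutes {..<n} \<and> sign (cyc j) = (- 1) ^ j"
  using assms
proof (induction j)
  case 0
  have "cyc 0 = id" by (auto simp: cyc_def)
  then show ?case by (metis permutes_id sign_id power_0)
next
  case (Suc j)
  have e: "cyc (Suc j) = cyc j \<circ> Transposition.transpose j (Suc j)"
    by (auto simp: cyc_def Transposition.transpose_def)
  have IH: "cyc j permutes {..<n}" "sign (cyc j) = (- 1) ^ j" using Suc by auto
  have 1: "permutation (cyc j)" using IH permutes_imp_permutation by blast
  have "Transposition.transpose j (Suc j) permutes {..<n}"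
    by (rule permutes_swap_id) (use Suc in auto)
  then have "cyc (Suc j) permutes {..<n}"
    unfolding e using IH by (blast intro: permutes_compose)
  moreover have "sign (cyc (Suc j)) = (- 1) ^ Suc j"
    unfolding e sign_compose[OF 1 permutation_swap_id] using IH by (simp add: sign_swap_id)
  ultimately show ?case by blast
qed

lemma perm_up_decompose:
  assumes p: "p permutes {..<Suc n}" and p0: "p 0 = 0"
  obtains q where "q permutes {..<n}" "p = perm_up q"
proof
  define q where "q = (\<lambda>i. p (Suc i) - 1)"
  have pos: "p (Suc i) \<noteq> 0" for i
    using permutes_inj[OF p] p0 by (metis injD nat.simps(3))
  show e: "p = perm_up q"
    using p0 pos by (auto simp: perm_up_def q_def split: nat.split)
  show "q permutes {..<n}"
  proof (rule bij_imp_permutes)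
    have in1: "q i < n" if "i < n" for i
      using permutes_in_image[OF p, of "Suc i"] that pos[of i] by (auto simp: q_def)
    have in2: "inj_on q {..<n}"
    proof (rule inj_onI)
      fix x y assume "q x = q y"
      then have "p (Suc x) = p (Suc y)" using pos[of x] pos[of y] by (simp add: q_def)
      then show "x = y" using permutes_inj[OF p] by (auto dest: injD)
    qed
    show "bij_betw q {..<n} {..<n}"
      using in1 in2 endo_inj_surj[of "{..<n}" q] by (auto simp: bij_betw_def)
    show "q x = x" if "x \<notin> {..<n}" for x
      using permutes_not_in[OF p, of "Suc x"] that by (simp add: q_def)
  qed
qed

lemma sum_permutes_fixed:
  fixes F :: "(nat \<Rightarrow> nat) \<Rightarrow> real"
  assumes j: "j < Suc n"
  shows "(\<Sum>p | p permutes {..<Suc n} \<and> p j = 0. F p)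
    = (\<Sum>q | q permutes {..<n}. F (perm_up q \<circ> cyc j))"
proof (rule sum.reindex_cong[where l = "\<lambda>q. perm_up q \<circ> cyc j"])
  have c: "cyc j permutes {..<Suc n}" using cyc_permutes_sign[OF j] by blast
  have ic: "inv (cyc j) permutes {..<Suc n}" by (rule permutes_inv[OF c])
  show "inj_on (\<lambda>q. perm_up q \<circ> cyc j) {q. q permutes {..<n}}"
  proof (rule inj_onI)
    fix q q' assume "perm_up q \<circ> cyc j = perm_up q' \<circ> cyc j"
    then have "(perm_up q \<circ> cyc j) \<circ> inv (cyc j) = (perm_up q' \<circ> cyc j) \<circ> inv (cyc j)" by simp
    then have *: "perm_up q = perm_up q'"
      by (simp add: comp_assoc permutes_inv_o(1)[OF c])
    have "q i = q' i" for i
      using fun_cong[OF *, of "Suc i"] by (simp add: perm_up_def)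
    then show "q = q'" by auto
  qed
  show "{p. p permutes {..<Suc n} \<and> p j = 0} = (\<lambda>q. perm_up q \<circ> cyc j) ` {q. q permutes {..<n}}"
  proof (intro equalityI subsetI)
    fix p assume "p \<in> {p. p permutes {..<Suc n} \<and> p j = 0}"
    then have p: "p permutes {..<Suc n}" "p j = 0" by auto
    have "inv (cyc j) 0 = j"
      using c by (metis cyc_def permutes_inv_eq)
    then have "(p \<circ> inv (cyc j)) 0 = 0" using p by simp
    moreover have "p \<circ> inv (cyc j) permutes {..<Suc n}"
      by (rule permutes_compose[OF ic p(1)])
    ultimately obtain q where q: "q permutes {..<n}" "p \<circ> inv (cyc j) = perm_up q"
      using perm_up_decompose by blast
    then have "p = perm_up q \<circ> cyc j"
      by (metis (no_types) comp_assoc comp_id permutes_inv_o(2)[OF c])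
    then show "p \<in> (\<lambda>q. perm_up q \<circ> cyc j) ` {q. q permutes {..<n}}" using q by blast
  next
    fix p assume "p \<in> (\<lambda>q. perm_up q \<circ> cyc j) ` {q. q permutes {..<n}}"
    then obtain q where "q permutes {..<n}" "p = perm_up q \<circ> cyc j" by blast
    then show "p \<in> {p. p permutes {..<Suc n} \<and> p j = 0}"
      using perm_up_permutes_sign[of q n] c
      by (auto intro: permutes_compose simp: perm_up_def cyc_def)
  qed
qed simp

text \<open>Contraction is an antiderivation. The permutations are sorted by the slot j that
  receives x. All j < k contribute equally, and so do all j \<ge> k; these multiplicities k and l
  turn the factorials in the definition into those of the two smaller products.\<close>

lemma wedge_vcons:
  assumes \<alpha>: "alt_form k \<alpha>" and \<beta>: "alt_form l \<beta>" and kl: "k + l \<noteq> 0"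
  shows "wedge k l \<alpha> \<beta> (x ## v) =
      (if k = 0 then 0 else wedge (k - 1) l (contract x \<alpha>) \<beta> v)
      + (if l = 0 then 0 else (- 1) ^ k * wedge k (l - 1) \<alpha> (contract x \<beta>) v)"
proof -
  obtain n where n: "k + l = Suc n" using kl by (cases "k + l") auto
  define w where "w = x ## v"
  define P where "P = {p. p permutes {..<Suc n}}"
  define F where "F p = of_int (sign p) * \<alpha> (\<lambda>i. w (p i)) * \<beta> (\<lambda>i. w (p (k + i)))" for p
  define S where "S j = (\<Sum>p | p permutes {..<Suc n} \<and> p j = 0. F p)" for j
  have finP: "finite P" unfolding P_def by (rule finite_permutations) simp
  have perm: "permutation p" if "p permutes {..<Suc n}" for p
    using that permutes_imp_permutation by blast
  have tot: "(\<Sum>p\<in>P. F p) = (\<Sum>j<Suc n. S j)"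
  proof -
    have ex: "(\<Sum>j<Suc n. if p j = 0 then F p else 0) = F p" if p: "p \<in> P" for p
    proof -
      define j where "j = inv p 0"
      have pp: "p permutes {..<Suc n}" using p P_def by simp
      have j: "(p i = 0) = (i = j)" for i
        unfolding j_def using permutes_inv_eq[OF pp] by metis
      have "j < Suc n"
        using permutes_in_image[OF permutes_inv[OF pp], of 0] by (simp add: j_def)
      then show ?thesis by (simp add: j)
    qed
    have Sj: "(\<Sum>p\<in>P. if p j = 0 then F p else 0) = S j" for j
    proof -
      have "{p. p permutes {..<Suc n} \<and> p j = 0} = {p \<in> P. p j = 0}" by (auto simp: P_def)
      then show ?thesis by (simp only: S_def sum.inter_filter[OF finP])
    qed
    have "(\<Sum>p\<in>P. F p) = (\<Sum>p\<in>P. \<Sum>j<Suc n. if p j = 0 then F p else 0)"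
      by (intro sum.cong refl) (simp only: ex)
    also have "\<dots> = (\<Sum>j<Suc n. \<Sum>p\<in>P. if p j = 0 then F p else 0)" by (rule sum.swap)
    also have "\<dots> = (\<Sum>j<Suc n. S j)"
      by (simp only: Sj)
    finally show ?thesis .
  qed
  \<comment> \<open>Moving the position of \<open>x\<close> inside one factor by a transposition \<open>\<tau>\<close> costs the sign of \<open>\<tau>\<close> twice.\<close>
  have tr: "S j = S i" if "F_inv": "\<And>p. p \<in> P \<Longrightarrow> F (p \<circ> Transposition.transpose i j) = F p"
    and ij: "i < Suc n" "j < Suc n" for i j
    unfolding S_def
  proof (rule sum.reindex_bij_witness[where i = "\<lambda>p. p \<circ> Transposition.transpose i j"
        and j = "\<lambda>p. p \<circ> Transposition.transpose i j"])
    have t: "Transposition.transpose i j permutes {..<Suc n}"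
      by (rule permutes_swap_id) (use ij in auto)
    fix p assume p: "p \<in> {p. p permutes {..<Suc n} \<and> p j = 0}"
    show "p \<circ> Transposition.transpose i j \<circ> Transposition.transpose i j = p"
      by (simp add: comp_assoc)
    show "p \<circ> Transposition.transpose i j \<in> {p. p permutes {..<Suc n} \<and> p i = 0}"
      using p permutes_compose[OF t] by auto
    show "F (p \<circ> Transposition.transpose i j) = F p" using p that by (auto simp: P_def)
  next
    have t: "Transposition.transpose i j permutes {..<Suc n}"
      by (rule permutes_swap_id) (use ij in auto)
    fix p assume p: "p \<in> {p. p permutes {..<Suc n} \<and> p i = 0}"
    show "p \<circ> Transposition.transpose i j \<circ> Transposition.transpose i j = p"
      by (simp add: comp_assoc)
    show "p \<circ> Transposition.transpose i j \<in> {p. p permutes {..<Suc n} \<and> p j = 0}"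
      using p permutes_compose[OF t] by auto
  qed
  have S1: "S j = S 0" if j: "j < k" for j
  proof (cases "j = 0")
    case False
    show ?thesis
    proof (rule tr)
      fix p assume p: "p \<in> P"
      have "sign (p \<circ> Transposition.transpose 0 j) = - sign p"
        using perm p False by (auto simp: P_def sign_compose permutation_swap_id sign_swap_id)
      moreover have "\<alpha> (\<lambda>i. w ((p \<circ> Transposition.transpose 0 j) i)) = - \<alpha> (\<lambda>i. w (p i))"
        using alt_form_swap[OF \<alpha>, of 0 j "\<lambda>i. w (p i)"] False j by simp
      moreover have "(p \<circ> Transposition.transpose 0 j) (k + i) = p (k + i)" for i
        using j by (simp add: Transposition.transpose_def)
      ultimately show "F (p \<circ> Transposition.transpose 0 j) = F p" by (simp add: F_def)
    qed (use j n in auto)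
  qed simp
  have S2: "S j = S k" if j: "k \<le> j" "j < k + l" for j
  proof (cases "j = k")
    case False
    show ?thesis
    proof (rule tr)
      fix p assume p: "p \<in> P"
      have "sign (p \<circ> Transposition.transpose k j) = - sign p"
        using perm p False by (auto simp: P_def sign_compose permutation_swap_id sign_swap_id)
      moreover have "\<alpha> (\<lambda>i. w ((p \<circ> Transposition.transpose k j) i)) = \<alpha> (\<lambda>i. w (p i))"
        by (rule alt_form_cong[OF \<alpha>]) (use j in \<open>simp add: Transposition.transpose_def\<close>)
      moreover have "(\<lambda>i. w ((p \<circ> Transposition.transpose k j) (k + i)))
          = (\<lambda>i. w (p (k + Transposition.transpose 0 (j - k) i)))"
        using j by (auto simp: fun_eq_iff Transposition.transpose_def)
      moreover have "\<beta> (\<lambda>i. w (p (k + Transposition.transpose 0 (j - k) i))) = - \<beta> (\<lambda>i. w (p (k + i)))"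
        using alt_form_swap[OF \<beta>, of 0 "j - k" "\<lambda>i. w (p (k + i))"] False j by auto
      ultimately show "F (p \<circ> Transposition.transpose k j) = F p" by (simp add: F_def)
    qed (use j n in auto)
  qed simp
  have sgn: "sign (perm_up q \<circ> cyc j) = (- 1) ^ j * sign q"
    if "q permutes {..<n}" "j < Suc n" for q j
  proof -
    have "permutation (perm_up q)" "permutation (cyc j)"
      using perm_up_permutes_sign[OF that(1)] cyc_permutes_sign[OF that(2)] perm by blast+
    then show ?thesis
      using perm_up_permutes_sign[OF that(1)] cyc_permutes_sign[OF that(2)]
      by (simp add: sign_compose)
  qed
  have c0: "cyc 0 = id" by (auto simp: cyc_def)
  have T1: "real k * S 0 = fact k * fact l *
      (if k = 0 then 0 else wedge (k - 1) l (contract x \<alpha>) \<beta> v)"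
  proof (cases k)
    case (Suc k')
    have n': "n = k' + l" using n Suc by simp
    have "S 0 = (\<Sum>q | q permutes {..<n}. F (perm_up q))"
      unfolding S_def using sum_permutes_fixed[of 0 n F] by (simp add: c0)
    also have "\<dots> = (\<Sum>q | q permutes {..<n}. of_int (sign q) * contract x \<alpha> (\<lambda>i. v (q i)) * \<beta> (\<lambda>i. v (q (k' + i))))"
    proof (intro sum.cong refl)
      fix q assume q: "q \<in> {q. q permutes {..<n}}"
      have "(\<lambda>i. w (perm_up q i)) = x ## (\<lambda>i. v (q i))"
        by (auto simp: w_def perm_up_def split: nat.split)
      moreover have "(\<lambda>i. w (perm_up q (k + i))) = (\<lambda>i. v (q (k' + i)))"
        by (auto simp: w_def perm_up_def Suc)
      ultimately show "F (perm_up q) = of_int (sign q) * contract x \<alpha> (\<lambda>i. v (q i)) * \<beta> (\<lambda>i. v (q (k' + i)))"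
        using perm_up_permutes_sign[of q n] q unfolding F_def by simp
    qed
    finally have "S 0 = fact k' * fact l * wedge k' l (contract x \<alpha>) \<beta> v"
      unfolding wedge_def n' by simp
    then show ?thesis by (simp add: Suc)
  qed simp
  have T2: "real l * S k = fact k * fact l *
      (if l = 0 then 0 else (- 1) ^ k * wedge k (l - 1) \<alpha> (contract x \<beta>) v)"
  proof (cases l)
    case (Suc l')
    have n': "n = k + l'" using n Suc by simp
    have "S k = (\<Sum>q | q permutes {..<n}. F (perm_up q \<circ> cyc k))"
      unfolding S_def using sum_permutes_fixed[of k n F] n' by simp
    also have "\<dots> = (\<Sum>q | q permutes {..<n}. (- 1) ^ k * (of_int (sign q) * \<alpha> (\<lambda>i. v (q i)) * contract x \<beta> (\<lambda>i. v (q (k + i)))))"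
    proof (intro sum.cong refl)
      fix q assume q: "q \<in> {q. q permutes {..<n}}"
      have "\<alpha> (\<lambda>i. w ((perm_up q \<circ> cyc k) i)) = \<alpha> (\<lambda>i. v (q i))"
        by (rule alt_form_cong[OF \<alpha>]) (auto simp: w_def perm_up_def cyc_def)
      moreover have "(\<lambda>i. w ((perm_up q \<circ> cyc k) (k + i))) = x ## (\<lambda>i. v (q (k + i)))"
        by (auto simp: w_def perm_up_def cyc_def split: nat.split)
      ultimately show "F (perm_up q \<circ> cyc k) = (- 1) ^ k * (of_int (sign q) * \<alpha> (\<lambda>i. v (q i)) * contract x \<beta> (\<lambda>i. v (q (k + i))))"
        using sgn[of q k] q n' unfolding F_def by simp
    qed
    finally have "S k = fact k * fact l' * ((- 1) ^ k * wedge k l' \<alpha> (contract x \<beta>) v)"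
      unfolding wedge_def n' sum_distrib_left[symmetric] by simp
    then show ?thesis by (simp add: Suc)
  qed simp
  have "(\<Sum>j<k + m. S j) = (\<Sum>j<k. S j) + (\<Sum>j=k..<k+m. S j)" for m
    by (induction m) simp_all
  from this[of l] have "(\<Sum>j<Suc n. S j) = (\<Sum>j<k. S j) + (\<Sum>j=k..<k+l. S j)"
    by (simp only: n)
  also have "(\<Sum>j<k. S j) = (\<Sum>j<k. S 0)" by (intro sum.cong refl S1) simp
  also have "(\<Sum>j=k..<k+l. S j) = (\<Sum>j=k..<k+l. S k)" by (intro sum.cong refl S2) auto
  finally have "(\<Sum>p\<in>P. F p) = fact k * fact l *
      ((if k = 0 then 0 else wedge (k - 1) l (contract x \<alpha>) \<beta> v)
      + (if l = 0 then 0 else (- 1) ^ k * wedge k (l - 1) \<alpha> (contract x \<beta>) v))"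
    unfolding tot by (simp add: T1 T2 distrib_left)
  moreover have "wedge k l \<alpha> \<beta> (x ## v) = (1 / (fact k * fact l)) * (\<Sum>p\<in>P. F p)"
    unfolding wedge_def n P_def F_def w_def by simp
  ultimately show ?thesis by simp
qed

text \<open>A zero-form is constant, so it may be read off at any \<open>u\<close>. The sign of each
  permutation occurs twice and cancels.\<close>

lemma wedge_0_left:
  assumes \<alpha>: "alt_form 0 \<alpha>" and \<beta>: "alt_form l \<beta>"
  shows "wedge 0 l \<alpha> \<beta> v = \<alpha> u * \<beta> v"
proof -
  have c: "\<alpha> w = \<alpha> u" for w by (rule alt_form_cong[OF \<alpha>]) simp
  have sq: "of_int (sign p) * of_int (sign p) = (1::real)" for p :: "nat \<Rightarrow> nat"
    by (cases p rule: sign_cases) auto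
  have "of_int (sign p) * \<alpha> (\<lambda>i. v (p i)) * \<beta> (\<lambda>i. v (p (0 + i))) = \<alpha> u * \<beta> v"
    if "p permutes {..<l}" for p
    using sq[of p] alt_form_permute[OF \<beta> that, of v] c[of "\<lambda>i. v (p i)"] by (simp add: algebra_simps)
  then have "wedge 0 l \<alpha> \<beta> v = (1 / fact l) * (\<Sum>p | p permutes {..<l}. \<alpha> u * \<beta> v)"
    unfolding wedge_def by simp
  also have "\<dots> = \<alpha> u * \<beta> v" by (simp add: card_permutations)
  finally show ?thesis .
qed

lemma wedge_0_right:
  assumes \<alpha>: "alt_form k \<alpha>" and \<beta>: "alt_form 0 \<beta>"
  shows "wedge k 0 \<alpha> \<beta> v = \<alpha> v * \<beta> u"
proof -
  have c: "\<beta> w = \<beta> u" for w by (rule alt_form_cong[OF \<beta>]) simp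
  have sq: "of_int (sign p) * of_int (sign p) = (1::real)" for p :: "nat \<Rightarrow> nat"
    by (cases p rule: sign_cases) auto
  have "of_int (sign p) * \<alpha> (\<lambda>i. v (p i)) * \<beta> (\<lambda>i. v (p (k + i))) = \<alpha> v * \<beta> u"
    if "p permutes {..<k}" for p
    using sq[of p] alt_form_permute[OF \<alpha> that, of v] c[of "\<lambda>i. v (p (k + i))"] by (simp add: algebra_simps)
  then have "wedge k 0 \<alpha> \<beta> v = (1 / fact k) * (\<Sum>p | p permutes {..<k}. \<alpha> v * \<beta> u)"
    unfolding wedge_def by simp
  also have "\<dots> = \<alpha> v * \<beta> u" by (simp add: card_permutations)
  finally show ?thesis .
qed

lemma alt_form_wedge:
  assumes \<alpha>: "alt_form k \<alpha>" and \<beta>: "alt_form l \<beta>"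
  shows "alt_form (k + l) (wedge k l \<alpha> \<beta>)"
  unfolding alt_form_def
proof (intro conjI allI impI)
  fix v w :: "nat \<Rightarrow> 'a" assume vw: "\<forall>i<k + l. v i = w i"
  have "\<alpha> (\<lambda>i. v (p i)) = \<alpha> (\<lambda>i. w (p i))" "\<beta> (\<lambda>i. v (p (k + i))) = \<beta> (\<lambda>i. w (p (k + i)))"
    if p: "p permutes {..<k + l}" for p
    using permutes_in_image[OF p] vw
    by (auto intro!: alt_form_cong[OF \<alpha>] alt_form_cong[OF \<beta>])
  then show "wedge k l \<alpha> \<beta> v = wedge k l \<alpha> \<beta> w"
    unfolding wedge_def by simp
next
  fix v :: "nat \<Rightarrow> 'a" and i assume i: "i < k + l"
  have "linear (\<lambda>x. of_int (sign p) * \<alpha> (\<lambda>m. (v(i := x)) (p m)) * \<beta> (\<lambda>m. (v(i := x)) (p (k + m))))"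
    if p: "p permutes {..<k + l}" for p
  proof -
    define j where "j = inv p i"
    have j: "(p m = i) = (m = j)" for m
      unfolding j_def using permutes_inv_eq[OF p] by metis
    have jkl: "j < k + l" using permutes_in_image[OF permutes_inv[OF p], of i] i by (simp add: j_def)
    have a: "(\<lambda>m. (v(i := x)) (p m)) = (\<lambda>m. v (p m))(j := x)" for x
      using j by auto
    show ?thesis
    proof (cases "j < k")
      case True
      have "(\<lambda>m. (v(i := x)) (p (k + m))) = (\<lambda>m. v (p (k + m)))" for x
        using j True by auto
      then show ?thesis unfolding a
        using alt_form_linear[OF \<alpha> True, of "\<lambda>m. v (p m)"]
        by (auto simp: linear_iff algebra_simps)
    next
      case False
      have "\<alpha> (\<lambda>m. (v(i := x)) (p m)) = \<alpha> (\<lambda>m. v (p m))" for x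
        by (rule alt_form_cong[OF \<alpha>]) (use j False in auto)
      moreover have "(\<lambda>m. (v(i := x)) (p (k + m))) = (\<lambda>m. v (p (k + m)))(j - k := x)" for x
        using j False by (auto simp: fun_eq_iff)
      moreover have "j - k < l" using False jkl by auto
      ultimately show ?thesis
        using alt_form_linear[OF \<beta>, of "j - k" "\<lambda>m. v (p (k + m))"]
        by (auto simp: linear_iff algebra_simps)
    qed
  qed
  then have "linear (\<lambda>x. \<Sum>p | p permutes {..<k + l}. of_int (sign p) *
      \<alpha> (\<lambda>m. (v(i := x)) (p m)) * \<beta> (\<lambda>m. (v(i := x)) (p (k + m))))"
    by (intro linear_compose_sum) auto
  then show "linear (\<lambda>x. wedge k l \<alpha> \<beta> (v(i := x)))"
    unfolding wedge_def by (rule linear_compose_scale_right[where 'b = real, unfolded real_scaleR_def])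
next
  fix v :: "nat \<Rightarrow> 'a" and i j assume i: "i < k + l" and j: "j < k + l" and ij: "i \<noteq> j \<and> v i = v j"
  define F where "F p = of_int (sign p) * \<alpha> (\<lambda>i. v (p i)) * \<beta> (\<lambda>i. v (p (k + i)))" for p
  define t where "t = Transposition.transpose i j"
  have t: "t permutes {..<k + l}" unfolding t_def by (rule permutes_swap_id) (use i j in auto)
  have vt: "v (t m) = v m" for m using ij by (auto simp: t_def Transposition.transpose_def)
  \<comment> \<open>Exchanging the two equal arguments pairs every permutation with one of opposite
    sign.\<close>
  have Ft: "F (t \<circ> p) = - F p" if "p permutes {..<k + l}" for p
  proof -
    have "permutation p" using that permutes_imp_permutation by blast
    then have "sign (t \<circ> p) = - sign p"
      using ij by (simp add: t_def sign_compose permutation_swap_id sign_swap_id)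
    then show ?thesis by (simp add: F_def vt)
  qed
  have "(\<Sum>p | p permutes {..<k + l}. F p) = (\<Sum>p | p permutes {..<k + l}. F (t \<circ> p))"
    by (rule sum.reindex_bij_witness[where i = "\<lambda>p. t \<circ> p" and j = "\<lambda>p. t \<circ> p"])
      (auto simp: t_def comp_assoc[symmetric] intro: permutes_compose[OF _ t[unfolded t_def]])
  also have "\<dots> = - (\<Sum>p | p permutes {..<k + l}. F p)"
    by (simp add: Ft sum_negf)
  finally show "wedge k l \<alpha> \<beta> v = 0"
    unfolding wedge_def F_def by simp
qed

lemma alt_form_zero: "alt_form k (\<lambda>v. 0)"
  by (auto simp: alt_form_def linear_iff)

lemma alt_form_add:
  assumes "alt_form k \<alpha>" "alt_form k \<beta>"
  shows "alt_form k (\<lambda>v. \<alpha> v + \<beta> v)"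
  unfolding alt_form_def
proof (intro conjI allI impI)
  fix v w :: "nat \<Rightarrow> 'a" assume "\<forall>i<k. v i = w i"
  then show "\<alpha> v + \<beta> v = \<alpha> w + \<beta> w"
    using alt_form_cong[OF assms(1), of v w] alt_form_cong[OF assms(2), of v w] by simp
next
  fix v :: "nat \<Rightarrow> 'a" and i assume "i < k"
  then show "linear (\<lambda>x. \<alpha> (v(i := x)) + \<beta> (v(i := x)))"
    using alt_form_linear[OF assms(1), of i v] alt_form_linear[OF assms(2), of i v]
    by (intro linear_compose_add)
next
  fix v :: "nat \<Rightarrow> 'a" and i j assume "i < k" "j < k" "i \<noteq> j \<and> v i = v j"
  then show "\<alpha> v + \<beta> v = 0"
    using alt_form_eq_0[OF assms(1), of i j v] alt_form_eq_0[OF assms(2), of i j v] by simp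
qed

lemma alt_form_scale:
  assumes "alt_form k \<alpha>"
  shows "alt_form k (\<lambda>v. c * \<alpha> v)"
  unfolding alt_form_def
proof (intro conjI allI impI)
  fix v w :: "nat \<Rightarrow> 'a" assume "\<forall>i<k. v i = w i"
  then show "c * \<alpha> v = c * \<alpha> w"
    using alt_form_cong[OF assms, of v w] by simp
next
  fix v :: "nat \<Rightarrow> 'a" and i assume "i < k"
  then show "linear (\<lambda>x. c * \<alpha> (v(i := x)))"
    using linear_compose_scale_right[OF alt_form_linear[OF assms, of i v], of c] by simp
next
  fix v :: "nat \<Rightarrow> 'a" and i j assume "i < k" "j < k" "i \<noteq> j \<and> v i = v j"
  then show "c * \<alpha> v = 0" using alt_form_eq_0[OF assms, of i j v] by simp
qed

lemma alt_form_diff: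
  assumes "alt_form k \<alpha>" "alt_form k \<beta>"
  shows "alt_form k (\<lambda>v. \<alpha> v - \<beta> v)"
  using alt_form_add[OF assms(1) alt_form_scale[OF assms(2), of "-1"]] by simp

lemma alt_form_sum:
  assumes "\<And>i. i \<in> I \<Longrightarrow> alt_form k (\<alpha> i)"
  shows "alt_form k (\<lambda>v. \<Sum>i\<in>I. \<alpha> i v)"
  using assms by (induction I rule: infinite_finite_induct) (auto intro: alt_form_zero alt_form_add)

lemma wedge_add_left: "wedge k l (\<lambda>v. \<alpha> v + \<alpha>' v) \<beta> v = wedge k l \<alpha> \<beta> v + wedge k l \<alpha>' \<beta> v"
  by (simp add: wedge_def algebra_simps sum.distrib add_divide_distrib)

lemma wedge_add_right: "wedge k l \<alpha> (\<lambda>v. \<beta> v + \<beta>' v) v = wedge k l \<alpha> \<beta> v + wedge k l \<alpha> \<beta>' v"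
  by (simp add: wedge_def algebra_simps sum.distrib add_divide_distrib)

lemma wedge_scale_left: "wedge k l (\<lambda>v. c * \<alpha> v) \<beta> v = c * wedge k l \<alpha> \<beta> v"
  by (simp add: wedge_def algebra_simps sum_distrib_left)

lemma wedge_scale_right: "wedge k l \<alpha> (\<lambda>v. c * \<beta> v) v = c * wedge k l \<alpha> \<beta> v"
  by (simp add: wedge_def algebra_simps sum_distrib_left)

lemma wedge_diff_right: "wedge k l \<alpha> (\<lambda>v. \<beta> v - \<beta>' v) v = wedge k l \<alpha> \<beta> v - wedge k l \<alpha> \<beta>' v"
  using wedge_add_right[of k l \<alpha> \<beta> "\<lambda>v. -1 * \<beta>' v"] wedge_scale_right[of k l \<alpha> "-1" \<beta>'] by simp

lemma wedge_zero_left: "wedge k l (\<lambda>v. 0) \<beta> = (\<lambda>v. 0)"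
  by (simp add: wedge_def)

lemma wedge_zero_right: "wedge k l \<alpha> (\<lambda>v. 0) = (\<lambda>v. 0)"
  by (simp add: wedge_def)

lemma wedge_sum_left: "wedge k l (\<lambda>v. \<Sum>i\<in>I. \<alpha> i v) \<beta> v = (\<Sum>i\<in>I. wedge k l (\<alpha> i) \<beta> v)"
  by (induction I rule: infinite_finite_induct) (auto simp: wedge_zero_left wedge_add_left)

lemma pullback_wedge: "pullback A (wedge k l \<alpha> \<beta>) = wedge k l (pullback A \<alpha>) (pullback A \<beta>)"
  by (simp add: wedge_def pullback_def)

text \<open>A zero-form must contract to zero, whereas \<open>contract\<close> would return its
  constant value. With this version the antiderivation rule holds in every positive total degree
  without a case split.\<close>

definition contract0 :: "nat \<Rightarrow> 'v \<Rightarrow> 'v form \<Rightarrow> 'v form" where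
  "contract0 k x \<alpha> = (if k = 0 then (\<lambda>v. 0) else contract x \<alpha>)"

lemma contract0_0 [simp]: "contract0 0 x \<alpha> = (\<lambda>v. 0)"
  and contract0_Suc [simp]: "contract0 (Suc k) x \<alpha> = contract x \<alpha>"
  by (simp_all add: contract0_def)

lemma wedge_vcons0:
  assumes "alt_form k \<alpha>" "alt_form l \<beta>" "k + l \<noteq> 0"
  shows "wedge k l \<alpha> \<beta> (x ## v) = wedge (k - 1) l (contract0 k x \<alpha>) \<beta> v
      + (- 1) ^ k * wedge k (l - 1) \<alpha> (contract0 l x \<beta>) v"
  using wedge_vcons[OF assms] by (auto simp: contract0_def wedge_zero_left wedge_zero_right)

lemma wedge_Suc_Suc:
  assumes "alt_form (Suc k) \<alpha>" "alt_form (Suc l) \<beta>"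
  shows "wedge (Suc k) (Suc l) \<alpha> \<beta> (x ## v) = wedge k (Suc l) (contract x \<alpha>) \<beta> v
      + (- 1) ^ (Suc k) * wedge (Suc k) l \<alpha> (contract x \<beta>) v"
  using wedge_vcons[OF assms] by simp

text \<open>Induction on the total degree: both sides obey the same recursion under contraction, so
  no block permutation and its sign have to be handled.\<close>

lemma wedge_comm:
  assumes "alt_form k \<alpha>" "alt_form l \<beta>"
  shows "wedge k l \<alpha> \<beta> v = (- 1) ^ (k * l) * wedge l k \<beta> \<alpha> v"
  using assms
proof (induction "k + l" arbitrary: k l \<alpha> \<beta> v)
  case 0
  then have "k = 0" "l = 0" by auto
  with 0 show ?case
    using wedge_0_left[of \<alpha> 0 \<beta> v v] wedge_0_left[of \<beta> 0 \<alpha> v v] by simp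
next
  case (Suc n)
  obtain x u where v: "v = x ## u" by (metis vcons_head_tail)
  have 1: "wedge (k - 1) l (contract0 k x \<alpha>) \<beta> u
      = (- 1) ^ (k * l) * ((- 1) ^ l * wedge l (k - 1) \<beta> (contract0 k x \<alpha>) u)"
  proof (cases k)
    case (Suc k')
    then show ?thesis
      using Suc.hyps(1)[of k' l "contract x \<alpha>" \<beta> u] Suc.hyps(2) Suc.prems
      by (simp add: alt_form_contract power_add mult.assoc[symmetric] power_mult_distrib[symmetric])
  qed (simp add: wedge_zero_left wedge_zero_right)
  have 2: "(- 1) ^ k * wedge k (l - 1) \<alpha> (contract0 l x \<beta>) u
      = (- 1) ^ (k * l) * wedge (l - 1) k (contract0 l x \<beta>) \<alpha> u"
  proof (cases l)
    case (Suc l')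
    then show ?thesis
      using Suc.hyps(1)[of k l' \<alpha> "contract x \<beta>" u] Suc.hyps(2) Suc.prems
      by (simp add: alt_form_contract power_add mult.assoc[symmetric] power_mult_distrib[symmetric])
  qed (simp add: wedge_zero_left wedge_zero_right)
  have "k + l \<noteq> 0" "l + k \<noteq> 0" using Suc.hyps(2) by auto
  then show ?case
    unfolding v wedge_vcons0[OF Suc.prems \<open>k + l \<noteq> 0\<close>] wedge_vcons0[OF Suc.prems(2,1) \<open>l + k \<noteq> 0\<close>] 1 2
    by (simp only: distrib_left add.commute)
qed

lemma wedge_wedge_vcons0:
  assumes a: "alt_form k \<alpha>" and b: "alt_form l \<beta>" and c: "alt_form m \<gamma>" and "k + l + m \<noteq> 0"
  shows "wedge k (l + m) \<alpha> (wedge l m \<beta> \<gamma>) (x ## v) =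
      wedge (k - 1) (l + m) (contract0 k x \<alpha>) (wedge l m \<beta> \<gamma>) v
      + (- 1) ^ k * wedge k (l - 1 + m) \<alpha> (wedge (l - 1) m (contract0 l x \<beta>) \<gamma>) v
      + (- 1) ^ (k + l) * wedge k (l + (m - 1)) \<alpha> (wedge l (m - 1) \<beta> (contract0 m x \<gamma>)) v"
proof -
  have bc: "alt_form (l + m) (wedge l m \<beta> \<gamma>)" by (rule alt_form_wedge[OF b c])
  have "wedge k (l + m - 1) \<alpha> (contract0 (l + m) x (wedge l m \<beta> \<gamma>)) v
     = wedge k (l - 1 + m) \<alpha> (wedge (l - 1) m (contract0 l x \<beta>) \<gamma>) v
      + (- 1) ^ l * wedge k (l + (m - 1)) \<alpha> (wedge l (m - 1) \<beta> (contract0 m x \<gamma>)) v"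
  proof (cases "l + m = 0")
    case True
    then show ?thesis by (simp add: wedge_zero_right wedge_zero_left)
  next
    case False
    have e: "contract0 (l + m) x (wedge l m \<beta> \<gamma>) = (\<lambda>v. wedge (l - 1) m (contract0 l x \<beta>) \<gamma> v
      + (- 1) ^ l * wedge l (m - 1) \<beta> (contract0 m x \<gamma>) v)"
      using False wedge_vcons0[OF b c] by (auto simp: contract0_def fun_eq_iff)
    have "wedge k (l + m - 1) \<alpha> (wedge (l - 1) m (contract0 l x \<beta>) \<gamma>) v
        = wedge k (l - 1 + m) \<alpha> (wedge (l - 1) m (contract0 l x \<beta>) \<gamma>) v"
      by (cases l) (auto simp: wedge_zero_right wedge_zero_left)
    moreover have "wedge k (l + m - 1) \<alpha> (wedge l (m - 1) \<beta> (contract0 m x \<gamma>)) v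
        = wedge k (l + (m - 1)) \<alpha> (wedge l (m - 1) \<beta> (contract0 m x \<gamma>)) v"
      by (cases m) (auto simp: wedge_zero_right wedge_zero_left)
    ultimately show ?thesis
      unfolding e wedge_add_right wedge_scale_right by simp
  qed
  then show ?thesis
    using wedge_vcons0[OF a bc, of x v] assms(4) by (simp add: algebra_simps power_add)
qed

text \<open>Associativity and graded commutativity in one rule, for products nested to the right. It
  is proved like \<open>wedge_comm\<close>, by the contraction recursion for three factors.\<close>

lemma wedge_left_commute:
  assumes "alt_form k \<alpha>" "alt_form l \<beta>" "alt_form m \<gamma>"
  shows "wedge k (l + m) \<alpha> (wedge l m \<beta> \<gamma>) v = (- 1) ^ (k * l) * wedge l (k + m) \<beta> (wedge k m \<alpha> \<gamma>) v"
  using assms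
proof (induction "k + l + m" arbitrary: k l m \<alpha> \<beta> \<gamma> v)
  case 0
  then have z: "k = 0" "l = 0" "m = 0" by auto
  have "alt_form 0 (wedge 0 0 \<beta> \<gamma>)" "alt_form 0 (wedge 0 0 \<alpha> \<gamma>)"
    using alt_form_wedge[of 0 _ 0] 0 z by auto
  with 0 z show ?case
    using wedge_0_left[of \<alpha> 0 "wedge 0 0 \<beta> \<gamma>" v v] wedge_0_left[of \<beta> 0 "wedge 0 0 \<alpha> \<gamma>" v v]
      wedge_0_left[of \<alpha> 0 \<gamma> v v] wedge_0_left[of \<beta> 0 \<gamma> v v] by simp
next
  case (Suc n)
  obtain x u where v: "v = x ## u" by (metis vcons_head_tail)
  note alt = Suc.prems
  have 1: "wedge (k - 1) (l + m) (contract0 k x \<alpha>) (wedge l m \<beta> \<gamma>) u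
      = (- 1) ^ (k * l) * ((- 1) ^ l * wedge l (k - 1 + m) \<beta> (wedge (k - 1) m (contract0 k x \<alpha>) \<gamma>) u)"
  proof (cases k)
    case (Suc k')
    then show ?thesis
      using Suc.hyps(1)[of k' l m "contract x \<alpha>" \<beta> \<gamma> u] Suc.hyps(2) alt
      by (simp add: alt_form_contract power_add mult.assoc[symmetric] power_mult_distrib[symmetric])
  qed (simp add: wedge_zero_left wedge_zero_right)
  have 2: "(- 1) ^ k * wedge k (l - 1 + m) \<alpha> (wedge (l - 1) m (contract0 l x \<beta>) \<gamma>) u
      = (- 1) ^ (k * l) * wedge (l - 1) (k + m) (contract0 l x \<beta>) (wedge k m \<alpha> \<gamma>) u"
  proof (cases l)
    case (Suc l')
    then show ?thesis
      using Suc.hyps(1)[of k l' m \<alpha> "contract x \<beta>" \<gamma> u] Suc.hyps(2) alt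
      by (simp add: alt_form_contract power_add mult.assoc[symmetric] power_mult_distrib[symmetric])
  qed (simp add: wedge_zero_left wedge_zero_right)
  have 3: "wedge k (l + (m - 1)) \<alpha> (wedge l (m - 1) \<beta> (contract0 m x \<gamma>)) u
      = (- 1) ^ (k * l) * wedge l (k + (m - 1)) \<beta> (wedge k (m - 1) \<alpha> (contract0 m x \<gamma>)) u"
  proof (cases m)
    case (Suc m')
    then show ?thesis
      using Suc.hyps(1)[of k l m' \<alpha> \<beta> "contract x \<gamma>" u] Suc.hyps(2) alt
      by (simp add: alt_form_contract)
  qed (simp add: wedge_zero_left wedge_zero_right)
  have "k + l + m \<noteq> 0" "l + k + m \<noteq> 0" using Suc.hyps(2) by auto
  then show ?case
    unfolding v wedge_wedge_vcons0[OF alt \<open>k + l + m \<noteq> 0\<close>]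
      wedge_wedge_vcons0[OF alt(2,1,3) \<open>l + k + m \<noteq> 0\<close>] 1 2 3
    by (simp add: algebra_simps power_add)
qed

text \<open>The extension of the transpose of \<open>K\<close> to a derivation of the exterior
  algebra. On top-degree forms it is multiplication by the trace, so its vanishing there expresses
  that \<open>K\<close> is trace-free without mentioning matrices.\<close>

definition deriv_form :: "('v \<Rightarrow> 'v) \<Rightarrow> nat \<Rightarrow> 'v form \<Rightarrow> 'v form" where
  "deriv_form K k \<alpha> v = (\<Sum>i<k. \<alpha> (v(i := K (v i))))"

text \<open>A derivation of degree zero, hence no sign. In the summand of p, every slot is
  \<open>p j\<close> for a unique j, and j lies in exactly one of the two factors.\<close>

lemma deriv_form_wedge:
  assumes \<alpha>: "alt_form k \<alpha>" and \<beta>: "alt_form l \<beta>"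
  shows "deriv_form K (k + l) (wedge k l \<alpha> \<beta>) v
    = wedge k l (deriv_form K k \<alpha>) \<beta> v + wedge k l \<alpha> (deriv_form K l \<beta>) v"
proof -
  define T where "T p m = of_int (sign p) * \<alpha> (\<lambda>i. (v(m := K (v m))) (p i)) * \<beta> (\<lambda>i. (v(m := K (v m))) (p (k + i)))" for p m
  have key: "(\<Sum>m<k + l. T p m) = of_int (sign p) * deriv_form K k \<alpha> (\<lambda>i. v (p i)) * \<beta> (\<lambda>i. v (p (k + i)))
      + of_int (sign p) * \<alpha> (\<lambda>i. v (p i)) * deriv_form K l \<beta> (\<lambda>i. v (p (k + i)))"
    if p: "p permutes {..<k + l}" for p
  proof -
    have inj: "(p i = p j) = (i = j)" for i j using permutes_inj[OF p] by (auto dest: injD)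
    have "(\<Sum>m<k + l. T p m) = (\<Sum>j<k + l. T p (p j))"
      using sum.permute[OF p, of "T p"] by (simp add: o_def)
    also have "\<dots> = (\<Sum>j<k. T p (p j)) + (\<Sum>j<l. T p (p (k + j)))"
      by (induction l) auto
    also have "(\<Sum>j<k. T p (p j)) = (\<Sum>j<k. of_int (sign p) * \<alpha> ((\<lambda>i. v (p i))(j := K (v (p j)))) * \<beta> (\<lambda>i. v (p (k + i))))"
    proof (intro sum.cong refl)
      fix j assume "j \<in> {..<k}"
      then have "(\<lambda>i. (v(p j := K (v (p j)))) (p (k + i))) = (\<lambda>i. v (p (k + i)))"
        by (auto simp: inj)
      moreover have "(\<lambda>i. (v(p j := K (v (p j)))) (p i)) = (\<lambda>i. v (p i))(j := K (v (p j)))"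
        by (auto simp: inj fun_eq_iff)
      ultimately show "T p (p j) = of_int (sign p) * \<alpha> ((\<lambda>i. v (p i))(j := K (v (p j)))) * \<beta> (\<lambda>i. v (p (k + i)))"
        by (simp add: T_def)
    qed
    also have "(\<Sum>j<l. T p (p (k + j))) = (\<Sum>j<l. of_int (sign p) * \<alpha> (\<lambda>i. v (p i)) * \<beta> ((\<lambda>i. v (p (k + i)))(j := K (v (p (k + j))))))"
    proof (intro sum.cong refl)
      fix j assume "j \<in> {..<l}"
      have "\<alpha> (\<lambda>i. (v(p (k + j) := K (v (p (k + j))))) (p i)) = \<alpha> (\<lambda>i. v (p i))"
        by (rule alt_form_cong[OF \<alpha>]) (auto simp: inj)
      moreover have "(\<lambda>i. (v(p (k + j) := K (v (p (k + j))))) (p (k + i))) = (\<lambda>i. v (p (k + i)))(j := K (v (p (k + j))))"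
        by (auto simp: inj)
      ultimately show "T p (p (k + j)) = of_int (sign p) * \<alpha> (\<lambda>i. v (p i)) * \<beta> ((\<lambda>i. v (p (k + i)))(j := K (v (p (k + j)))))"
        by (simp add: T_def)
    qed
    finally show ?thesis
      by (simp only: deriv_form_def sum_distrib_left sum_distrib_right)
  qed
  have "deriv_form K (k + l) (wedge k l \<alpha> \<beta>) v
      = (1 / (fact k * fact l)) * (\<Sum>m<k + l. \<Sum>p | p permutes {..<k + l}. T p m)"
    unfolding deriv_form_def wedge_def T_def by (simp add: sum_distrib_left)
  also have "(\<Sum>m<k + l. \<Sum>p | p permutes {..<k + l}. T p m) = (\<Sum>p | p permutes {..<k + l}. \<Sum>m<k + l. T p m)"
    by (rule sum.swap)
  also have "\<dots> = (\<Sum>p | p permutes {..<k + l}.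
      of_int (sign p) * deriv_form K k \<alpha> (\<lambda>i. v (p i)) * \<beta> (\<lambda>i. v (p (k + i)))
      + of_int (sign p) * \<alpha> (\<lambda>i. v (p i)) * deriv_form K l \<beta> (\<lambda>i. v (p (k + i))))"
    using key by simp
  finally show ?thesis
    unfolding wedge_def by (simp add: sum.distrib algebra_simps add_divide_distrib)
qed

section \<open>One-forms and the expansion of products with them\<close>

definition cov :: "('v \<Rightarrow> real) \<Rightarrow> 'v form" where
  "cov \<phi> v = \<phi> (v 0)"

lemma alt_form_cov: "linear \<phi> \<Longrightarrow> alt_form 1 (cov \<phi>)"
  by (auto simp: alt_form_def cov_def)

lemma contract_cov: "contract x (cov \<phi>) = (\<lambda>v. \<phi> x)"
  by (auto simp: cov_def)

lemma alt_form_const: "alt_form 0 (\<lambda>v. c)"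
  by (auto simp: alt_form_def)

lemma wedge_cov_0:
  assumes "linear \<phi>" "alt_form 0 \<beta>"
  shows "wedge 1 0 (cov \<phi>) \<beta> v = \<phi> (v 0) * \<beta> u"
  using wedge_0_right[OF alt_form_cov[OF assms(1)] assms(2)] by (simp add: cov_def)

lemma wedge_cov_Suc:
  assumes \<phi>: "linear \<phi>" and \<beta>: "alt_form (Suc l) \<beta>"
  shows "wedge 1 (Suc l) (cov \<phi>) \<beta> (x ## v) = \<phi> x * \<beta> v - wedge 1 l (cov \<phi>) (contract x \<beta>) v"
  using wedge_Suc_Suc[of 0 "cov \<phi>" l \<beta> x v] alt_form_cov[OF \<phi>] \<beta>
    wedge_0_left[OF alt_form_const[of "\<phi> x"] \<beta>, of v] by (simp add: contract_cov)

definition del :: "nat \<Rightarrow> (nat \<Rightarrow> 'v) \<Rightarrow> nat \<Rightarrow> 'v" where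
  "del i v = (\<lambda>j. if j < i then v j else v (Suc j))"

lemma del_0: "del 0 (x ## v) = v"
  by (auto simp: del_def)

lemma del_Suc: "del (Suc i) (x ## v) = x ## del i v"
  by (auto simp: del_def split: nat.split)

text \<open>The alternating sum has the shape of the one that defines \<open>ext_deriv\<close>; this
  later allows reading an exterior derivative as a sum of products of one-forms with derivatives of
  the form.\<close>

lemma wedge_cov_expand:
  assumes \<phi>: "linear \<phi>" and \<beta>: "alt_form l \<beta>"
  shows "wedge 1 l (cov \<phi>) \<beta> v = (\<Sum>i\<le>l. (- 1) ^ i * \<phi> (v i) * \<beta> (del i v))"
  using \<beta>
proof (induction l arbitrary: \<beta> v)
  case 0
  then show ?case using wedge_cov_0[OF \<phi> 0, of v "del 0 v"] by simp
next
  case (Suc l)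
  obtain x u where v: "v = x ## u" by (metis vcons_head_tail)
  show ?case unfolding v wedge_cov_Suc[OF \<phi> Suc.prems] Suc.IH[OF alt_form_contract[OF Suc.prems]]
    unfolding sum.atMost_Suc_shift
    by (simp add: del_0 del_Suc sum_negf[symmetric])
qed

lemma alt_form_deriv_form:
  assumes \<alpha>: "alt_form k \<alpha>" and K: "linear K"
  shows "alt_form k (deriv_form K k \<alpha>)"
  unfolding alt_form_def
proof (intro conjI allI impI)
  fix v w :: "nat \<Rightarrow> 'a" assume "\<forall>i<k. v i = w i"
  then show "deriv_form K k \<alpha> v = deriv_form K k \<alpha> w"
    unfolding deriv_form_def by (intro sum.cong refl alt_form_cong[OF \<alpha>]) auto
next
  fix v :: "nat \<Rightarrow> 'a" and j assume j: "j < k"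
  have "linear (\<lambda>x. \<alpha> ((v(j := x))(i := K ((v(j := x)) i))))" if i: "i < k" for i
  proof (cases "i = j")
    case True
    then show ?thesis
      using linear_compose[OF K alt_form_linear[OF \<alpha> j, of v]] by (simp add: o_def)
  next
    case False
    then have "(v(j := x))(i := K ((v(j := x)) i)) = (v(i := K (v i)))(j := x)" for x
      by auto
    then show ?thesis using alt_form_linear[OF \<alpha> j, of "v(i := K (v i))"] by simp
  qed
  then show "linear (\<lambda>x. deriv_form K k \<alpha> (v(j := x)))"
    unfolding deriv_form_def by (intro linear_compose_sum) auto
next
  fix v :: "nat \<Rightarrow> 'a" and i j assume i: "i < k" and j: "j < k" and ij: "i \<noteq> j \<and> v i = v j"
  have z: "\<alpha> (v(m := K (v m))) = 0" if "m \<noteq> i" "m \<noteq> j" for m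
    by (rule alt_form_eq_0[OF \<alpha> i j]) (use ij that in auto)
  have "v(j := K (v j)) = (\<lambda>m. (v(i := K (v i))) (Transposition.transpose i j m))"
    using ij by (auto simp: Transposition.transpose_def)
  then have s: "\<alpha> (v(j := K (v j))) = - \<alpha> (v(i := K (v i)))"
    using alt_form_swap[OF \<alpha> i j] ij by metis
  have "deriv_form K k \<alpha> v = (\<Sum>m\<in>{i, j}. \<alpha> (v(m := K (v m))))"
    unfolding deriv_form_def by (rule sum.mono_neutral_right) (use i j z in auto)
  then show "deriv_form K k \<alpha> v = 0" using ij s by simp
qed

section \<open>Forms in dimension six and Hitchin's endomorphism\<close>

lemma alt_form_basis_zero:
  fixes \<alpha> :: "(real ^ 'n) form"
  assumes \<alpha>: "alt_form k \<alpha>"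
    and z: "\<And>f. inj_on f {..<k} \<Longrightarrow> \<alpha> (\<lambda>i. axis (f i) 1) = 0"
  shows "\<alpha> v = 0"
proof -
  \<comment> \<open>Induction on the number m of leading slots that are unrestricted, while the
    others hold basis vectors; m = k is the claim.\<close>
  have "\<forall>v. (\<forall>i. m \<le> i \<longrightarrow> i < k \<longrightarrow> v i \<in> range (\<lambda>j. axis j 1)) \<longrightarrow> \<alpha> v = 0" for m
  proof (induction m)
    case 0
    show ?case
    proof (intro allI impI)
      fix v :: "nat \<Rightarrow> real ^ 'n" assume v: "\<forall>i. 0 \<le> i \<longrightarrow> i < k \<longrightarrow> v i \<in> range (\<lambda>j. axis j 1)"
      then obtain f where f: "\<And>i. i < k \<Longrightarrow> v i = axis (f i) 1"
        unfolding image_iff by (metis zero_le)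
      have e: "\<alpha> v = \<alpha> (\<lambda>i. axis (f i) 1)" by (rule alt_form_cong[OF \<alpha>]) (rule f)
      show "\<alpha> v = 0"
      proof (cases "inj_on f {..<k}")
        case True then show ?thesis using z e by simp
      next
        case False
        then obtain i j where "i < k" "j < k" "i \<noteq> j" "f i = f j" by (auto simp: inj_on_def)
        then show ?thesis unfolding e using alt_form_eq_0[OF \<alpha>, of i j "\<lambda>i. axis (f i) 1"] by simp
      qed
    qed
  next
    case (Suc m)
    show ?case
    proof (intro allI impI)
      fix v :: "nat \<Rightarrow> real ^ 'n" assume v: "\<forall>i. Suc m \<le> i \<longrightarrow> i < k \<longrightarrow> v i \<in> range (\<lambda>j. axis j 1)"
      show "\<alpha> v = 0"
      proof (cases "m < k")
        case False then show ?thesis using Suc v by (metis le_trans not_le)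
      next
        case True
        note lin = alt_form_linear[OF \<alpha> True, of v]
        have b: "\<alpha> (v(m := axis j 1)) = 0" for j
        proof -
          have "\<forall>i. m \<le> i \<longrightarrow> i < k \<longrightarrow> (v(m := axis j 1)) i \<in> range (\<lambda>j. axis j 1)"
            using v by (auto simp: Suc_le_eq)
          then show ?thesis using Suc by blast
        qed
        have "\<alpha> v = \<alpha> (v(m := v m))" by simp
        also have "\<dots> = \<alpha> (v(m := (\<Sum>j\<in>UNIV. v m $ j *\<^sub>R axis j 1)))"
          using basis_expansion[of "v m"] by (simp add: scalar_mult_eq_scaleR)
        also have "\<dots> = (\<Sum>j\<in>UNIV. v m $ j * \<alpha> (v(m := axis j 1)))"
          using linear_sum[OF lin, of "\<lambda>j. v m $ j *\<^sub>R axis j 1" UNIV] linear_scale[OF lin] by simp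
        finally show ?thesis by (simp add: b)
      qed
    qed
  qed
  from this[of k] show ?thesis by auto
qed

lemma alt_form_gt_card:
  fixes \<alpha> :: "(real ^ 'n) form"
  assumes "alt_form k \<alpha>" "CARD('n) < k"
  shows "\<alpha> v = 0"
proof (rule alt_form_basis_zero[OF assms(1)])
  fix f :: "nat \<Rightarrow> 'n" assume "inj_on f {..<k}"
  then have "card {..<k} \<le> CARD('n)" by (intro card_inj_on_le[of f]) auto
  then show "\<alpha> (\<lambda>i. axis (f i) 1) = 0" using assms(2) by simp
qed

text \<open>One-dimensionality of the top exterior power, stated without division so that it also
  covers forms that vanish at \<open>v\<close> or \<open>w\<close>.\<close>

lemma alt_form_top_proportional:
  fixes \<theta> \<eta> :: "(real ^ 'n) form"
  assumes \<theta>: "alt_form CARD('n) \<theta>" and \<eta>: "alt_form CARD('n) \<eta>"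
  shows "\<theta> v * \<eta> w = \<theta> w * \<eta> v"
proof -
  obtain h where h: "bij_betw h {..<CARD('n)} (UNIV :: 'n set)"
    using ex_bij_betw_nat_finite[OF finite, of "UNIV :: 'n set"] by (auto simp: atLeast0LessThan)
  define b where "b = (\<lambda>i. axis (h i) 1 :: real ^ 'n)"
  \<comment> \<open>The factor \<open>s\<close> is the sign of a permutation determined by f alone,
    so one value serves both top forms.\<close>
  have perm: "\<exists>s. \<forall>\<alpha>. alt_form CARD('n) \<alpha> \<longrightarrow> \<alpha> (\<lambda>i. axis (f i) 1) = s * \<alpha> b"
    if f: "inj_on f {..<CARD('n)}" for f :: "nat \<Rightarrow> 'n"
  proof -
    define p where "p i = (if i < CARD('n) then inv_into {..<CARD('n)} h (f i) else i)" for i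
    have hi: "h (inv_into {..<CARD('n)} h y) = y" "inv_into {..<CARD('n)} h y \<in> {..<CARD('n)}" for y
      using h inv_into_into[of y h "{..<CARD('n)}"] by (auto simp: bij_betw_def f_inv_into_f)
    have "inj_on p {..<CARD('n)}"
    proof (rule inj_onI)
      fix x y assume xy: "x \<in> {..<CARD('n)}" "y \<in> {..<CARD('n)}" "p x = p y"
      have "h (p x) = f x" "h (p y) = f y" using hi xy(1,2) by (simp_all add: p_def)
      then have "f x = f y" using xy(3) by simp
      then show "x = y" using f xy by (auto dest: inj_onD)
    qed
    moreover have "p ` {..<CARD('n)} \<subseteq> {..<CARD('n)}" using hi by (auto simp: p_def)
    ultimately have "bij_betw p {..<CARD('n)} {..<CARD('n)}"
      by (simp add: bij_betw_def endo_inj_surj)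
    then have p: "p permutes {..<CARD('n)}"
      by (rule bij_imp_permutes) (simp add: p_def)
    have "\<alpha> (\<lambda>i. axis (f i) 1) = of_int (sign p) * \<alpha> b" if \<alpha>: "alt_form CARD('n) \<alpha>" for \<alpha>
    proof -
      have "\<alpha> (\<lambda>i. axis (f i) 1) = \<alpha> (\<lambda>i. b (p i))"
        by (rule alt_form_cong[OF \<alpha>]) (simp add: b_def p_def hi)
      then show ?thesis using alt_form_permute[OF \<alpha> p] by simp
    qed
    then show ?thesis by blast
  qed
  have E: "\<theta> v * \<eta> b = \<theta> b * \<eta> v" for v
  proof -
    have alt: "alt_form CARD('n) (\<lambda>v. \<eta> b * \<theta> v - \<theta> b * \<eta> v)"
      by (intro alt_form_diff alt_form_scale \<theta> \<eta>)
    have "(\<lambda>v. \<eta> b * \<theta> v - \<theta> b * \<eta> v) v = 0"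
    proof (rule alt_form_basis_zero[OF alt])
      fix f :: "nat \<Rightarrow> 'n" assume "inj_on f {..<CARD('n)}"
      then obtain s where s: "\<And>\<alpha>. alt_form CARD('n) \<alpha> \<Longrightarrow> \<alpha> (\<lambda>i. axis (f i) 1) = s * \<alpha> b"
        using perm by blast
      show "\<eta> b * \<theta> (\<lambda>i. axis (f i) 1) - \<theta> b * \<eta> (\<lambda>i. axis (f i) 1) = 0"
        by (simp add: s[OF \<theta>] s[OF \<eta>])
    qed
    then show ?thesis by (simp add: algebra_simps)
  qed
  show ?thesis
  proof (cases "\<eta> b = 0")
    case True
    have "\<eta> v = 0" for v
    proof (rule alt_form_basis_zero[OF \<eta>])
      fix f :: "nat \<Rightarrow> 'n" assume "inj_on f {..<CARD('n)}"
      then obtain s where s: "\<And>\<alpha>. alt_form CARD('n) \<alpha> \<Longrightarrow> \<alpha> (\<lambda>i. axis (f i) 1) = s * \<alpha> b"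
        using perm by blast
      show "\<eta> (\<lambda>i. axis (f i) 1) = 0" using True by (simp add: s[OF \<eta>])
    qed
    then show ?thesis by simp
  next
    case False
    have "\<theta> v * \<eta> w * \<eta> b = \<theta> w * \<eta> v * \<eta> b"
      using E[of v] E[of w] by (metis mult.assoc mult.commute)
    then show ?thesis using False by simp
  qed
qed

lemma alt_form_top_6:
  assumes "alt_form 6 (\<theta> :: V form)" "alt_form 6 \<eta>"
  shows "\<theta> v * \<eta> w = \<theta> w * \<eta> v"
  using alt_form_top_proportional[of \<theta> \<eta>] assms by simp

lemma alt_form_7_zero:
  assumes "alt_form 7 (\<theta> :: V form)"
  shows "\<theta> v = 0"
  using alt_form_gt_card[OF assms] by simp

text \<open>Contract the vanishing seven-form \<phi> \<and> vol with x. The identity recovers the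
  components of x from the five-form that represents x, and is the means by which equations between
  vectors become equations between six-forms.\<close>

lemma wedge_cov_contract_top:
  assumes \<phi>: "linear \<phi>" and vol: "alt_form 6 (vol :: V form)"
  shows "wedge 1 5 (cov \<phi>) (contract x vol) w = \<phi> x * vol w"
proof -
  have "alt_form 7 (wedge 1 6 (cov \<phi>) vol)"
    using alt_form_wedge[OF alt_form_cov[OF \<phi>] vol] by simp
  then have "wedge 1 6 (cov \<phi>) vol (x ## w) = 0" by (rule alt_form_7_zero)
  then show ?thesis using wedge_cov_Suc[OF \<phi>, of 5 vol x w] vol by simp
qed

lemma wedge_cov_eq_zero_imp:
  fixes \<tau> :: "V form"
  assumes \<tau>: "alt_form 5 \<tau>" and z: "\<And>\<phi> w. linear \<phi> \<Longrightarrow> wedge 1 5 (cov \<phi>) \<tau> w = 0"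
  shows "\<tau> v = 0"
proof (rule alt_form_basis_zero[OF \<tau>])
  fix f :: "nat \<Rightarrow> 6" assume "inj_on f {..<5}"
  have "card (f ` {..<5}) \<le> 5" using card_image_le[of "{..<5::nat}" f] by simp
  then have "f ` {..<5} \<noteq> UNIV" by auto
  \<comment> \<open>Five basis indices miss some j. The j-th coordinate kills all the given basis
    vectors, so putting \<open>axis j 1\<close> in front leaves only the term i = 0 of the
    expansion.\<close>
  then obtain j where j: "j \<notin> f ` {..<5}" by blast
  define \<phi> where "\<phi> x = x $ j" for x :: V
  have \<phi>: "linear \<phi>" unfolding \<phi>_def by (auto simp: linear_iff)
  have "wedge 1 5 (cov \<phi>) \<tau> (axis j 1 ## (\<lambda>i. axis (f i) 1)) = (\<Sum>i\<le>5. (- 1) ^ i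
      * \<phi> ((axis j 1 ## (\<lambda>i. axis (f i) 1)) i) * \<tau> (del i (axis j 1 ## (\<lambda>i. axis (f i) 1))))"
    by (rule wedge_cov_expand[OF \<phi> \<tau>])
  also have "\<dots> = (\<Sum>i\<in>{0}. (- 1) ^ i
      * \<phi> ((axis j 1 ## (\<lambda>i. axis (f i) 1)) i) * \<tau> (del i (axis j 1 ## (\<lambda>i. axis (f i) 1))))"
  proof (rule sum.mono_neutral_right)
    show "\<forall>i\<in>{..5} - {0}. (- 1) ^ i
      * \<phi> ((axis j 1 ## (\<lambda>i. axis (f i) 1)) i) * \<tau> (del i (axis j 1 ## (\<lambda>i. axis (f i) 1))) = 0"
    proof
      fix i :: nat assume "i \<in> {..5} - {0}"
      then obtain m where m: "i = Suc m" "m < 5" by (cases i) auto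
      then have "f m \<noteq> j" using j by auto
      then have "\<phi> ((axis j 1 ## (\<lambda>i. axis (f i) 1)) i) = 0"
        by (simp add: m \<phi>_def axis_def)
      then show "(- 1) ^ i
      * \<phi> ((axis j 1 ## (\<lambda>i. axis (f i) 1)) i) * \<tau> (del i (axis j 1 ## (\<lambda>i. axis (f i) 1))) = 0" by simp
    qed
  qed auto
  also have "\<dots> = \<tau> (\<lambda>i. axis (f i) 1)" by (simp add: del_0 \<phi>_def axis_def)
  finally show "\<tau> (\<lambda>i. axis (f i) 1) = 0" using z[OF \<phi>] by simp
qed

text \<open>Existence and uniqueness behind the definite description in
  \<open>kappa\<close>.\<close>

lemma kappa_contract:
  fixes vol \<sigma> :: "V form"
  assumes vol: "alt_form 6 vol" and w0: "vol w0 \<noteq> 0" and \<sigma>: "alt_form 5 \<sigma>"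
  shows "contract (kappa vol \<sigma>) vol = \<sigma>"
proof -
  \<comment> \<open>Forced by \<open>wedge_cov_contract_top\<close>: this quotient is the j-th
    coordinate of any x that represents \<sigma>.\<close>
  define c where "c j = wedge 1 5 (cov (\<lambda>x. x $ j)) \<sigma> w0 / vol w0" for j :: 6
  define x where "x = (\<chi> j. c j)"
  have ex: "contract x vol = \<sigma>"
  proof (rule ext)
    fix v
    have volx: "alt_form 5 (contract x vol)" using alt_form_contract[of 5 vol x] vol by simp
    have alt: "alt_form 5 (\<lambda>v. contract x vol v - \<sigma> v)"
      by (rule alt_form_diff[OF volx \<sigma>])
    have "(\<lambda>v. contract x vol v - \<sigma> v) v = 0"
    proof (rule wedge_cov_eq_zero_imp[OF alt])
      fix \<phi> :: "V \<Rightarrow> real" and w assume \<phi>: "linear \<phi>"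
      have cj: "linear (\<lambda>x. x $ j)" for j :: 6 by (auto simp: linear_iff)
      have "wedge 1 5 (cov \<phi>) \<sigma> w * vol w0 = wedge 1 5 (cov \<phi>) \<sigma> w0 * vol w"
        using alt_form_wedge[OF alt_form_cov[OF \<phi>] \<sigma>] by (intro alt_form_top_6[OF _ vol]) simp
      moreover have "cov \<phi> = (\<lambda>v. \<Sum>j\<in>UNIV. \<phi> (axis j 1) * cov (\<lambda>x. x $ j) v)"
      proof (rule ext)
        fix v :: "nat \<Rightarrow> V"
        have "\<phi> (v 0) = \<phi> (\<Sum>j\<in>UNIV. v 0 $ j *\<^sub>R axis j 1)"
          using basis_expansion[of "v 0"] by (simp add: scalar_mult_eq_scaleR)
        also have "\<dots> = (\<Sum>j\<in>UNIV. v 0 $ j * \<phi> (axis j 1))"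
          by (simp add: linear_sum[OF \<phi>] linear_scale[OF \<phi>])
        finally show "cov \<phi> v = (\<Sum>j\<in>UNIV. \<phi> (axis j 1) * cov (\<lambda>x. x $ j) v)"
          by (simp add: cov_def mult.commute)
      qed
      then have "wedge 1 5 (cov \<phi>) \<sigma> w0 = (\<Sum>j\<in>UNIV. \<phi> (axis j 1) * wedge 1 5 (cov (\<lambda>x. x $ j)) \<sigma> w0)"
        by (simp only: wedge_sum_left wedge_scale_left)
      moreover have "\<phi> x = (\<Sum>j\<in>UNIV. x $ j * \<phi> (axis j 1))"
      proof -
        have "\<phi> x = \<phi> (\<Sum>j\<in>UNIV. x $ j *\<^sub>R axis j 1)"
          using basis_expansion[of x] by (simp add: scalar_mult_eq_scaleR)
        then show ?thesis by (simp add: linear_sum[OF \<phi>] linear_scale[OF \<phi>])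
      qed
      ultimately have "wedge 1 5 (cov \<phi>) \<sigma> w * vol w0 = \<phi> x * vol w0 * vol w"
        using w0 by (simp add: x_def c_def sum_distrib_right sum_distrib_left algebra_simps)
      then have "wedge 1 5 (cov \<phi>) \<sigma> w = \<phi> x * vol w" using w0 by simp
      then show "wedge 1 5 (cov \<phi>) (\<lambda>v. contract x vol v - \<sigma> v) w = 0"
        unfolding wedge_diff_right using wedge_cov_contract_top[OF \<phi> vol] by (simp del: contract_apply)
    qed
    then show "contract x vol v = \<sigma> v" by simp
  qed
  have uniq: "y = x" if "contract y vol = \<sigma>" for y
  proof -
    have "y $ j = x $ j" for j
    proof -
      have \<phi>: "linear (\<lambda>x::V. x $ j)" by (auto simp: linear_iff)
      show ?thesis
        using wedge_cov_contract_top[OF \<phi> vol, of x w0] wedge_cov_contract_top[OF \<phi> vol, of y w0] that ex w0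
        by simp
    qed
    then show ?thesis by (simp add: vec_eq_iff)
  qed
  show ?thesis unfolding kappa_def by (rule theI[of "\<lambda>x. contract x vol = \<sigma>", OF ex]) (rule uniq)
qed

section \<open>Hitchin's endomorphism of a three-form\<close>

locale volume_and_three_form =
  fixes vol \<rho> :: "V form"
  assumes vol: "alt_form 6 vol" and vol_nz: "\<exists>w. vol w \<noteq> 0" and \<rho>: "alt_form 3 \<rho>"
begin

abbreviation "K \<equiv> Kmap vol \<rho>"

lemma alt_form_contract_rho: "alt_form 2 (contract v \<rho>)"
  using alt_form_contract[of 2 \<rho>] \<rho> by simp

lemma alt_form_contract2_rho: "alt_form 1 (contract z (contract y \<rho>))"
  using alt_form_contract[of 1 "contract y \<rho>" z] alt_form_contract_rho[of y]
  by (simp add: numeral_2_eq_2)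

lemma alt_form_rho_rho: "alt_form 5 (wedge 2 3 (contract v \<rho>) \<rho>)"
  using alt_form_wedge[OF alt_form_contract_rho \<rho>] by simp

lemma contract_K: "contract (K v) vol = wedge 2 3 (contract v \<rho>) \<rho>"
  using vol_nz kappa_contract[OF vol _ alt_form_rho_rho] by (auto simp: Kmap_def)

lemma K_wedge:
  assumes "linear \<phi>"
  shows "wedge 1 5 (cov \<phi>) (wedge 2 3 (contract v \<rho>) \<rho>) w = \<phi> (K v) * vol w"
  using wedge_cov_contract_top[OF assms vol, of "K v" w] by (simp add: contract_K)

lemma K_eqI:
  assumes "contract x vol = wedge 2 3 (contract v \<rho>) \<rho>"
  shows "K v = x"
proof -
  obtain w where w: "vol w \<noteq> 0" using vol_nz by blast
  have "K v $ j = x $ j" for j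
  proof -
    have \<phi>: "linear (\<lambda>x::V. x $ j)" by (auto simp: linear_iff)
    show ?thesis using wedge_cov_contract_top[OF \<phi> vol, of x w] K_wedge[OF \<phi>, of v w] assms w by simp
  qed
  then show ?thesis by (simp add: vec_eq_iff)
qed

lemma linear_K: "linear K"
proof (rule linearI)
  fix x y :: V and c :: real
  have l: "linear (\<lambda>x. \<rho> (x ## v))" for v using alt_form_linear_head[of 2 \<rho>] \<rho> by simp
  have lv: "linear (\<lambda>x. vol (x ## v))" for v using alt_form_linear_head[of 5 vol] vol by simp
  show "K (x + y) = K x + K y"
  proof (rule K_eqI, rule ext)
    fix w
    have e: "contract (x + y) \<rho> = (\<lambda>v. contract x \<rho> v + contract y \<rho> v)"
      by (auto simp: linear_add[OF l])
    show "contract (K x + K y) vol w = wedge 2 3 (contract (x + y) \<rho>) \<rho> w"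
      unfolding e wedge_add_left contract_K[symmetric] by (simp add: linear_add[OF lv])
  qed
  show "K (c *\<^sub>R x) = c *\<^sub>R K x"
  proof (rule K_eqI, rule ext)
    fix w
    have e: "contract (c *\<^sub>R x) \<rho> = (\<lambda>v. c * contract x \<rho> v)"
      by (auto simp: linear_scale[OF l])
    show "contract (c *\<^sub>R K x) vol w = wedge 2 3 (contract (c *\<^sub>R x) \<rho>) \<rho> w"
      unfolding e wedge_scale_left contract_K[symmetric] by (simp add: linear_scale[OF lv])
  qed
qed

lemma rho_swap12: "\<rho> (x ## y ## z ## u) = - \<rho> (y ## x ## z ## u)"
  using alt_form_head_swap[of 1 \<rho> x y] \<rho> by (simp add: numeral_3_eq_3)

lemma rho_swap23: "\<rho> (x ## y ## z ## u) = - \<rho> (x ## z ## y ## u)"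
proof -
  have "alt_form (Suc (Suc 0)) (contract x \<rho>)" using alt_form_contract_rho by (simp add: numeral_2_eq_2)
  from alt_form_head_swap[OF this, of y z u] show ?thesis by simp
qed

lemma rho_cov: "cov (\<lambda>x. \<rho> (x ## y ## z ## u)) = contract z (contract y \<rho>)"
proof (rule ext)
  fix w :: "nat \<Rightarrow> V"
  have "\<rho> (w 0 ## y ## z ## u) = \<rho> (y ## z ## w 0 ## u)"
    using rho_swap12[of "w 0" y z u] rho_swap23[of y "w 0" z u] by simp
  also have "\<dots> = \<rho> (y ## z ## w)"
    by (rule alt_form_cong[OF \<rho>]) (auto split: nat.split simp: less_Suc_eq numeral_3_eq_3)
  finally show "cov (\<lambda>x. \<rho> (x ## y ## z ## u)) w = contract z (contract y \<rho>) w"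
    by (simp add: cov_def)
qed

text \<open>Here \<open>F\<close> encodes \<rho>(K v, y, z) as a six-form; it is antisymmetric in y
  and z, and \<open>G\<close> is totally symmetric. By \<open>rel\<close>, the differences between
  cyclically consecutive values of F at (x,y,z), (y,z,x), (z,x,y) all equal -G. They add up to zero,
  so G vanishes and F is invariant under cyclic permutations.\<close>

lemma K_rho_symmetric: "\<rho> (K x ## y ## z ## u) = \<rho> (x ## K y ## z ## u)"
proof -
  obtain w where w: "vol w \<noteq> 0" using vol_nz by blast
  define F where "F v y z = wedge 1 5 (contract z (contract y \<rho>)) (wedge 2 3 (contract v \<rho>) \<rho>) w" for v y z
  define G where "G v y z = wedge 2 4 (contract v \<rho>) (wedge 2 2 (contract y \<rho>) (contract z \<rho>)) w" for v y z
  have F: "F v y z = \<rho> (K v ## y ## z ## u) * vol w" for v y z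
  proof -
    have "linear (\<lambda>x. \<rho> (x ## y ## z ## u))" using alt_form_linear_head[of 2 \<rho>] \<rho> by simp
    from K_wedge[OF this, of v w] show ?thesis by (simp add: rho_cov F_def)
  qed
  have Fanti: "F v z y = - F v y z" for v y z
    using rho_swap23[of "K v" y z u] by (simp add: F)
  have G1: "G v y z = G y v z" for v y z
    unfolding G_def
    using wedge_left_commute[OF alt_form_contract_rho alt_form_contract_rho alt_form_contract_rho, of v y z w]
    by (simp del: contract_apply)
  have G2: "G v y z = G v z y" for v y z
  proof -
    have "wedge 2 2 (contract y \<rho>) (contract z \<rho>) = wedge 2 2 (contract z \<rho>) (contract y \<rho>)"
      using wedge_comm[OF alt_form_contract_rho alt_form_contract_rho, of y z] by (auto simp: fun_eq_iff)
    then show ?thesis by (simp add: G_def)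
  qed
  \<comment> \<open>Contract the vanishing seven-form \<open>\<rho>\<^sub>v \<and> \<rho>\<^sub>y \<and> \<rho>\<close> with \<open>z\<close>, where \<open>\<rho>\<^sub>v\<close> is the contraction.\<close>
  have rel: "F y v z + F v y z + G v y z = 0" for v y z
  proof -
    have "alt_form 7 (wedge 2 5 (contract v \<rho>) (wedge 2 3 (contract y \<rho>) \<rho>))"
      using alt_form_wedge[OF alt_form_contract_rho alt_form_rho_rho] by simp
    then have "wedge 2 5 (contract v \<rho>) (wedge 2 3 (contract y \<rho>) \<rho>) (z ## w) = 0"
      by (rule alt_form_7_zero)
    moreover have "wedge 2 4 (contract v \<rho>) (wedge 1 3 (contract z (contract y \<rho>)) \<rho>) w = F v y z"
      using wedge_left_commute[OF alt_form_contract_rho alt_form_contract2_rho \<rho>, of v z y w]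
      by (simp add: F_def)
    ultimately show ?thesis
      using wedge_wedge_vcons0[OF alt_form_contract_rho[of v] alt_form_contract_rho[of y] \<rho>, of z w]
      by (simp add: contract0_def F_def G_def)
  qed
  have "F x y z = F y z x"
    using rel[of x y z] rel[of x z y] rel[of y z x] Fanti[of x y z] Fanti[of y x z] Fanti[of z x y]
      G1[of z x y] G1[of x y z] G1[of z y x] G2[of x z y] G2[of x y z] G2[of y z x] G2[of y x z] by linarith
  then have "\<rho> (K x ## y ## z ## u) = \<rho> (K y ## z ## x ## u)" using w by (simp add: F)
  also have "\<dots> = \<rho> (x ## K y ## z ## u)"
    using rho_swap23[of "K y" z x u] rho_swap12[of "K y" x z u] by simp
  finally show ?thesis .
qed

definition rho_K :: "V form" where
  "rho_K w = \<rho> (K (w 0) ## (\<lambda>i. w (Suc i)))"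

lemma contract_rho_K: "contract v rho_K = contract (K v) \<rho>"
  by (auto simp: rho_K_def)

lemma vcons3: "\<exists>x y z u. w = x ## y ## z ## u" for w :: "nat \<Rightarrow> V"
  by (metis vcons_head_tail)

lemma deriv_form_rho: "deriv_form K 3 \<rho> w = 3 * rho_K w"
proof -
  obtain x y z u where w: "w = x ## y ## z ## u" using vcons3 by blast
  have "\<rho> (x ## y ## K z ## u) = \<rho> (K x ## y ## z ## u)"
    using rho_swap23[of x y "K z" u] rho_swap23[of x "K y" z u] K_rho_symmetric[of x y z u]
      K_rho_symmetric[of x z y u] rho_swap23[of "K x" y z u] by simp
  then show ?thesis
    unfolding w deriv_form_def rho_K_def
    by (simp add: numeral_3_eq_3 vcons_upd_0 vcons_upd_Suc K_rho_symmetric)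
qed

text \<open>The three slots contribute equally to the derivation, so the form is a third of one
  already known to be alternating.\<close>

lemma alt_form_rho_K: "alt_form 3 rho_K"
proof -
  have "rho_K = (\<lambda>w. (1/3) * deriv_form K 3 \<rho> w)" by (auto simp: deriv_form_rho)
  then show ?thesis using alt_form_scale[OF alt_form_deriv_form[OF \<rho> linear_K]] by metis
qed

lemma deriv_form_contract_rho: "deriv_form K 2 (contract v \<rho>) w = 2 * contract (K v) \<rho> w"
proof -
  obtain x y z u where w: "w = x ## y ## z ## u" using vcons3 by blast
  have "\<rho> (v ## x ## K y ## z ## u) = \<rho> (K v ## x ## y ## z ## u)"
    using rho_swap23[of v x "K y"] K_rho_symmetric[of v y x] rho_swap23[of "K v" x y] by simp
  then show ?thesis
    unfolding w deriv_form_def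
    by (simp add: numeral_2_eq_2 vcons_upd_0 vcons_upd_Suc K_rho_symmetric)
qed

lemma deriv_form_cov: "deriv_form K 1 (cov \<phi>) = cov (\<lambda>x. \<phi> (K x))"
  by (auto simp: deriv_form_def cov_def)

lemma deriv_form_top:
  assumes "\<And>w. deriv_form A 6 vol w = 0" and \<theta>: "alt_form 6 \<theta>"
  shows "deriv_form A 6 \<theta> w = 0"
proof -
  obtain w0 where w0: "vol w0 \<noteq> 0" using vol_nz by blast
  define c where "c = \<theta> w0 / vol w0"
  have "\<theta> v = c * vol v" for v
    using alt_form_top_6[OF \<theta> vol, of v w0] w0 by (simp add: c_def field_simps)
  then have "deriv_form A 6 \<theta> w = c * deriv_form A 6 vol w"
    by (simp only: deriv_form_def sum_distrib_left)
  then show ?thesis using assms(1) by simp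
qed

text \<open>With \<open>\<rho>\<^sub>K = \<rho>(K\<cdot>,\<cdot>,\<cdot>)\<close> and subscripts for contraction, let the trace-free derivation \<open>K\<close> act on
  \<open>\<alpha> \<and> \<rho>\<^sub>v \<and> \<rho>\<close>: this yields \<open>(\<rho>\<^sub>K)\<^sub>v \<and> \<rho> = - \<rho>\<^sub>v \<and> \<rho>\<^sub>K\<close>, so \<open>2 (\<rho>\<^sub>K)\<^sub>v \<and> \<rho>\<close> is the contraction of the
  six-form \<open>\<rho>\<^sub>K \<and> \<rho>\<close> with \<open>v\<close>.\<close>

lemma K_squared:
  assumes tr: "\<And>w. deriv_form K 6 vol w = 0"
  shows "\<exists>\<mu>. \<forall>v. K (K v) = \<mu> *\<^sub>R v"
proof -
  obtain w where w: "vol w \<noteq> 0" using vol_nz by blast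
  define \<Theta> where "\<Theta> = wedge 3 3 rho_K \<rho>"
  have \<Theta>: "alt_form 6 \<Theta>" using alt_form_wedge[OF alt_form_rho_K \<rho>] by (simp add: \<Theta>_def)
  have "2 * \<phi> (K (K v)) * vol w = \<phi> v * \<Theta> w" if \<phi>: "linear \<phi>" for \<phi> v
  proof -
    have \<phi>K: "linear (\<lambda>x. \<phi> (K x))" using linear_compose[OF linear_K \<phi>] by (simp add: o_def)
    define P where "P = wedge 1 5 (cov \<phi>) (wedge 2 3 (contract (K v) \<rho>) \<rho>) w"
    define Q where "Q = wedge 1 5 (cov \<phi>) (wedge 2 3 (contract v \<rho>) rho_K) w"
    have P: "P = \<phi> (K (K v)) * vol w" unfolding P_def by (rule K_wedge[OF \<phi>])
    have "deriv_form K 6 (wedge 1 5 (cov \<phi>) (wedge 2 3 (contract v \<rho>) \<rho>)) w = 0"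
      by (rule deriv_form_top[OF tr])
        (use alt_form_wedge[OF alt_form_cov[OF \<phi>] alt_form_rho_rho[of v]] in simp)
    moreover have "deriv_form K 5 (wedge 2 3 (contract v \<rho>) \<rho>)
        = (\<lambda>w. 2 * wedge 2 3 (contract (K v) \<rho>) \<rho> w + 3 * wedge 2 3 (contract v \<rho>) rho_K w)"
    proof (rule ext)
      fix w
      have "deriv_form K 2 (contract v \<rho>) = (\<lambda>w. 2 * contract (K v) \<rho> w)"
        "deriv_form K 3 \<rho> = (\<lambda>w. 3 * rho_K w)"
        by (simp_all only: fun_eq_iff deriv_form_contract_rho deriv_form_rho) simp_all
      then show "deriv_form K 5 (wedge 2 3 (contract v \<rho>) \<rho>) w
        = 2 * wedge 2 3 (contract (K v) \<rho>) \<rho> w + 3 * wedge 2 3 (contract v \<rho>) rho_K w"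
        using deriv_form_wedge[OF alt_form_contract_rho[of v] \<rho>, of K w]
        by (simp add: wedge_scale_left wedge_scale_right del: contract_apply)
    qed
    ultimately have "wedge 1 5 (cov (\<lambda>x. \<phi> (K x))) (wedge 2 3 (contract v \<rho>) \<rho>) w + 2 * P + 3 * Q = 0"
      using deriv_form_wedge[OF alt_form_cov[OF \<phi>] alt_form_rho_rho[of v], of K w]
      unfolding deriv_form_cov P_def Q_def by (simp add: wedge_add_right wedge_scale_right)
    \<comment> \<open>The first summand is \<phi>(K(K v)) times the volume, that is P again, so the
      relation reads 3P + 3Q = 0.\<close>
    then have PQ: "P + Q = 0" unfolding K_wedge[OF \<phi>K] P[symmetric] by simp
    have "contract v \<Theta> = (\<lambda>w. wedge 2 3 (contract (K v) \<rho>) \<rho> w - wedge 2 3 (contract v \<rho>) rho_K w)"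
    proof (rule ext)
      fix w
      have a: "alt_form (Suc 2) rho_K" "alt_form (Suc 2) \<rho>" using alt_form_rho_K \<rho> by auto
      show "contract v \<Theta> w = wedge 2 3 (contract (K v) \<rho>) \<rho> w - wedge 2 3 (contract v \<rho>) rho_K w"
        using wedge_Suc_Suc[OF a, of v w] wedge_comm[OF alt_form_rho_K alt_form_contract_rho, of v w]
        by (simp add: \<Theta>_def contract_rho_K)
    qed
    then have "wedge 1 5 (cov \<phi>) (contract v \<Theta>) w = P - Q"
      by (simp add: wedge_diff_right P_def Q_def)
    then show ?thesis using wedge_cov_contract_top[OF \<phi> \<Theta>, of v w] PQ P by simp
  qed
  note key = this
  have "K (K v) = (\<Theta> w / (2 * vol w)) *\<^sub>R v" for v
  proof -
    have "K (K v) $ j = ((\<Theta> w / (2 * vol w)) *\<^sub>R v) $ j" for j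
    proof -
      have "linear (\<lambda>x::V. x $ j)" by (auto simp: linear_iff)
      from key[OF this, of v] show ?thesis using w by (simp add: field_simps)
    qed
    then show ?thesis by (simp add: vec_eq_iff)
  qed
  then show ?thesis by blast
qed

end

section \<open>Compatible pairs\<close>

lemma square_contract:
  assumes \<omega>: "alt_form 2 \<omega>"
  shows "contract x (wedge 2 2 \<omega> \<omega>) = (\<lambda>v. 2 * wedge 1 2 (contract x \<omega>) \<omega> v)"
proof (rule ext)
  fix v
  have a: "alt_form (Suc 1) \<omega>" using \<omega> by (simp add: numeral_2_eq_2)
  have c: "alt_form 1 (contract x \<omega>)" by (rule alt_form_contract[OF a])
  show "contract x (wedge 2 2 \<omega> \<omega>) v = 2 * wedge 1 2 (contract x \<omega>) \<omega> v"
    using wedge_Suc_Suc[OF a a, of x v] wedge_comm[OF \<omega> c, of v] by (simp add: numeral_2_eq_2)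
qed

lemma alt_form_square:
  assumes "alt_form 2 \<omega>"
  shows "alt_form 4 (wedge 2 2 \<omega> \<omega>)"
  using alt_form_wedge[OF assms assms] by simp

lemma alt_form_cube:
  assumes "alt_form 2 \<omega>"
  shows "alt_form 6 (cube \<omega>)"
  using alt_form_wedge[OF alt_form_square[OF assms] assms] by (simp add: cube_def)

lemma cube_contract:
  assumes \<omega>: "alt_form 2 \<omega>"
  shows "contract x (cube \<omega>) v = 3 * wedge 1 4 (contract x \<omega>) (wedge 2 2 \<omega> \<omega>) v"
proof -
  have a: "alt_form (Suc 1) \<omega>" using \<omega> by (simp add: numeral_2_eq_2)
  have c: "alt_form 1 (contract x \<omega>)" by (rule alt_form_contract[OF a])
  have c3: "alt_form 3 (wedge 1 2 (contract x \<omega>) \<omega>)" using alt_form_wedge[OF c \<omega>] by (simp add: numeral_3_eq_3)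
  have "cube \<omega> (x ## v) = wedge 3 2 (contract x (wedge 2 2 \<omega> \<omega>)) \<omega> v
      + wedge 4 1 (wedge 2 2 \<omega> \<omega>) (contract x \<omega>) v"
    using wedge_vcons[OF alt_form_square[OF \<omega>] \<omega>, of x v] by (simp add: cube_def)
  also have "wedge 3 2 (contract x (wedge 2 2 \<omega> \<omega>)) \<omega> v = 2 * wedge 3 2 (wedge 1 2 (contract x \<omega>) \<omega>) \<omega> v"
    unfolding square_contract[OF \<omega>] by (rule wedge_scale_left)
  also have "wedge 3 2 (wedge 1 2 (contract x \<omega>) \<omega>) \<omega> v = wedge 2 3 \<omega> (wedge 1 2 (contract x \<omega>) \<omega>) v"
    using wedge_comm[OF c3 \<omega>, of v] by simp
  also have "\<dots> = wedge 1 4 (contract x \<omega>) (wedge 2 2 \<omega> \<omega>) v"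
    using wedge_left_commute[OF \<omega> c \<omega>, of v] by (simp add: numeral_eq_Suc)
  also have "wedge 4 1 (wedge 2 2 \<omega> \<omega>) (contract x \<omega>) v = wedge 1 4 (contract x \<omega>) (wedge 2 2 \<omega> \<omega>) v"
    using wedge_comm[OF alt_form_square[OF \<omega>] c, of v] by simp
  finally have "cube \<omega> (x ## v) = 3 * wedge 1 4 (contract x \<omega>) (wedge 2 2 \<omega> \<omega>) v"
    by (simp del: contract_apply)
  then show ?thesis by (simp only: contract_apply)
qed

lemma two_form_cov:
  assumes "alt_form 2 \<omega>"
  shows "linear (\<lambda>y. \<omega> (x ## y ## u))" "contract x \<omega> = cov (\<lambda>y. \<omega> (x ## y ## u))"
proof -
  have a: "alt_form (Suc (Suc 0)) \<omega>" using assms by (simp add: numeral_2_eq_2)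
  show "linear (\<lambda>y. \<omega> (x ## y ## u))" by (rule alt_form_linear_second[OF a])
  show "contract x \<omega> = cov (\<lambda>y. \<omega> (x ## y ## u))"
    by (rule ext) (auto simp: cov_def intro!: alt_form_cong[OF assms] split: nat.split)
qed

lemma two_form_tail:
  assumes "alt_form 2 \<omega>"
  shows "\<omega> (x ## y ## u) = \<omega> (x ## y ## u')"
  by (rule alt_form_cong[OF assms]) (auto split: nat.split)

lemma wedge_1_2_eq:
  assumes \<omega>: "alt_form 2 \<omega>" and \<gamma>: "alt_form 2 \<gamma>"
  shows "wedge 1 2 (contract a \<omega>) \<gamma> (b ## c ## d ## u) = \<omega> (a ## b ## u) * \<gamma> (c ## d ## u)
    - \<omega> (a ## c ## u) * \<gamma> (b ## d ## u) + \<omega> (a ## d ## u) * \<gamma> (b ## c ## u)"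
  unfolding two_form_cov(2)[OF \<omega>, of a u] wedge_cov_expand[OF two_form_cov(1)[OF \<omega>, of a u] \<gamma>]
  using two_form_tail[OF \<gamma>, of b c "d ## u" u]
  by (simp add: numeral_2_eq_2 del_0 del_Suc)

lemma wedge_2_2_eq:
  assumes \<omega>: "alt_form 2 \<omega>" and \<gamma>: "alt_form 2 \<gamma>"
  shows "wedge 2 2 \<omega> \<gamma> (a ## b ## c ## d ## u) = \<omega> (a ## b ## u) * \<gamma> (c ## d ## u)
    - \<omega> (a ## c ## u) * \<gamma> (b ## d ## u) + \<omega> (a ## d ## u) * \<gamma> (b ## c ## u)
    + \<gamma> (a ## b ## u) * \<omega> (c ## d ## u)
    - \<gamma> (a ## c ## u) * \<omega> (b ## d ## u) + \<gamma> (a ## d ## u) * \<omega> (b ## c ## u)"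
proof -
  have c: "alt_form 1 (contract a \<gamma>)" using alt_form_contract[of 1 \<gamma>] \<gamma> by (simp add: numeral_2_eq_2)
  have "wedge 2 2 \<omega> \<gamma> (a ## b ## c ## d ## u) = wedge 1 2 (contract a \<omega>) \<gamma> (b ## c ## d ## u)
      + wedge 2 1 \<omega> (contract a \<gamma>) (b ## c ## d ## u)"
    using wedge_vcons[OF \<omega> \<gamma>, of a "b ## c ## d ## u"] by simp
  also have "wedge 2 1 \<omega> (contract a \<gamma>) (b ## c ## d ## u) = wedge 1 2 (contract a \<gamma>) \<omega> (b ## c ## d ## u)"
    using wedge_comm[OF \<omega> c] by simp
  finally show ?thesis unfolding wedge_1_2_eq[OF \<omega> \<gamma>] wedge_1_2_eq[OF \<gamma> \<omega>] by simp
qed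

lemma square_eq:
  assumes \<omega>: "alt_form 2 \<omega>"
  shows "wedge 2 2 \<omega> \<omega> (a ## b ## c ## d ## u) = 2 * (\<omega> (a ## b ## u) * \<omega> (c ## d ## u)
    - \<omega> (a ## c ## u) * \<omega> (b ## d ## u) + \<omega> (a ## d ## u) * \<omega> (b ## c ## u))"
  unfolding wedge_2_2_eq[OF \<omega> \<omega>] by simp

lemma cube_eq:
  assumes \<omega>: "alt_form 2 \<omega>"
  shows "cube \<omega> (x ## v) = 3 * (\<Sum>i\<le>4. (- 1) ^ i * \<omega> (x ## v i ## u) * wedge 2 2 \<omega> \<omega> (del i v))"
  using cube_contract[OF \<omega>, of x v]
    wedge_cov_expand[OF two_form_cov(1)[OF \<omega>, of x u] alt_form_square[OF \<omega>], of v]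
  by (simp add: two_form_cov(2)[OF \<omega>, of x u, symmetric])

text \<open>One step of the symplectic Gram-Schmidt process. The hypothesis \<open>proj\<close> says
  that every vector can be made orthogonal to S by a correction in the span of S; the conclusion
  restores it for the enlarged set, so the step can be iterated.\<close>

lemma hyperbolic_pair:
  fixes w :: "'a::euclidean_space \<Rightarrow> 'a \<Rightarrow> real"
  assumes l: "\<And>x. linear (w x)" and anti: "\<And>x y. w x y = - w y x"
    and nondeg: "\<forall>x. x \<noteq> 0 \<longrightarrow> (\<exists>y. w x y \<noteq> 0)"
    and S: "finite S" "card S < DIM('a)"
    and proj: "\<And>x. \<exists>x'. x - x' \<in> span S \<and> (\<forall>s\<in>S. w s x' = 0)"
  obtains e f where "w e f = 1" "\<forall>s\<in>S. w s e = 0 \<and> w s f = 0"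
    "\<And>x. \<exists>x'. x - x' \<in> span (insert e (insert f S)) \<and> (\<forall>s\<in>insert e (insert f S). w s x' = 0)"
proof -
  have "dim S < DIM('a)" using dim_le_card'[OF S(1)] S(2) by simp
  then have "span S \<noteq> UNIV" by (metis dim_UNIV dim_span less_irrefl)
  then obtain x where x: "x \<notin> span S" by blast
  obtain e where e: "x - e \<in> span S" "\<forall>s\<in>S. w s e = 0" using proj by blast
  have "e \<noteq> 0" using e(1) x by auto
  then obtain y where y: "w e y \<noteq> 0" using nondeg by blast
  obtain y' where y': "y - y' \<in> span S" "\<forall>s\<in>S. w s y' = 0" using proj by blast
  \<comment> \<open>As e is orthogonal to S, replacing y by its orthogonal part y' does not change
    the pairing with e.\<close>
  have "w e z = 0" if "z \<in> span S" for z
    using that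
  proof (induction rule: span_induct_alt)
    case base show ?case by (rule linear_0[OF l])
  next
    case (step c s z)
    then show ?case using e(2) anti[of e s] by (simp add: linear_add[OF l] linear_scale[OF l])
  qed
  then have "w e (y - y') = 0" using y' by blast
  then have wy': "w e y' \<noteq> 0" using y by (simp add: linear_diff[OF l])
  define f where "f = (1 / w e y') *\<^sub>R y'"
  show thesis
  proof
    show ef: "w e f = 1" using wy' by (simp add: f_def linear_scale[OF l])
    show sef: "\<forall>s\<in>S. w s e = 0 \<and> w s f = 0" using e y' by (simp add: f_def linear_scale[OF l])
    fix z
    obtain z' where z': "z - z' \<in> span S" "\<forall>s\<in>S. w s z' = 0" using proj by blast
    \<comment> \<open>Removal of the components along e and f; the signs differ because the pairing
      of f with e is -1.\<close>
    define z2 where "z2 = z' + w f z' *\<^sub>R e - w e z' *\<^sub>R f"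
    have sub: "span S \<subseteq> span (insert e (insert f S))" by (rule span_mono) auto
    have "z - z2 = (z - z') - w f z' *\<^sub>R e + w e z' *\<^sub>R f" by (simp add: z2_def)
    also have "\<dots> \<in> span (insert e (insert f S))"
      by (rule span_add[OF span_diff[OF subsetD[OF sub z'(1)] span_scale[OF span_base]] span_scale[OF span_base]]) auto
    finally have "z - z2 \<in> span (insert e (insert f S))" .
    moreover have "w s z2 = 0" if "s \<in> insert e (insert f S)" for s
    proof -
      have "w e e = 0" "w f f = 0" "w f e = - 1"
        using anti[of e e] anti[of f f] anti[of f e] ef by auto
      then show ?thesis using that z'(2) sef ef
        by (auto simp: z2_def linear_add[OF l] linear_diff[OF l] linear_scale[OF l])
    qed
    ultimately show "\<exists>x'. z - x' \<in> span (insert e (insert f S)) \<and> (\<forall>s\<in>insert e (insert f S). w s x' = 0)"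
      by blast
  qed
qed

text \<open>Evaluate on a symplectic basis e1, f1, e2, f2, e3, f3. Since e1 pairs only with f1, a
  single term of the expansion survives, and the value is 3 * 2 = 6.\<close>

lemma cube_nonzero:
  fixes \<omega> :: "V form"
  assumes \<omega>: "alt_form 2 \<omega>" and nondeg: "\<And>x. x \<noteq> 0 \<Longrightarrow> \<exists>y. \<omega> (x ## y ## u) \<noteq> 0"
  shows "\<exists>v. cube \<omega> v \<noteq> 0"
proof -
  define w where "w x y = \<omega> (x ## y ## u)" for x y
  have l: "linear (w x)" for x unfolding w_def by (rule two_form_cov(1)[OF \<omega>])
  have anti: "w x y = - w y x" for x y
    unfolding w_def by (rule alt_form_head_swap[of 0]) (use \<omega> in \<open>simp add: numeral_2_eq_2\<close>)
  have nd: "\<forall>x. x \<noteq> 0 \<longrightarrow> (\<exists>y. w x y \<noteq> 0)" using nondeg by (simp add: w_def)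
  note hp = hyperbolic_pair[of w, OF l anti nd]
  have p0: "\<exists>x'. x - x' \<in> span {} \<and> (\<forall>s\<in>{}. w s x' = 0)" for x :: V
    by (rule exI[of _ x]) auto
  obtain e1 f1 where 1: "w e1 f1 = 1"
    "\<And>x. \<exists>x'. x - x' \<in> span {e1, f1} \<and> (\<forall>s\<in>{e1, f1}. w s x' = 0)"
    by (rule hp[of "{}", OF _ _ p0]) auto
  have "card {e1, f1} < DIM(V)" by (simp add: card_insert_if)
  then obtain e2 f2 where 2: "w e2 f2 = 1" "\<forall>s\<in>{e1, f1}. w s e2 = 0 \<and> w s f2 = 0"
    "\<And>x. \<exists>x'. x - x' \<in> span {e2, f2, e1, f1} \<and> (\<forall>s\<in>{e2, f2, e1, f1}. w s x' = 0)"
    by (rule hp[of "{e1, f1}", OF _ _ 1(2), rotated]) auto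
  have "card {e2, f2, e1, f1} < DIM(V)" by (simp add: card_insert_if)
  then obtain e3 f3 where 3: "w e3 f3 = 1" "\<forall>s\<in>{e2, f2, e1, f1}. w s e3 = 0 \<and> w s f3 = 0"
    by (rule hp[of "{e2, f2, e1, f1}", OF _ _ 2(3), rotated]) auto
  define v where "v = f1 ## e2 ## f2 ## e3 ## f3 ## u"
  have z: "w e1 (v i) = 0" if "i \<le> 4" "i \<noteq> 0" for i
  proof -
    have "i = 1 \<or> i = 2 \<or> i = 3 \<or> i = 4" using that by linarith
    then show ?thesis using 1 2 3 by (auto simp: v_def eval_nat_numeral)
  qed
  have "(\<Sum>i\<le>4. (- 1) ^ i * w e1 (v i) * wedge 2 2 \<omega> \<omega> (del i v))
      = (\<Sum>i\<in>{0}. (- 1) ^ i * w e1 (v i) * wedge 2 2 \<omega> \<omega> (del i v))"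
    by (rule sum.mono_neutral_right) (use z in auto)
  also have "\<dots> = wedge 2 2 \<omega> \<omega> (e2 ## f2 ## e3 ## f3 ## u)"
    using 1 by (simp add: v_def del_0)
  also have "\<dots> = 2"
    using square_eq[OF \<omega>, of e2 f2 e3 f3 u] 2 3 by (simp add: w_def[symmetric])
  finally have "cube \<omega> (e1 ## v) \<noteq> 0"
    using cube_eq[OF \<omega>, of e1 v u] by (simp add: w_def)
  then show ?thesis by blast
qed

locale su_pair =
  fixes \<omega> \<psi> :: "V form" and \<epsilon> :: real
  assumes \<omega>: "alt_form 2 \<omega>" and \<psi>: "alt_form 3 \<psi>"
    and \<epsilon>: "\<epsilon> = 1 \<or> \<epsilon> = - 1"
    and compat: "\<And>v. wedge 2 3 \<omega> \<psi> v = 0"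
    and sgn_lam: "sgn (lam (cube \<omega>) \<psi>) = \<epsilon>"
    and signature: "\<exists>a b. has_signature (metric \<epsilon> \<omega> \<psi>) a b"
begin

abbreviation "J \<equiv> Jmap \<omega> \<psi>"

lemma eps_square: "\<epsilon> * \<epsilon> = 1" and eps_nz: "\<epsilon> \<noteq> 0"
  using \<epsilon> by auto

lemma metric_eq: "metric \<epsilon> \<omega> \<psi> x y = \<epsilon> * \<omega> (x ## J y ## u)"
  unfolding metric_def nth_Cons_vcons using two_form_tail[OF \<omega>] by metis

lemma omega_linear1: "linear (\<lambda>x. \<omega> (x ## y ## u))"
  using alt_form_linear_head[of 1 \<omega>] \<omega> by (simp add: numeral_2_eq_2)

lemma omega_linear2: "linear (\<lambda>y. \<omega> (x ## y ## u))"
  by (rule two_form_cov(1)[OF \<omega>])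

lemma omega_swap: "\<omega> (x ## y ## u) = - \<omega> (y ## x ## u)"
  by (rule alt_form_head_swap[of 0]) (use \<omega> in \<open>simp add: numeral_2_eq_2\<close>)

text \<open>At this stage J is not known to be linear, since \<open>cube \<omega>\<close> might
  still vanish. Only linearity of the metric in its first argument, inherited from \<omega>, is used
  to see that the six frame vectors are independent.\<close>

lemma metric_frame:
  obtains e :: "6 \<Rightarrow> V" and s :: "6 \<Rightarrow> real" where "\<And>i. s i \<noteq> 0"
    "\<And>i j. metric \<epsilon> \<omega> \<psi> (e i) (e j) = (if i = j then s i else 0)"
    "\<And>x. \<exists>c. x = (\<Sum>i\<in>UNIV. c i *\<^sub>R e i)"
proof -
  obtain e :: "6 \<Rightarrow> V" and I where
    e: "\<And>i j. metric \<epsilon> \<omega> \<psi> (e i) (e j) = (if i = j then (if i \<in> I then 1 else - 1) else 0)"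
    using signature unfolding has_signature_def by blast
  define s :: "6 \<Rightarrow> real" where "s i = (if i \<in> I then 1 else - 1)" for i
  have g: "metric \<epsilon> \<omega> \<psi> (e i) (e j) = (if i = j then s i else 0)" for i j
    using e by (simp add: s_def)
  define T :: "V \<Rightarrow> V" where "T c = (\<Sum>i\<in>UNIV. c $ i *\<^sub>R e i)" for c
  have T: "linear T"
    unfolding T_def by (intro linearI) (auto simp: sum.distrib scaleR_add_left scaleR_sum_right)
  have "inj T"
  proof (rule linear_injective_on_subspace_0[OF T subspace_UNIV, THEN iffD2], intro ballI impI)
    fix c assume "T c = 0"
    have "c $ j * s j = 0" for j
    proof -
      have "metric \<epsilon> \<omega> \<psi> (T c) (e j) = (\<Sum>i\<in>UNIV. c $ i * metric \<epsilon> \<omega> \<psi> (e i) (e j))"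
        unfolding metric_eq[where u = undefined] T_def
        by (simp add: linear_sum[OF omega_linear1] linear_scale[OF omega_linear1] sum_distrib_left algebra_simps)
      also have "\<dots> = c $ j * s j" by (simp add: g if_distrib[of "\<lambda>x. _ * x"] cong: if_cong)
      finally show ?thesis
        using \<open>T c = 0\<close> by (simp add: metric_eq[where u = undefined] linear_0[OF omega_linear1])
    qed
    then have "c $ j = 0" for j by (metis s_def mult_eq_0_iff neg_equal_0_iff_equal one_neq_zero)
    then show "c = 0" by (simp add: vec_eq_iff)
  qed
  then have "surj T" using linear_injective_imp_surjective[OF T] by simp
  have "\<exists>c. x = (\<Sum>i\<in>UNIV. c i *\<^sub>R e i)" for x
  proof -
    obtain c where "x = T c" using \<open>surj T\<close> by (metis surjD)
    then show ?thesis unfolding T_def by blast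
  qed
  moreover have "s i \<noteq> 0" for i by (simp add: s_def)
  ultimately show thesis using that[of s e] g by blast
qed

lemma omega_nondeg:
  assumes "\<And>y. \<omega> (x ## y ## u) = 0"
  shows "x = 0"
proof -
  obtain e s where s: "\<And>i. s i \<noteq> (0::real)"
    and g: "\<And>i j. metric \<epsilon> \<omega> \<psi> (e i) (e j) = (if i = j then s i else 0)"
    and sp: "\<And>x. \<exists>c. x = (\<Sum>i\<in>UNIV. c i *\<^sub>R e (i::6))"
    by (rule metric_frame) blast
  obtain c where c: "x = (\<Sum>i\<in>UNIV. c i *\<^sub>R e i)" using sp by blast
  have "c j = 0" for j
  proof -
    have "metric \<epsilon> \<omega> \<psi> x (e j) = (\<Sum>i\<in>UNIV. c i * metric \<epsilon> \<omega> \<psi> (e i) (e j))"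
      unfolding metric_eq[where u = undefined] c
      by (simp add: linear_sum[OF omega_linear1] linear_scale[OF omega_linear1] sum_distrib_left algebra_simps)
    also have "\<dots> = c j * s j" by (simp add: g if_distrib[of "\<lambda>x. _ * x"] cong: if_cong)
    finally show ?thesis using s assms by (simp add: metric_eq[where u = u])
  qed
  then show ?thesis using c by simp
qed

lemma cube_nz: "\<exists>v. cube \<omega> v \<noteq> 0"
  by (rule cube_nonzero[OF \<omega>, of undefined]) (use omega_nondeg in blast)

end

sublocale su_pair \<subseteq> volume_and_three_form "cube \<omega>" \<psi>
  by unfold_locales (use alt_form_cube[OF \<omega>] cube_nz \<psi> in auto)

section \<open>The endomorphism J and its symmetries with respect to omega and psi\<close>

context su_pair
begin

definition phi :: real where
  "phi = sqrt \<bar>lam (cube \<omega>) \<psi>\<bar>"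

lemma phi_pos: "phi > 0"
  using sgn_lam eps_nz by (auto simp: phi_def sgn_0_0)

lemma K_eq_J: "K v = phi *\<^sub>R J v"
  using phi_pos by (simp add: Jmap_def phi_def)

lemma J_eq_K: "J v = (1 / phi) *\<^sub>R K v"
  by (simp add: Jmap_def phi_def)

lemma linear_J: "linear J"
  using linear_compose_scale_right[OF linear_K, of "1 / phi"] by (simp add: J_eq_K[abs_def])

text \<open>The metric is diagonal in its frame. Once J is linear both arguments can be expanded,
  and symmetry becomes the skewness of J for \<omega>.\<close>

lemma metric_sym: "metric \<epsilon> \<omega> \<psi> x y = metric \<epsilon> \<omega> \<psi> y x"
proof -
  obtain e s where g: "\<And>i j. metric \<epsilon> \<omega> \<psi> (e i) (e j) = (if i = j then s i else 0)"
    and sp: "\<And>x. \<exists>c. x = (\<Sum>i\<in>UNIV. c i *\<^sub>R e (i::6))"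
    by (rule metric_frame) blast
  have "metric \<epsilon> \<omega> \<psi> (\<Sum>i\<in>UNIV. a i *\<^sub>R e i) (\<Sum>j\<in>UNIV. b j *\<^sub>R e j)
      = (\<Sum>i\<in>UNIV. a i * b i * s i)" for a b
  proof -
    have 1: "metric \<epsilon> \<omega> \<psi> (\<Sum>i\<in>UNIV. a i *\<^sub>R e i) y = (\<Sum>i\<in>UNIV. a i * metric \<epsilon> \<omega> \<psi> (e i) y)" for y
      unfolding metric_eq[where u = undefined]
      by (simp add: linear_sum[OF omega_linear1] linear_scale[OF omega_linear1] sum_distrib_left algebra_simps)
    have 2: "metric \<epsilon> \<omega> \<psi> x (\<Sum>i\<in>UNIV. b i *\<^sub>R e i) = (\<Sum>i\<in>UNIV. b i * metric \<epsilon> \<omega> \<psi> x (e i))" for x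
      unfolding metric_eq[where u = undefined]
      by (simp add: linear_sum[OF omega_linear2] linear_scale[OF omega_linear2]
         linear_sum[OF linear_J] linear_scale[OF linear_J] sum_distrib_left algebra_simps)
    show ?thesis
      unfolding 1 2 by (simp add: g if_distrib[of "\<lambda>x. _ * x"] algebra_simps cong: if_cong)
  qed
  note dia = this
  obtain a where "x = (\<Sum>i\<in>UNIV. a i *\<^sub>R e i)" using sp by blast
  moreover obtain b where "y = (\<Sum>i\<in>UNIV. b i *\<^sub>R e i)" using sp by blast
  ultimately show ?thesis using dia by (simp add: mult.commute[of "a _"])
qed

lemma omega_J: "\<omega> (J x ## y ## u) = - \<omega> (x ## J y ## u)"
proof -
  have "\<epsilon> * \<omega> (x ## J y ## u) = \<epsilon> * \<omega> (y ## J x ## u)"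
    using metric_sym[of x y] by (simp add: metric_eq[where u = u])
  then have "\<omega> (x ## J y ## u) = \<omega> (y ## J x ## u)" using eps_nz by simp
  then show ?thesis using omega_swap[of y "J x" u] by simp
qed

lemma omega_K: "\<omega> (K x ## y ## u) = - \<omega> (x ## K y ## u)"
  using omega_J[of x y u] by (simp add: K_eq_J linear_scale[OF omega_linear1] linear_scale[OF omega_linear2])

lemma deriv_K_omega: "deriv_form K 2 \<omega> = (\<lambda>v. 0)"
proof (rule ext)
  fix w :: "nat \<Rightarrow> V"
  obtain x y u where w: "w = x ## y ## u" by (metis vcons_head_tail)
  show "deriv_form K 2 \<omega> w = 0"
    unfolding w deriv_form_def using omega_K[of x y u]
    by (simp add: numeral_2_eq_2 vcons_upd_0 vcons_upd_Suc)
qed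

text \<open>Trace-freeness of K, in the form that \<open>K_squared\<close> requires: K is skew for
  \<omega>, so the derivation kills \<omega> and all its powers.\<close>

lemma deriv_K_cube: "deriv_form K 6 (cube \<omega>) w = 0"
proof -
  have "deriv_form K 4 (wedge 2 2 \<omega> \<omega>) = (\<lambda>v. 0)"
    using deriv_form_wedge[OF \<omega> \<omega>, of K] by (auto simp: deriv_K_omega wedge_zero_left wedge_zero_right)
  then show ?thesis
    using deriv_form_wedge[OF alt_form_square[OF \<omega>] \<omega>, of K w]
    unfolding deriv_K_omega by (simp add: cube_def[symmetric] wedge_zero_left wedge_zero_right)
qed

lemma K_K: "K (K v) = lam (cube \<omega>) \<psi> *\<^sub>R v"
proof -
  obtain \<mu> where \<mu>: "\<And>v. K (K v) = \<mu> *\<^sub>R v" using K_squared[OF deriv_K_cube] by blast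
  \<comment> \<open>The scalar \<mu> is identified by the trace: on a six-dimensional space it is 6
    \<mu>, which the factor 1/6 in \<open>lam\<close> normalises.\<close>
  have "matrix (K \<circ> K) = (\<chi> i j. if i = j then \<mu> else 0)"
    by (auto simp: matrix_def \<mu> axis_def vec_eq_iff)
  then have "lam (cube \<omega>) \<psi> = \<mu>" by (simp add: lam_def trace_def)
  then show ?thesis using \<mu> by simp
qed

lemma J_J: "J (J v) = \<epsilon> *\<^sub>R v"
proof -
  have "J (J v) = (1 / (phi * phi)) *\<^sub>R lam (cube \<omega>) \<psi> *\<^sub>R v"
    by (simp add: J_eq_K linear_scale[OF linear_K] K_K)
  also have "phi * phi = \<bar>lam (cube \<omega>) \<psi>\<bar>" by (simp add: phi_def)
  finally show ?thesis using sgn_lam eps_nz by (auto simp: sgn_real_def split: if_splits)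
qed

lemma psi_linear1: "linear (\<lambda>x. \<psi> (x ## v))"
  using alt_form_linear_head[of 2 \<psi>] \<psi> by simp

lemma psi_linear2: "linear (\<lambda>x. \<psi> (y ## x ## v))"
  using alt_form_linear_second[of 1 \<psi>] \<psi> by (simp add: numeral_3_eq_3)

lemma psi_linear3: "linear (\<lambda>x. \<psi> (y ## z ## x ## v))"
  using alt_form_linear_third[of 0 \<psi>] \<psi> by (simp add: numeral_3_eq_3)

lemma psi_J12: "\<psi> (J x ## y ## z ## u) = \<psi> (x ## J y ## z ## u)"
  using K_rho_symmetric[of x y z u]
  by (simp add: J_eq_K linear_scale[OF psi_linear1] linear_scale[OF psi_linear2])

lemma psi_J13: "\<psi> (x ## y ## J z ## u) = \<psi> (J x ## y ## z ## u)"
  using rho_swap23[of x y "J z" u] psi_J12[of x z y u] rho_swap23[of "J x" z y u] by simp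

text \<open>If x contracts \<psi> to zero then K x = 0 by the definition of K, but K is a nonzero
  multiple of the invertible J.\<close>

lemma psi_nondeg:
  assumes "\<And>y z. \<psi> (x ## y ## z ## u) = 0"
  shows "x = 0"
proof -
  have "contract x \<psi> = (\<lambda>v. 0)"
  proof (rule ext)
    fix v :: "nat \<Rightarrow> V"
    obtain y z u' where v: "v = y ## z ## u'" by (metis vcons_head_tail)
    have "\<psi> (x ## v) = \<psi> (x ## y ## z ## u)"
      unfolding v by (rule alt_form_cong[OF \<psi>]) (auto split: nat.split simp: less_Suc_eq numeral_3_eq_3)
    then show "contract x \<psi> v = 0" using assms by simp
  qed
  then have "contract 0 (cube \<omega>) = wedge 2 3 (contract x \<psi>) \<psi>"
    using linear_0[OF alt_form_linear_head[of 5 "cube \<omega>"]] vol by (auto simp: wedge_zero_left)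
  then have "K x = 0" by (rule K_eqI)
  then have "J x = 0" by (simp add: J_eq_K)
  then show ?thesis using J_J[of x] eps_nz linear_0[OF linear_J] by simp
qed

end

text \<open>The behaviour of \<open>B\<close> under \<open>J\<close> forces \<open>\<sigma>\<close> to be of type \<open>(2,2)\<close>, so that \<open>J\<close> acts on it
  trivially as a derivation; this is the stated antisymmetry.\<close>

lemma type_2_2_pair_antisym:
  fixes \<sigma> :: "'a::real_vector \<Rightarrow> 'a \<Rightarrow> 'a \<Rightarrow> 'a \<Rightarrow> real"
  assumes JJ: "\<And>x. J (J x) = \<epsilon> *\<^sub>R x" and eps: "\<epsilon> * \<epsilon> = 1"
    and s1: "\<And>c x y z t. \<sigma> (c *\<^sub>R x) y z t = c * \<sigma> x y z t"
    and s12: "\<And>x y z t. \<sigma> x y z t = - \<sigma> y x z t"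
    and s23: "\<And>x y z t. \<sigma> x y z t = - \<sigma> x z y t"
    and s34: "\<And>x y z t. \<sigma> x y z t = - \<sigma> x y t z"
    and B: "\<And>x y z t. \<sigma> (J x) y z t + \<sigma> x (J y) z t = B x y z t"
    and BJ: "\<And>x y z t. B (J x) y z t = - B x y (J z) t"
  shows "B x y z t = - B z t x y"
proof -
  have s2: "\<sigma> x (c *\<^sub>R y) z t = c * \<sigma> x y z t" for c x y z t
    using s12[of x "c *\<^sub>R y"] s12[of x y] by (simp add: s1)
  have s3: "\<sigma> x y (c *\<^sub>R z) t = c * \<sigma> x y z t" for c x y z t
    using s23[of x y "c *\<^sub>R z"] s23[of x y z] by (simp add: s2)
  \<comment> \<open>Rewriting \<open>BJ\<close> by \<open>B\<close>. The identity says that no three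
    slots carry a component of pure type (3,0) or (0,3), which leaves only type (2,2).\<close>
  have III: "\<epsilon> * \<sigma> x y z t + \<sigma> (J x) (J y) z t + \<sigma> (J x) y (J z) t + \<sigma> x (J y) (J z) t = 0" for x y z t
    using B[of "J x" y z t] B[of x y "J z" t] BJ[of x y z t] by (simp add: JJ s1)
  have IV: "\<epsilon> * (\<sigma> (J x) y z t + \<sigma> x (J y) z t + \<sigma> x y (J z) t) + \<sigma> (J x) (J y) (J z) t = 0" for x y z t
    using III[of "J x" y z t] by (simp add: JJ s1 algebra_simps)
  have a: "\<sigma> x y z t = \<sigma> z t x y" for x y z t
    using s23[of x y z t] s12[of x z y t] s34[of z x y t] s23[of z x t y] by simp
  have b: "\<sigma> x y z t = \<sigma> x z t y" for x y z t
    using s23[of x y z t] s34[of x z y t] by simp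
  have c: "\<sigma> x y z t = \<sigma> y z x t" for x y z t
    using s12[of x y z t] s23[of y x z t] by simp
  have "\<epsilon> * \<sigma> x y z (J t) + \<sigma> (J x) (J y) z (J t) + \<sigma> (J x) y (J z) (J t) + \<sigma> x (J y) (J z) (J t) = 0"
    by (rule III)
  moreover have "\<epsilon> * (\<sigma> (J x) y z t + \<sigma> x (J y) z t + \<sigma> x y z (J t)) + \<sigma> (J x) (J y) z (J t) = 0"
    using IV[of x y t z] s34[of "J x" y t z] s34[of x "J y" t z] s34[of x y "J t" z] s34[of "J x" "J y" "J t" z]
    by (simp add: algebra_simps)
  moreover have "\<epsilon> * (\<sigma> (J x) y z t + \<sigma> x y (J z) t + \<sigma> x y z (J t)) + \<sigma> (J x) y (J z) (J t) = 0"
    using IV[of x z t y] b[of "J x" y z t] b[of x y "J z" t] b[of x y z "J t"] b[of "J x" y "J z" "J t"]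
    by simp
  moreover have "\<epsilon> * (\<sigma> x (J y) z t + \<sigma> x y (J z) t + \<sigma> x y z (J t)) + \<sigma> x (J y) (J z) (J t) = 0"
  proof -
    have d: "\<sigma> x y z t = - \<sigma> y z t x" for x y z t
      using c[of x y z t] s34[of y z x t] by simp
    show ?thesis
      using IV[of y z t x] d[of x "J y" z t] d[of x y "J z" t] d[of x y z "J t"] d[of x "J y" "J z" "J t"]
      by (simp add: algebra_simps)
  qed
  \<comment> \<open>The last three relations are \<open>IV\<close> for the triples of slots that
    contain t. Their sum minus the first relation is twice \<epsilon> times the action of J as a
    derivation; all terms with three copies of J cancel.\<close>
  ultimately have "\<epsilon> * (\<sigma> (J x) y z t + \<sigma> x (J y) z t + \<sigma> x y (J z) t + \<sigma> x y z (J t)) = 0"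
    by (simp add: algebra_simps)
  then have "\<sigma> (J x) y z t + \<sigma> x (J y) z t + \<sigma> x y (J z) t + \<sigma> x y z (J t) = 0"
    using eps by (metis mult_eq_0_iff zero_neq_one)
  then show ?thesis
    using B[of x y z t] B[of z t x y] a[of x y "J z" t] a[of x y z "J t"] by simp
qed

text \<open>Insertions of J into any two slots are opposite to each other. With three slots at hand
  each insertion is its own negative, and J is invertible.\<close>

lemma four_form_zero_if_J_pair_zero:
  fixes \<sigma> :: "'a::real_vector \<Rightarrow> 'a \<Rightarrow> 'a \<Rightarrow> 'a \<Rightarrow> real"
  assumes JJ: "\<And>x. J (J x) = \<epsilon> *\<^sub>R x" and eps: "\<epsilon> * \<epsilon> = 1"
    and s1: "\<And>c x y z t. \<sigma> (c *\<^sub>R x) y z t = c * \<sigma> x y z t"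
    and s12: "\<And>x y z t. \<sigma> x y z t = - \<sigma> y x z t"
    and s23: "\<And>x y z t. \<sigma> x y z t = - \<sigma> x z y t"
    and B: "\<And>x y z t. \<sigma> (J x) y z t + \<sigma> x (J y) z t = 0"
  shows "\<sigma> x y z t = 0"
proof -
  have "\<sigma> (J x) y z t = 0" for x y z t
  proof -
    have "\<sigma> (J x) y z t + \<sigma> x y (J z) t = 0"
      using B[of x z y t] s23[of "J x" y z t] s23[of x y "J z" t] by simp
    moreover have "\<sigma> x (J y) z t + \<sigma> x y (J z) t = 0"
      using B[of y z x t] s12[of x "J y" z t] s23[of "J y" x z t] s12[of x y "J z" t] s23[of y x "J z" t]
      by simp
    ultimately show ?thesis using B[of x y z t] by simp
  qed
  from this[of "J x"] have "\<epsilon> * \<sigma> x y z t = 0" by (simp add: JJ s1)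
  then show ?thesis using eps by (metis mult_eq_0_iff zero_neq_one)
qed

text \<open>Over the (para-)complex numbers the derivation has the eigenvalues (\<plusminus>1
  \<plusminus>1 \<plusminus>1) times a square root of \<epsilon>. A sum of three signs is odd, so
  the derivation is injective.\<close>

lemma trilinear_J_derivation_zero:
  fixes G :: "'a::real_vector \<Rightarrow> 'a \<Rightarrow> 'a \<Rightarrow> real"
  assumes JJ: "\<And>x. J (J x) = \<epsilon> *\<^sub>R x" and eps: "\<epsilon> * \<epsilon> = 1"
    and s1: "\<And>c x y z. G (c *\<^sub>R x) y z = c * G x y z"
    and s2: "\<And>c x y z. G x (c *\<^sub>R y) z = c * G x y z"
    and s3: "\<And>c x y z. G x y (c *\<^sub>R z) = c * G x y z"
    and D: "\<And>x y z. G (J x) y z + G x (J y) z + G x y (J z) = 0"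
  shows "G x y z = 0"
proof -
  have e0: "\<epsilon> \<noteq> 0" using eps by auto
  have z: "G (J x) y z = 0" for x y z
  proof -
    have "\<epsilon> * (G x (J y) z + G (J x) y z) + G (J x) (J y) (J z) = 0"
      using D[of "J x" "J y" z] by (simp add: JJ s1 s2 algebra_simps)
    moreover have "\<epsilon> * (G x y (J z) + G (J x) y z) + G (J x) (J y) (J z) = 0"
      using D[of "J x" y "J z"] by (simp add: JJ s1 s3 algebra_simps)
    moreover have "\<epsilon> * (G x y (J z) + G x (J y) z) + G (J x) (J y) (J z) = 0"
      using D[of x "J y" "J z"] by (simp add: JJ s2 s3 algebra_simps)
    ultimately have "\<epsilon> * (G x (J y) z - G x y (J z)) = 0" "\<epsilon> * (G (J x) y z - G x y (J z)) = 0"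
      unfolding distrib_left right_diff_distrib by linarith+
    then have "G x (J y) z = G x y (J z)" "G (J x) y z = G x y (J z)" using e0 by simp_all
    then show ?thesis using D[of x y z] by simp
  qed
  from z[of "J x" y z] show ?thesis using e0 by (simp add: JJ s1)
qed

section \<open>Three-forms of type (3,0) + (0,3) and products with omega\<close>

context su_pair
begin

definition om :: "V \<Rightarrow> V \<Rightarrow> real" where "om x y = \<omega> (x ## y ## (\<lambda>_. 0))"

definition ps :: "V \<Rightarrow> V \<Rightarrow> V \<Rightarrow> real" where "ps x y z = \<psi> (x ## y ## z ## (\<lambda>_. 0))"

lemma om_eq: "\<omega> (x ## y ## u) = om x y"
  unfolding om_def by (rule two_form_tail[OF \<omega>])

lemma ps_eq: "\<psi> (x ## y ## z ## u) = ps x y z"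
  unfolding ps_def
  by (rule alt_form_cong[OF \<psi>]) (auto split: nat.split simp: less_Suc_eq numeral_3_eq_3)

lemma om_linear1: "linear (\<lambda>x. om x y)" and om_linear2: "linear (om x)"
  unfolding om_def by (rule omega_linear1, rule omega_linear2)

lemma om_anti: "om x y = - om y x"
  unfolding om_def by (rule omega_swap)

lemma om_self [simp]: "om x x = 0"
  using om_anti[of x x] by simp

lemma om_J: "om (J x) y = - om x (J y)"
  unfolding om_def by (rule omega_J)

lemma om_nondeg: "(\<And>y. om x y = 0) \<Longrightarrow> x = 0"
  unfolding om_def by (rule omega_nondeg)

lemma om_cov: "contract x \<omega> = cov (om x)"
  using two_form_cov(2)[OF \<omega>, of x] by (simp add: om_eq)

lemmas om_lin = linear_add[OF om_linear1] linear_add[OF om_linear2]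
  linear_diff[OF om_linear1] linear_diff[OF om_linear2]
  linear_neg[OF om_linear1] linear_neg[OF om_linear2]
  linear_scale[OF om_linear1] linear_scale[OF om_linear2]
  linear_0[OF om_linear1] linear_0[OF om_linear2]

lemma ps_linear1: "linear (\<lambda>x. ps x y z)" and ps_linear2: "linear (\<lambda>y. ps x y z)"
  and ps_linear3: "linear (ps x y)"
  unfolding ps_def by (rule psi_linear1, rule psi_linear2, rule psi_linear3)

lemma ps_swap12: "ps x y z = - ps y x z" and ps_swap23: "ps x y z = - ps x z y"
  unfolding ps_def by (rule rho_swap12, rule rho_swap23)

lemma ps_J12: "ps (J x) y z = ps x (J y) z" and ps_J13: "ps (J x) y z = ps x y (J z)"
  unfolding ps_def by (rule psi_J12, rule psi_J13[symmetric])

lemma ps_nondeg: "(\<And>y z. ps x y z = 0) \<Longrightarrow> x = 0"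
  unfolding ps_def by (rule psi_nondeg)

lemma ps_repeat [simp]: "ps x x z = 0" "ps x z z = 0" "ps x z x = 0"
  using ps_swap12[of x x z] ps_swap23[of x z z] ps_swap23[of x z x] by auto

text \<open>On \<open>{x,y}\<^sup>\<bottom>\<close>, for a hyperbolic pair \<open>x, y\<close>, the hypothesis says \<open>\<gamma> = - \<gamma>(x,y) \<omega>\<close>; comparing three
  mutually orthogonal pairs gives \<open>\<gamma>(x,y) = 0\<close>.\<close>

lemma omega_wedge_injective:
  assumes \<gamma>: "alt_form 2 \<gamma>" and z: "\<And>v. wedge 2 2 \<omega> \<gamma> v = 0"
  shows "\<gamma> v = 0"
proof -
  define g where "g x y = \<gamma> (x ## y ## (\<lambda>_. 0))" for x y
  have g_eq: "\<gamma> (x ## y ## u) = g x y" for x y u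
    unfolding g_def by (rule two_form_tail[OF \<gamma>])
  have g_lin: "linear (g x)" for x unfolding g_def by (rule two_form_cov(1)[OF \<gamma>])
  have E: "om a b * g c d - om a c * g b d + om a d * g b c
      + g a b * om c d - g a c * om b d + g a d * om b c = 0" for a b c d
    using wedge_2_2_eq[OF \<omega> \<gamma>, of a b c d "\<lambda>_. 0"] z by (simp add: om_eq g_eq)
  have hyp: "g x y = 0" if xy: "om x y = 1" for x y
  proof -
    have proj1: "\<exists>x'. z - x' \<in> span {x, y} \<and> (\<forall>s\<in>{x, y}. om s x' = 0)" for z
    proof (intro exI[of _ "z + om y z *\<^sub>R x - om x z *\<^sub>R y"] conjI ballI)
      have "z - (z + om y z *\<^sub>R x - om x z *\<^sub>R y) = om x z *\<^sub>R y - om y z *\<^sub>R x" by simp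
      also have "\<dots> \<in> span {x, y}" by (intro span_diff span_scale span_base) auto
      finally show "z - (z + om y z *\<^sub>R x - om x z *\<^sub>R y) \<in> span {x, y}" .
      fix s assume "s \<in> {x, y}"
      then show "om s (z + om y z *\<^sub>R x - om x z *\<^sub>R y) = 0"
        using xy om_anti[of y x] by (auto simp: om_lin)
    qed
    have nd: "\<forall>x. x \<noteq> 0 \<longrightarrow> (\<exists>y. om x y \<noteq> 0)" using om_nondeg by blast
    note hp = hyperbolic_pair[of om, OF om_linear2 om_anti nd]
    have "card {x, y} < DIM(V)" by (simp add: card_insert_if)
    with hp[of "{x, y}", OF _ _ proj1] obtain e2 f2 where 2: "om e2 f2 = 1" "\<forall>s\<in>{x, y}. om s e2 = 0 \<and> om s f2 = 0"
      "\<And>z. \<exists>x'. z - x' \<in> span {e2, f2, x, y} \<and> (\<forall>s\<in>{e2, f2, x, y}. om s x' = 0)" by auto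
    have "card {e2, f2, x, y} < DIM(V)" by (simp add: card_insert_if)
    then obtain e3 f3 where 3: "om e3 f3 = 1" "\<forall>s\<in>{e2, f2, x, y}. om s e3 = 0 \<and> om s f3 = 0"
      by (rule hp[of "{e2, f2, x, y}", OF _ _ 2(3), rotated]) auto
    have "g e2 f2 + g x y = 0" using E[of x y e2 f2] 2 xy by simp
    moreover have "g e3 f3 + g x y = 0" using E[of x y e3 f3] 3 xy by simp
    moreover have "g e3 f3 + g e2 f2 = 0" using E[of e2 f2 e3 f3] 2 3 by simp
    ultimately show ?thesis by simp
  qed
  have hyp2: "g x y = 0" if "om x y \<noteq> 0" for x y
  proof -
    have "om x ((1 / om x y) *\<^sub>R y) = 1" using that by (simp add: om_lin)
    then have "g x ((1 / om x y) *\<^sub>R y) = 0" by (rule hyp)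
    then show ?thesis using that by (simp add: linear_scale[OF g_lin])
  qed
  have all: "g x y = 0" for x y
  proof (cases "x = 0")
    case True
    have "linear (\<lambda>x. g x y)"
      unfolding g_def using alt_form_linear_head[of 1 \<gamma>] \<gamma> by (simp add: numeral_2_eq_2)
    from linear_0[OF this] show ?thesis using True by simp
  next
    case False
    then obtain y' where y': "om x y' \<noteq> 0" using om_nondeg by blast
    show ?thesis
    proof (cases "om x y = 0")
      case True
      \<comment> \<open>The linear map \<open>g x\<close> vanishes off a hyperplane. A vector of the
        hyperplane is the difference of two vectors off it, so \<open>g x\<close> vanishes
        everywhere.\<close>
      then have "om x (y + y') \<noteq> 0" using y' by (simp add: om_lin)
      then have "g x (y + y') = 0" by (rule hyp2)
      then show ?thesis using hyp2[OF y'] by (simp add: linear_add[OF g_lin])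
    qed (rule hyp2)
  qed
  obtain x y u where "v = x ## y ## u" by (metis vcons_head_tail)
  then show ?thesis using all by (simp add: g_eq)
qed

text \<open>The polarisation of \<open>Kmap\<close>, which is quadratic in its three-form.\<close>

definition KK :: "V form \<Rightarrow> V form \<Rightarrow> V \<Rightarrow> V" where
  "KK S T v = kappa (cube \<omega>) (wedge 2 3 (contract v S) T)"

lemma KK_wedge:
  assumes S: "alt_form 3 S" and T: "alt_form 3 T" and \<phi>: "linear \<phi>"
  shows "wedge 1 5 (cov \<phi>) (wedge 2 3 (contract v S) T) w = \<phi> (KK S T v) * cube \<omega> w"
proof -
  have c: "alt_form 2 (contract v S)" using alt_form_contract[of 2 S] S by simp
  have "alt_form 5 (wedge 2 3 (contract v S) T)" using alt_form_wedge[OF c T] by simp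
  then have "contract (KK S T v) (cube \<omega>) = wedge 2 3 (contract v S) T"
    using vol_nz kappa_contract[OF vol] by (auto simp: KK_def)
  then show ?thesis using wedge_cov_contract_top[OF \<phi> vol, of "KK S T v" w] by simp
qed

lemma eq_by_functionals:
  fixes x y :: V
  assumes "\<And>\<phi>. linear \<phi> \<Longrightarrow> \<phi> x = (\<phi> y :: real)"
  shows "x = y"
proof -
  have "x $ j = y $ j" for j by (rule assms) (auto simp: linear_iff)
  then show ?thesis by (simp add: vec_eq_iff)
qed

text \<open>The difference of the two five-forms is the contraction of the six-form S \<and> T with
  v, and such contractions correspond to multiples of v.\<close>

lemma KK_commute:
  assumes S: "alt_form 3 S" and T: "alt_form 3 T"
  obtains c where "\<And>v. KK S T v = KK T S v + c *\<^sub>R v"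
proof -
  obtain w where w: "cube \<omega> w \<noteq> 0" using vol_nz by blast
  define \<Theta> where "\<Theta> = wedge 3 3 S T"
  have \<Theta>: "alt_form 6 \<Theta>" using alt_form_wedge[OF S T] by (simp add: \<Theta>_def)
  have "KK S T v = KK T S v + (\<Theta> w / cube \<omega> w) *\<^sub>R v" for v
  proof (rule eq_by_functionals)
    fix \<phi> :: "V \<Rightarrow> real" assume \<phi>: "linear \<phi>"
    have c: "alt_form 2 (contract v T)" using alt_form_contract[of 2 T] T by simp
    have "contract v \<Theta> = (\<lambda>w. wedge 2 3 (contract v S) T w - wedge 2 3 (contract v T) S w)"
    proof (rule ext)
      fix w
      have a: "alt_form (Suc 2) S" "alt_form (Suc 2) T" using S T by auto
      show "contract v \<Theta> w = wedge 2 3 (contract v S) T w - wedge 2 3 (contract v T) S w"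
        using wedge_Suc_Suc[OF a, of v w] wedge_comm[OF S c, of w]
        by (simp add: \<Theta>_def)
    qed
    then have "\<phi> v * \<Theta> w = \<phi> (KK S T v) * cube \<omega> w - \<phi> (KK T S v) * cube \<omega> w"
      using wedge_cov_contract_top[OF \<phi> \<Theta>, of v w]
      unfolding wedge_diff_right KK_wedge[OF S T \<phi>] KK_wedge[OF T S \<phi>]
      by (simp only: wedge_diff_right KK_wedge[OF S T \<phi>] KK_wedge[OF T S \<phi>])
    then show "\<phi> (KK S T v) = \<phi> (KK T S v + (\<Theta> w / cube \<omega> w) *\<^sub>R v)"
      using w by (simp add: linear_add[OF \<phi>] linear_scale[OF \<phi>] field_simps)
  qed
  then show thesis by (rule that)
qed

text \<open>For \<epsilon> = -1 these are the real forms of type (3,0) + (0,3), for \<epsilon> = 1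
  their para-complex analogue: J may be moved from one slot to another.\<close>

definition J_symmetric :: "V form \<Rightarrow> bool" where
  "J_symmetric T \<longleftrightarrow> alt_form 3 T \<and> (\<forall>x y z u. T (J x ## y ## z ## u) = T (x ## J y ## z ## u))"

definition twist :: "V form \<Rightarrow> V form" where
  "twist T w = T (J (w 0) ## (\<lambda>i. w (Suc i)))"

lemma contract_twist: "contract v (twist T) = contract (J v) T"
  by (auto simp: twist_def)

lemma J_symmetric_psi: "J_symmetric \<psi>"
  unfolding J_symmetric_def using \<psi> psi_J12 by blast

lemma J_symmetric13:
  assumes "J_symmetric T"
  shows "T (x ## y ## J z ## u) = T (J x ## y ## z ## u)"
proof -
  have T: "alt_form 3 T" using assms by (simp add: J_symmetric_def)
  have s: "T (a ## b ## c ## u) = - T (a ## c ## b ## u)" for a b c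
    using alt_form_head_swap[OF alt_form_contract[of "Suc (Suc 0)" T a], of b c u] T
    by (simp add: numeral_3_eq_3)
  show ?thesis
    using s[of x y "J z"] s[of "J x" z y] assms unfolding J_symmetric_def by simp
qed

lemma deriv_form_J_symmetric:
  assumes "J_symmetric T"
  shows "deriv_form J 3 T = (\<lambda>w. 3 * twist T w)"
proof (rule ext)
  fix w :: "nat \<Rightarrow> V"
  obtain x y z u where w: "w = x ## y ## z ## u" using vcons3 by blast
  have "T (x ## J y ## z ## u) = T (J x ## y ## z ## u)" using assms by (simp add: J_symmetric_def)
  then show "deriv_form J 3 T w = 3 * twist T w"
    unfolding w deriv_form_def twist_def
    by (simp add: numeral_3_eq_3 vcons_upd_0 vcons_upd_Suc J_symmetric13[OF assms])
qed

lemma alt_form_twist: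
  assumes "J_symmetric T"
  shows "alt_form 3 (twist T)"
proof -
  have "twist T = (\<lambda>w. (1/3) * deriv_form J 3 T w)" by (auto simp: deriv_form_J_symmetric[OF assms])
  moreover have "alt_form 3 T" using assms by (simp add: J_symmetric_def)
  ultimately show ?thesis using alt_form_scale[OF alt_form_deriv_form[OF _ linear_J]] by metis
qed

lemma deriv_form_contract_J_symmetric:
  assumes "J_symmetric T"
  shows "deriv_form J 2 (contract v T) = (\<lambda>w. 2 * contract (J v) T w)"
proof (rule ext)
  fix w :: "nat \<Rightarrow> V"
  obtain x y z u where w: "w = x ## y ## z ## u" using vcons3 by blast
  have "T (v ## J x ## y ## z ## u) = T (J v ## x ## y ## z ## u)" using assms by (simp add: J_symmetric_def)
  then show "deriv_form J 2 (contract v T) w = 2 * contract (J v) T w"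
    unfolding w deriv_form_def
    by (simp add: numeral_2_eq_2 vcons_upd_0 vcons_upd_Suc J_symmetric13[OF assms])
qed

lemma deriv_J_top:
  assumes "alt_form 6 \<theta>"
  shows "deriv_form J 6 \<theta> w = 0"
proof (rule deriv_form_top[OF _ assms])
  fix w
  have "deriv_form K 6 (cube \<omega>) w = phi * deriv_form J 6 (cube \<omega>) w"
    using linear_scale[OF alt_form_linear[OF vol]] by (simp add: deriv_form_def K_eq_J sum_distrib_left)
  then show "deriv_form J 6 (cube \<omega>) w = 0" using deriv_K_cube[of w] phi_pos by simp
qed

text \<open>J is trace-free, so as a derivation it kills the six-form \<phi> \<and> S_v \<and> T.
  The coefficients 2 and 3 count the slots of S_v and of T.\<close>

lemma KK_derivation:
  assumes S: "J_symmetric S" and T: "J_symmetric T"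
  shows "J (KK S T v) + 2 *\<^sub>R KK S T (J v) + 3 *\<^sub>R KK S (twist T) v = 0"
proof (rule eq_by_functionals)
  fix \<phi> :: "V \<Rightarrow> real" assume \<phi>: "linear \<phi>"
  obtain w where w: "cube \<omega> w \<noteq> 0" using vol_nz by blast
  have aS: "alt_form 3 S" and aT: "alt_form 3 T" using S T by (auto simp: J_symmetric_def)
  have c: "alt_form 2 (contract v S)" using alt_form_contract[of 2 S] aS by simp
  have a5: "alt_form 5 (wedge 2 3 (contract v S) T)" using alt_form_wedge[OF c aT] by simp
  have \<phi>J: "linear (\<lambda>x. \<phi> (J x))" using linear_compose[OF linear_J \<phi>] by (simp add: o_def)
  have "deriv_form J 6 (wedge 1 5 (cov \<phi>) (wedge 2 3 (contract v S) T)) w = 0"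
    by (rule deriv_J_top) (use alt_form_wedge[OF alt_form_cov[OF \<phi>] a5] in simp)
  moreover have "deriv_form J 5 (wedge 2 3 (contract v S) T)
      = (\<lambda>w. 2 * wedge 2 3 (contract (J v) S) T w + 3 * wedge 2 3 (contract v S) (twist T) w)"
    using deriv_form_wedge[OF c aT, of J]
    by (simp add: deriv_form_contract_J_symmetric[OF S] deriv_form_J_symmetric[OF T]
        wedge_scale_left wedge_scale_right fun_eq_iff del: contract_apply)
  moreover have "deriv_form J 1 (cov \<phi>) = cov (\<lambda>x. \<phi> (J x))"
    by (auto simp: deriv_form_def cov_def)
  ultimately have "wedge 1 5 (cov (\<lambda>x. \<phi> (J x))) (wedge 2 3 (contract v S) T) w
     + 2 * wedge 1 5 (cov \<phi>) (wedge 2 3 (contract (J v) S) T) w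
     + 3 * wedge 1 5 (cov \<phi>) (wedge 2 3 (contract v S) (twist T)) w = 0"
    using deriv_form_wedge[OF alt_form_cov[OF \<phi>] a5, of J w]
    by (simp add: wedge_add_right wedge_scale_right)
  then have "(\<phi> (J (KK S T v)) + 2 * \<phi> (KK S T (J v)) + 3 * \<phi> (KK S (twist T) v)) * cube \<omega> w = 0"
    using KK_wedge[OF aS aT \<phi>J, of v w] KK_wedge[OF aS aT \<phi>, of "J v" w]
      KK_wedge[OF aS alt_form_twist[OF T] \<phi>, of v w] by (simp add: algebra_simps)
  then show "\<phi> (J (KK S T v) + 2 *\<^sub>R KK S T (J v) + 3 *\<^sub>R KK S (twist T) v) = \<phi> 0"
    using w by (simp add: linear_add[OF \<phi>] linear_scale[OF \<phi>] linear_0[OF \<phi>])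
qed

lemma alt_form_contract_3: "alt_form 3 S \<Longrightarrow> alt_form 2 (contract v S)"
  using alt_form_contract[of 2 S] by simp

lemma alt_form_contract_2: "alt_form 2 S \<Longrightarrow> alt_form 1 (contract v S)"
  using alt_form_contract[of 1 S] by (simp add: numeral_2_eq_2)

lemma KK_psi_psi: "KK \<psi> \<psi> v = K v"
  by (simp add: KK_def Kmap_def)

text \<open>The forms of type \<open>(3,0)\<close> are a line over the (para-)complex numbers.  The proof avoids bases:
  letting \<open>J\<close> act as a derivation on \<open>\<alpha> \<and> T\<^sub>v \<and> \<psi>\<close> shows that the endomorphism \<open>L\<close> defined by this
  six-form satisfies \<open>J L + 5 L J = 3 c\<^sub>0 J - 3 c\<^sub>1\<close>, so \<open>L\<close> is a combination of \<open>id\<close> and \<open>J\<close>.\<close>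

lemma J_symmetric_form_span:
  assumes T: "J_symmetric T"
  obtains a b where "\<And>v. T v = a * \<psi> v + b * twist \<psi> v"
proof -
  have aT: "alt_form 3 T" using T by (simp add: J_symmetric_def)
  obtain w where w: "cube \<omega> w \<noteq> 0" using vol_nz by blast
  define L where "L = KK T \<psi>"
  obtain c0 where c0: "\<And>v. KK T \<psi> v = KK \<psi> T v + c0 *\<^sub>R v"
    using KK_commute[OF aT \<psi>] by metis
  obtain c1 where c1: "\<And>v. KK T (twist \<psi>) v = KK (twist \<psi>) T v + c1 *\<^sub>R v"
    using KK_commute[OF aT alt_form_twist[OF J_symmetric_psi]] by metis
  \<comment> \<open>Contracting a twist with v is contracting the form itself with J v. Hence both
    commutation relations concern L, and \<open>KK_derivation\<close> closes up to an equation for L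
    alone.\<close>
  have tw: "KK (twist \<psi>) T v = KK \<psi> T (J v)" for v
    by (simp add: KK_def contract_twist)
  have JL: "J (L v) + 5 *\<^sub>R L (J v) = (3 * c0) *\<^sub>R J v - (3 * c1) *\<^sub>R v" for v
  proof -
    have "KK T (twist \<psi>) v = L (J v) - c0 *\<^sub>R J v + c1 *\<^sub>R v"
      using c1[of v] tw[of v] c0[of "J v"] by (simp add: L_def)
    then have "J (L v) + 2 *\<^sub>R L (J v) + 3 *\<^sub>R (L (J v) - c0 *\<^sub>R J v + c1 *\<^sub>R v) = 0"
      using KK_derivation[OF T J_symmetric_psi, of v] by (simp add: L_def)
    moreover have "5 *\<^sub>R L (J v) = 2 *\<^sub>R L (J v) + 3 *\<^sub>R L (J v)"
      by (simp add: scaleR_add_left[symmetric])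
    ultimately show ?thesis
      by (simp add: algebra_simps eq_neg_iff_add_eq_0 add_eq_0_iff2 minus_equation_iff)
  qed
  have lL: "L (c *\<^sub>R v) = c *\<^sub>R L v" for c v
  proof (rule eq_by_functionals)
    fix \<phi> :: "V \<Rightarrow> real" assume \<phi>: "linear \<phi>"
    have "contract (c *\<^sub>R v) T = (\<lambda>u. c * contract v T u)"
      using linear_scale[OF alt_form_linear_head[of 2 T]] aT by auto
    then have "\<phi> (L (c *\<^sub>R v)) * cube \<omega> w = c * \<phi> (L v) * cube \<omega> w"
      unfolding L_def KK_wedge[OF aT \<psi> \<phi>, symmetric]
      by (simp add: KK_wedge[OF aT \<psi> \<phi>, symmetric] wedge_scale_right wedge_scale_left[abs_def] del: contract_apply)
    then show "\<phi> (L (c *\<^sub>R v)) = \<phi> (c *\<^sub>R L v)" using w by (simp add: linear_scale[OF \<phi>])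
  qed
  have L: "L v = (c0 / 2) *\<^sub>R v - (\<epsilon> * c1 / 2) *\<^sub>R J v" for v
  proof -
    note Js = linear_add[OF linear_J] linear_diff[OF linear_J] linear_scale[OF linear_J]
    \<comment> \<open>Applying J to \<open>JL\<close>, and evaluating \<open>JL\<close> at J v,
      gives two equations for L v and J(L(J v)) with the same right-hand side. Eliminating the
      latter shows that this side equals 6 \<epsilon> L v.\<close>
    have "J (J (L v) + 5 *\<^sub>R L (J v)) = J ((3 * c0) *\<^sub>R J v - (3 * c1) *\<^sub>R v)" by (simp only: JL)
    then have 1: "\<epsilon> *\<^sub>R L v + 5 *\<^sub>R J (L (J v)) = (3 * c0 * \<epsilon>) *\<^sub>R v - (3 * c1) *\<^sub>R J v"
      by (simp add: Js J_J)
    have 2: "J (L (J v)) + (5 * \<epsilon>) *\<^sub>R L v = (3 * c0 * \<epsilon>) *\<^sub>R v - (3 * c1) *\<^sub>R J v"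
      using JL[of "J v"] by (simp add: J_J lL)
    show ?thesis
    proof (rule eq_by_functionals)
      fix \<phi> :: "V \<Rightarrow> real" assume \<phi>: "linear \<phi>"
      note ps = linear_add[OF \<phi>] linear_diff[OF \<phi>] linear_scale[OF \<phi>]
      have "\<epsilon> * \<phi> (L v) + 5 * \<phi> (J (L (J v))) = 3 * c0 * \<epsilon> * \<phi> v - 3 * c1 * \<phi> (J v)"
        using arg_cong[OF 1, of \<phi>] by (simp add: ps)
      moreover have "\<phi> (J (L (J v))) + 5 * \<epsilon> * \<phi> (L v) = 3 * c0 * \<epsilon> * \<phi> v - 3 * c1 * \<phi> (J v)"
        using arg_cong[OF 2, of \<phi>] by (simp add: ps)
      ultimately have "\<phi> (L v) = c0 / 2 * \<phi> v - \<epsilon> * c1 / 2 * \<phi> (J v)"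
        using \<epsilon> by auto
      then show "\<phi> (L v) = \<phi> ((c0 / 2) *\<^sub>R v - (\<epsilon> * c1 / 2) *\<^sub>R J v)" by (simp add: ps)
    qed
  qed
  have T_cov: "cov (\<lambda>x. T (x ## y ## z ## (\<lambda>_. 0))) = contract z (contract y T)"
    and T_lin: "linear (\<lambda>x. T (x ## y ## z ## (\<lambda>_. 0)))" for y z
  proof -
    interpret T: volume_and_three_form "cube \<omega>" T by unfold_locales (use vol vol_nz aT in auto)
    show "cov (\<lambda>x. T (x ## y ## z ## (\<lambda>_. 0))) = contract z (contract y T)" by (rule T.rho_cov)
    show "linear (\<lambda>x. T (x ## y ## z ## (\<lambda>_. 0)))" using alt_form_linear_head[of 2 T] aT by simp
  qed
  \<comment> \<open>Contract the vanishing seven-form \<psi>_v \<and> T_y \<and> \<psi> with z. Two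
    of the three terms evaluate to values of \<psi> and T; the third, \<open>G\<close>, is trilinear
    and killed by J as a derivation, hence zero.\<close>
  have key: "T (K v ## y ## z ## (\<lambda>_. 0)) = ps v (L y) z" for v y z
  proof -
    note c2 = alt_form_contract_3 note c1 = alt_form_contract_2
    define G where "G v y z = wedge 2 4 (contract v \<psi>) (wedge 2 2 (contract y T) (contract z \<psi>)) w" for v y z
    have G0: "G v y z = 0" for v y z
    proof (rule trilinear_J_derivation_zero[where J = J and \<epsilon> = \<epsilon>, OF J_J eps_square])
      fix c x y z
      have s: "contract (c *\<^sub>R x) \<psi> = (\<lambda>u. c * contract x \<psi> u)" for x
        using linear_scale[OF psi_linear1] by auto
      have sT: "contract (c *\<^sub>R x) T = (\<lambda>u. c * contract x T u)" for x
        using linear_scale[OF alt_form_linear_head[of 2 T]] aT by auto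
      show "G (c *\<^sub>R x) y z = c * G x y z" unfolding G_def s wedge_scale_left by (simp del: contract_apply)
      show "G x (c *\<^sub>R y) z = c * G x y z" unfolding G_def sT
        using ext[of "wedge 2 2 (\<lambda>u. c * contract y T u) (contract z \<psi>)", OF wedge_scale_left]
        by (simp add: wedge_scale_right del: contract_apply)
      show "G x y (c *\<^sub>R z) = c * G x y z" unfolding G_def s
        by (simp only: wedge_scale_right[of 2 2, abs_def] wedge_scale_right)
    next
      fix x y z
      have a4: "alt_form 4 (wedge 2 2 (contract y T) (contract z \<psi>))"
        using alt_form_wedge[OF c2[OF aT, of y] c2[OF \<psi>, of z]] by simp
      have "deriv_form J 4 (wedge 2 2 (contract y T) (contract z \<psi>))
        = (\<lambda>w. 2 * wedge 2 2 (contract (J y) T) (contract z \<psi>) w + 2 * wedge 2 2 (contract y T) (contract (J z) \<psi>) w)"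
        using deriv_form_wedge[OF c2[OF aT, of y] c2[OF \<psi>, of z], of J]
        by (simp add: deriv_form_contract_J_symmetric[OF T] deriv_form_contract_J_symmetric[OF J_symmetric_psi]
          wedge_scale_left wedge_scale_right fun_eq_iff del: contract_apply)
      moreover have "deriv_form J 6 (wedge 2 4 (contract x \<psi>) (wedge 2 2 (contract y T) (contract z \<psi>))) w = 0"
        by (rule deriv_J_top) (use alt_form_wedge[OF c2[OF \<psi>, of x] a4] in simp)
      ultimately have "2 * G (J x) y z + (2 * G x (J y) z + 2 * G x y (J z)) = 0"
        using deriv_form_wedge[OF c2[OF \<psi>, of x] a4, of J w]
        by (simp add: deriv_form_contract_J_symmetric[OF J_symmetric_psi] G_def
          wedge_scale_left wedge_scale_right wedge_add_right del: contract_apply)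
      then show "G (J x) y z + G x (J y) z + G x y (J z) = 0" by simp
    qed
    have a5: "alt_form 5 (wedge 2 3 (contract y T) \<psi>)" using alt_form_wedge[OF c2[OF aT] \<psi>] by simp
    have "alt_form 7 (wedge 2 5 (contract v \<psi>) (wedge 2 3 (contract y T) \<psi>))"
      using alt_form_wedge[OF c2[OF \<psi>] a5] by simp
    then have "wedge 2 5 (contract v \<psi>) (wedge 2 3 (contract y T) \<psi>) (z ## w) = 0"
      by (rule alt_form_7_zero)
    moreover have "wedge 2 4 (contract v \<psi>) (wedge 1 3 (contract z (contract y T)) \<psi>) w
       = wedge 1 5 (contract z (contract y T)) (wedge 2 3 (contract v \<psi>) \<psi>) w"
      using wedge_left_commute[OF c2[OF \<psi>, of v] c1[OF c2[OF aT, of y], of z] \<psi>, of w]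
      by simp
    ultimately have "wedge 1 5 (contract z (contract v \<psi>)) (wedge 2 3 (contract y T) \<psi>) w
       + wedge 1 5 (contract z (contract y T)) (wedge 2 3 (contract v \<psi>) \<psi>) w = 0"
      using wedge_wedge_vcons0[OF c2[OF \<psi>, of v] c2[OF aT, of y] \<psi>, of z w] G0[of v y z]
      by (simp add: contract0_def G_def)
    then have "ps (L y) v z * cube \<omega> w + T (K v ## y ## z ## (\<lambda>_. 0)) * cube \<omega> w = 0"
      using KK_wedge[OF \<psi> \<psi> T_lin, of y z v w] KK_wedge[OF aT \<psi> psi_linear1, of "v ## z ## (\<lambda>_. 0)" y w]
      unfolding T_cov rho_cov KK_psi_psi L_def ps_def by linarith
    then have "ps (L y) v z + T (K v ## y ## z ## (\<lambda>_. 0)) = 0"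
      using w by (metis distrib_right mult_eq_0_iff)
    then show ?thesis using ps_swap12[of "L y" v z] by simp
  qed
  \<comment> \<open>The coefficients come from \<open>key\<close> at v = J x: its left side is phi
    \<epsilon> T(x,y,z), while on the right the identity part of L gives the twist and the J part
    gives \<psi>. Division by phi \<epsilon> uses \<epsilon>^2 = 1.\<close>
  define a where "a = - \<epsilon> * c1 / (2 * phi)"
  define b where "b = \<epsilon> * c0 / (2 * phi)"
  have "T v = a * \<psi> v + b * twist \<psi> v" for v
  proof -
    obtain x y z u where v: "v = x ## y ## z ## u" using vcons3 by blast
    have lin: "linear (\<lambda>x. T (x ## y ## z ## (\<lambda>_. 0)))" by (rule T_lin)
    have Tu: "T (x ## y ## z ## u) = T (x ## y ## z ## (\<lambda>_. 0))"
      by (rule alt_form_cong[OF aT]) (auto split: nat.split simp: less_Suc_eq numeral_3_eq_3)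
    have "T (K (J x) ## y ## z ## (\<lambda>_. 0)) = phi * \<epsilon> * T (x ## y ## z ## (\<lambda>_. 0))"
      by (simp add: K_eq_J J_J linear_scale[OF lin])
    moreover have "ps (J x) (L y) z = c0 / 2 * ps (J x) y z - \<epsilon> * c1 / 2 * (\<epsilon> * ps x y z)"
      unfolding L by (simp add: linear_diff[OF ps_linear2] linear_scale[OF ps_linear2]
          linear_scale[OF ps_linear1] ps_J12[symmetric] J_J)
    ultimately have "phi * \<epsilon> * T (x ## y ## z ## u) = c0 / 2 * ps (J x) y z - c1 / 2 * ps x y z * (\<epsilon> * \<epsilon>)"
      using key[of "J x" y z] Tu by (simp add: algebra_simps)
    then show ?thesis
      unfolding v twist_def a_def b_def using phi_pos \<epsilon>
      by (auto simp: ps_eq field_simps)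
  qed
  then show thesis by (rule that)
qed

lemma omega_wedge_psi_contract:
  "wedge 2 2 \<omega> (contract u \<psi>) v = - wedge 1 3 (contract u \<omega>) \<psi> v"
proof -
  have "wedge 2 3 \<omega> \<psi> (u ## v) = wedge 1 3 (contract u \<omega>) \<psi> v + wedge 2 2 \<omega> (contract u \<psi>) v"
    using wedge_vcons[OF \<omega> \<psi>, of u v] by simp
  then show ?thesis using compat[of "u ## v"] by simp
qed

text \<open>With x' for \<omega>(x, .), this is (Jz)' \<and> t' - (Jt)' \<and> z'. Both sides of the
  correspondence pass through it: it describes \<psi>_{zt} \<and> \<psi> as well as the insertion of
  J into \<omega>^2.\<close>

definition beta :: "V \<Rightarrow> V \<Rightarrow> V form" where
  "beta z t = (\<lambda>v. wedge 1 1 (contract (J z) \<omega>) (contract t \<omega>) v - wedge 1 1 (contract (J t) \<omega>) (contract z \<omega>) v)"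

lemma alt_form_wedge_11: "alt_form 2 (wedge 1 1 (contract x \<omega>) (contract t \<omega>))"
  using alt_form_wedge[OF alt_form_contract_2[OF \<omega>, of x] alt_form_contract_2[OF \<omega>, of t]]
  by (simp add: numeral_eq_Suc)

lemma alt_form_beta: "alt_form 2 (beta z t)"
  unfolding beta_def by (intro alt_form_diff alt_form_wedge_11)

lemma beta_eq: "beta z t (x ## y ## u)
    = om (J z) x * om t y - om (J z) y * om t x - om (J t) x * om z y + om (J t) y * om z x"
proof -
  have "wedge 1 1 (contract a \<omega>) (contract b \<omega>) (x ## y ## u) = om a x * om b y - om a y * om b x" for a b
    using wedge_cov_expand[OF om_linear2 alt_form_contract_2[OF \<omega>, of b], of a "x ## y ## u"]
    by (simp add: om_cov[symmetric] om_eq del_0 del_Suc)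
  then show ?thesis by (simp add: beta_def)
qed

lemma cube_contract_contract:
  "cube \<omega> (x ## t ## v) = 3 * om x t * wedge 2 2 \<omega> \<omega> v - 6 * wedge 2 2 \<omega> (wedge 1 1 (contract x \<omega>) (contract t \<omega>)) v"
proof -
  note c1 = alt_form_contract_2[OF \<omega>]
  have a4: "alt_form (Suc 3) (wedge 2 2 \<omega> \<omega>)" using alt_form_square[OF \<omega>] by simp
  have "cube \<omega> (x ## t ## v) = 3 * wedge 1 4 (cov (om x)) (wedge 2 2 \<omega> \<omega>) (t ## v)"
    using cube_contract[OF \<omega>, of x "t ## v"] by (simp add: om_cov)
  also have "wedge 1 4 (cov (om x)) (wedge 2 2 \<omega> \<omega>) (t ## v)
      = om x t * wedge 2 2 \<omega> \<omega> v - wedge 1 3 (contract x \<omega>) (contract t (wedge 2 2 \<omega> \<omega>)) v"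
    using wedge_cov_Suc[OF om_linear2 a4, of x t v] by (simp add: om_cov)
  also have "wedge 1 3 (contract x \<omega>) (contract t (wedge 2 2 \<omega> \<omega>)) v
      = 2 * wedge 1 3 (contract x \<omega>) (wedge 1 2 (contract t \<omega>) \<omega>) v"
    unfolding square_contract[OF \<omega>] by (rule wedge_scale_right)
  also have "wedge 1 2 (contract t \<omega>) \<omega> = wedge 2 1 \<omega> (contract t \<omega>)"
    using wedge_comm[OF c1[of t] \<omega>] by (auto simp: fun_eq_iff)
  also have "wedge 1 3 (contract x \<omega>) (wedge 2 1 \<omega> (contract t \<omega>)) v
      = wedge 2 2 \<omega> (wedge 1 1 (contract x \<omega>) (contract t \<omega>)) v"
    using wedge_left_commute[OF c1[of x] \<omega> c1[of t], of v] by (simp add: numeral_eq_Suc)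
  finally show ?thesis by simp
qed

text \<open>Contract the defining relation of K once more, with t, and antisymmetrise in z and t.
  The symmetric product \<psi>_z \<and> \<psi>_t drops out, and so does the multiple of \<omega>^2,
  because \<omega>(Jz,t) is symmetric. The factor -3 is half of the -6 in
  \<open>cube_contract_contract\<close>.\<close>

lemma psi_contract_wedge_psi:
  "wedge 1 3 (contract t (contract z \<psi>)) \<psi> v = - 3 * phi * wedge 2 2 \<omega> (beta z t) v"
proof -
  note c2 = alt_form_contract_3[OF \<psi>]
  have D: "wedge 1 3 (contract t (contract z \<psi>)) \<psi> v + wedge 2 2 (contract z \<psi>) (contract t \<psi>) v
      = cube \<omega> (K z ## t ## v)" for z t
    using wedge_vcons[OF c2[of z] \<psi>, of t v] fun_cong[OF contract_K[of z], of "t ## v"] by simp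
  have "contract z (contract t \<psi>) = (\<lambda>v. - 1 * contract t (contract z \<psi>) v)"
    using alt_form_head_swap[OF \<psi>[unfolded numeral_3_eq_3], of t z] by (intro ext) simp
  then have "wedge 1 3 (contract z (contract t \<psi>)) \<psi> v = - wedge 1 3 (contract t (contract z \<psi>)) \<psi> v"
    using wedge_scale_left[of 1 3 "- 1" "contract t (contract z \<psi>)" \<psi> v] by simp
  moreover have "wedge 2 2 (contract z \<psi>) (contract t \<psi>) v = wedge 2 2 (contract t \<psi>) (contract z \<psi>) v"
    using wedge_comm[OF c2 c2, of z t v] by simp
  ultimately have "2 * wedge 1 3 (contract t (contract z \<psi>)) \<psi> v = cube \<omega> (K z ## t ## v) - cube \<omega> (K t ## z ## v)"
    using D[of t z] D[of z t] by simp
  also have "\<dots> = phi * (cube \<omega> (J z ## t ## v) - cube \<omega> (J t ## z ## v))"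
    using linear_scale[OF alt_form_linear_head[of 5 "cube \<omega>"]] vol by (simp add: K_eq_J algebra_simps)
  also have "\<dots> = phi * (- 6 * wedge 2 2 \<omega> (beta z t) v)"
  proof -
    have "wedge 2 2 \<omega> (beta z t) v = wedge 2 2 \<omega> (wedge 1 1 (contract (J z) \<omega>) (contract t \<omega>)) v
        - wedge 2 2 \<omega> (wedge 1 1 (contract (J t) \<omega>) (contract z \<omega>)) v"
      unfolding beta_def by (rule wedge_diff_right)
    moreover have "om (J z) t = om (J t) z" using om_J[of z t] om_anti[of z "J t"] by linarith
    moreover have "phi * (3 * c * W - 6 * A - (3 * c * W - 6 * B)) = phi * (- 6 * (A - B))" for c W A B
      by simp
    ultimately show ?thesis unfolding cube_contract_contract by metis
  qed
  finally have "2 * wedge 1 3 (contract t (contract z \<psi>)) \<psi> v = phi * (- 6 * wedge 2 2 \<omega> (beta z t) v)" .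
  moreover have "x = - 3 * p * y" if "2 * x = p * (- 6 * y)" for x p y :: real using that by linarith
  ultimately show ?thesis by blast
qed

lemma beta_pair_antisym: "beta z t (x ## y ## u) = - beta x y (z ## t ## u)"
  using om_J[of z x] om_J[of z y] om_J[of t x] om_J[of t y]
    om_anti[of z x] om_anti[of z y] om_anti[of t x] om_anti[of t y]
    om_anti[of z "J x"] om_anti[of z "J y"] om_anti[of t "J x"] om_anti[of t "J y"]
  by (simp add: beta_eq)

text \<open>The sign is opposite to that of \<open>beta_pair_antisym\<close>; this difference is
  what separates the multiples of \<psi> from those of its twist.\<close>

lemma beta_J_pair_sym: "beta (J z) t (x ## y ## u) = beta (J x) y (z ## t ## u)"
  using om_J[of z x] om_J[of z y] om_J[of t x] om_J[of t y]
    om_anti[of z x] om_anti[of z y] om_anti[of t x] om_anti[of t y]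
    om_anti[of z "J x"] om_anti[of z "J y"] om_anti[of t "J x"] om_anti[of t "J y"]
  by (simp add: beta_eq J_J om_lin)

text \<open>Hence a four-form \<nu> \<omega>^2 corresponds to a tensor N with \<psi>(N(x,y), ., .) =
  2 \<nu> \<beta>(x,y).\<close>

lemma square_J: "wedge 2 2 \<omega> \<omega> (J x ## y ## z ## t ## u) + wedge 2 2 \<omega> \<omega> (x ## J y ## z ## t ## u)
    = - 2 * beta x y (z ## t ## u)"
  using om_J[of x y] by (simp add: square_eq[OF \<omega>] beta_eq om_eq algebra_simps)

lemma four_form_swaps:
  assumes \<sigma>: "alt_form 4 \<sigma>"
  shows "\<sigma> (x ## y ## z ## t ## u) = - \<sigma> (y ## x ## z ## t ## u)"
    "\<sigma> (x ## y ## z ## t ## u) = - \<sigma> (x ## z ## y ## t ## u)"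
    "\<sigma> (x ## y ## z ## t ## u) = - \<sigma> (x ## y ## t ## z ## u)"
proof -
  have a: "alt_form (Suc (Suc 2)) \<sigma>" using \<sigma> by (simp add: numeral_eq_Suc)
  show "\<sigma> (x ## y ## z ## t ## u) = - \<sigma> (y ## x ## z ## t ## u)" by (rule alt_form_head_swap[OF a])
  have b: "alt_form (Suc (Suc 1)) (contract x \<sigma>)" using alt_form_contract[OF a] by (simp add: numeral_eq_Suc)
  show "\<sigma> (x ## y ## z ## t ## u) = - \<sigma> (x ## z ## y ## t ## u)"
    using alt_form_head_swap[OF b, of y z "t ## u"] by simp
  have c: "alt_form (Suc (Suc 0)) (contract y (contract x \<sigma>))" using alt_form_contract[OF b] by simp
  show "\<sigma> (x ## y ## z ## t ## u) = - \<sigma> (x ## y ## t ## z ## u)"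
    using alt_form_head_swap[OF c, of z t u] by simp
qed

text \<open>The sum of the insertions of J into the first two slots determines a four-form. This is
  the direction from N back to d psi^-.\<close>

lemma four_form_eqI:
  assumes \<sigma>: "alt_form 4 \<sigma>" and \<tau>: "alt_form 4 \<tau>"
    and B: "\<And>x y z t u. \<sigma> (J x ## y ## z ## t ## u) + \<sigma> (x ## J y ## z ## t ## u)
      = \<tau> (J x ## y ## z ## t ## u) + \<tau> (x ## J y ## z ## t ## u)"
  shows "\<sigma> v = \<tau> v"
proof -
  define \<delta> where "\<delta> v = \<sigma> v - \<tau> v" for v
  have \<delta>: "alt_form 4 \<delta>" unfolding \<delta>_def by (rule alt_form_diff[OF \<sigma> \<tau>])
  obtain x y z t u where v: "v = x ## y ## z ## t ## u" by (metis vcons_head_tail)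
  have "\<delta> (x ## y ## z ## t ## u) = 0"
  proof (rule four_form_zero_if_J_pair_zero[where J = J and \<epsilon> = \<epsilon> and \<sigma> = "\<lambda>x y z t. \<delta> (x ## y ## z ## t ## u)", OF J_J eps_square])
    show "\<delta> (c *\<^sub>R x ## y ## z ## t ## u) = c * \<delta> (x ## y ## z ## t ## u)" for c x y z t
      using linear_scale[OF alt_form_linear_head[of 3 \<delta>]] \<delta> by simp
    show "\<delta> (J x ## y ## z ## t ## u) + \<delta> (x ## J y ## z ## t ## u) = 0" for x y z t
      using B[of x y z t u] by (simp add: \<delta>_def)
  qed (rule four_form_swaps[OF \<delta>])+
  then show ?thesis by (simp add: \<delta>_def v)
qed

section \<open>Pointwise equivalence: skew N against multiples of the square of omega\<close>

context
  fixes \<sigma> :: "V form" and N :: "V \<Rightarrow> V \<Rightarrow> V"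
  assumes \<sigma>: "alt_form 4 \<sigma>"
    and N_linear: "\<And>x. linear (N x)" and N_anti: "\<And>x y. N x y = - N y x"
    and N_J: "\<And>x y. N (J x) y = - J (N x y)"
    and \<sigma>_N: "\<And>x y z t u. \<sigma> (J x ## y ## z ## t ## u) + \<sigma> (x ## J y ## z ## t ## u) = - \<psi> (N x y ## z ## t ## u)"
begin

lemma N_J2: "N x (J y) = - J (N x y)"
  using N_anti[of x "J y"] N_J[of y x] N_anti[of y x] by (simp add: linear_neg[OF linear_J])

lemma N_self [simp]: "N x x = 0"
proof -
  have "N x x = - N x x" by (rule N_anti)
  then have "2 *\<^sub>R N x x = 0" by (simp add: scaleR_2 eq_neg_iff_add_eq_0)
  then show ?thesis by simp
qed

text \<open>Inserting \<open>u = N X Y\<close> into its own contraction with \<open>\<psi>\<close> gives a linear relation between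
  \<open>X\<close>, \<open>JX\<close>, \<open>Y\<close> and \<open>JY\<close>; applying \<open>N X\<close> to it makes all relevant coefficients vanish, even if
  the four vectors are dependent.\<close>

lemma N_skew_if_square:
  assumes s: "\<And>v. \<sigma> v = \<nu> * wedge 2 2 \<omega> \<omega> v"
  shows "om X (N X Y) = 0"
proof -
  define u where "u = N X Y"
  have psN: "ps (N x y) z t = 2 * \<nu> * beta x y (z ## t ## (\<lambda>_. 0))" for x y z t
    using \<sigma>_N[of x y z t "\<lambda>_. 0"] square_J[of x y z t "\<lambda>_. 0"] unfolding s ps_def
    by (metis (no_types) distrib_left minus_mult_minus mult.assoc mult.commute minus_minus mult_minus_left)
  show ?thesis
  proof (cases "\<nu> = 0")
    case True
    then have "N X Y = 0" by (intro ps_nondeg) (simp add: psN)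
    then show ?thesis by (simp add: om_lin)
  next
    case False
    \<comment> \<open>These are the coefficients, with sign reversed, of the covectors of X, JX, Y
      and JY in the contraction of \<beta>(X,Y) with u.\<close>
    define a b c d where "a = om (J Y) u" and "b = om Y u" and "c = - om (J X) u" and "d = - om X u"
    have "ps u u t = 0" for t by simp
    then have bz: "beta X Y (u ## t ## (\<lambda>_. 0)) = 0" for t
      using psN[of X Y u t] False by (simp add: u_def)
    have "om (a *\<^sub>R X + b *\<^sub>R J X + c *\<^sub>R Y + d *\<^sub>R J Y) t = 0" for t
      using bz[of t] unfolding beta_eq
      by (simp add: om_lin a_def b_def c_def d_def algebra_simps)
    then have "a *\<^sub>R X + b *\<^sub>R J X + c *\<^sub>R Y + d *\<^sub>R J Y = 0" by (rule om_nondeg)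
    then have "N X (a *\<^sub>R X + b *\<^sub>R J X + c *\<^sub>R Y + d *\<^sub>R J Y) = 0"
      by (simp add: linear_0[OF N_linear])
    \<comment> \<open>N X kills X and JX and maps Y and JY to u and -Ju.\<close>
    then have cu: "c *\<^sub>R u = d *\<^sub>R J u"
      by (simp add: linear_add[OF N_linear] linear_scale[OF N_linear] N_J2 linear_0[OF linear_J] u_def)
    have "c * om X u = d * om X (J u)"
      using arg_cong[OF cu, of "om X"] by (simp add: om_lin)
    moreover have "c * om (J X) u = d * om (J X) (J u)"
      using arg_cong[OF cu, of "om (J X)"] by (simp add: om_lin)
    moreover have "om X (J u) = c" using om_J[of X u] by (simp add: c_def)
    moreover have "om (J X) (J u) = \<epsilon> * d" using om_J[of X "J u"] by (simp add: J_J om_lin d_def)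
    \<comment> \<open>Pairing with X gives c d = 0 and pairing with JX gives c^2 = -\<epsilon> d^2.
      For either sign of \<epsilon> this leaves d = 0, and d is -\<omega>(X,u).\<close>
    ultimately have "c * d = - c * d" "c * c = - (\<epsilon> * (d * d))"
      unfolding c_def d_def by (auto simp: algebra_simps)
    then have "c * d = 0" "c * c = - (\<epsilon> * (d * d))" by auto
    then have "d = 0" using \<epsilon> by auto
    then show ?thesis by (simp add: d_def u_def)
  qed
qed

text \<open>Skewness makes \<open>\<omega>(N X Y, Z)\<close> a combination of \<open>\<psi>\<close> and its twist.  Contracting \<open>\<omega> \<and> \<psi> = 0\<close> and
  cancelling \<open>\<omega>\<close> then computes \<open>\<psi>(N X Y, \<cdot>, \<cdot>)\<close> from \<open>\<omega>\<close>; the antisymmetry under exchange of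
  the two pairs kills the twisted part.\<close>

lemma square_if_N_skew:
  assumes skew: "\<And>X Y. om X (N X Y) = 0"
  shows "\<exists>\<nu>. \<forall>v. \<sigma> v = \<nu> * wedge 2 2 \<omega> \<omega> v"
proof -
  have skew2: "om Y (N X Y) = 0" for X Y using skew[of Y X] N_anti[of X Y] by (simp add: om_lin)
  have N_add1: "N (x + x') y = N x y + N x' y" for x x' y
    using N_anti[of "x + x'" y] N_anti[of x y] N_anti[of x' y] by (simp add: linear_add[OF N_linear])
  define T where "T v = om (N (v 0) (v 1)) (v 2)" for v :: "nat \<Rightarrow> V"
  have T3: "T (x ## y ## z ## u) = om (N x y) z" for x y z u
    by (simp add: T_def numeral_2_eq_2 One_nat_def)
  have aT: "alt_form 3 T"
    unfolding alt_form_def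
  proof (intro conjI allI impI)
    fix v w :: "nat \<Rightarrow> V" assume "\<forall>i<3. v i = w i"
    then show "T v = T w" by (simp add: T_def)
  next
    fix v :: "nat \<Rightarrow> V" and i :: nat assume "i < 3"
    then consider "i = 0" | "i = 1" | "i = 2" by linarith
    then show "linear (\<lambda>x. T (v(i := x)))"
    proof cases
      case 1
      have "N (c *\<^sub>R x) y = c *\<^sub>R N x y" for c x y
        using N_anti[of "c *\<^sub>R x" y] N_anti[of x y] by (simp add: linear_scale[OF N_linear])
      then show ?thesis using 1 by (auto simp: T_def linear_iff N_add1 om_lin)
    next
      case 2
      then show ?thesis
        by (auto simp: T_def linear_iff linear_add[OF N_linear] linear_scale[OF N_linear] om_lin)
    next
      case 3
      then show ?thesis by (auto simp: T_def linear_iff om_lin)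
    qed
  next
    fix v :: "nat \<Rightarrow> V" and i j :: nat assume "i < 3" "j < 3" "i \<noteq> j \<and> v i = v j"
    then have "v 0 = v 1 \<or> v 0 = v 2 \<or> v 1 = v 2" by (auto simp: less_Suc_eq numeral_eq_Suc One_nat_def)
    then show "T v = 0"
      using skew[of "v 0" "v 1"] skew2[of "v 1" "v 0"] om_anti[of "N (v 0) (v 1)"]
      by (auto simp: T_def om_lin)
  qed
  have "T (J x ## y ## z ## u) = T (x ## J y ## z ## u)" for x y z u
    by (simp add: T3 N_J N_J2)
  then have "J_symmetric T" using aT by (simp add: J_symmetric_def)
  then obtain a b where ab: "\<And>v. T v = a * \<psi> v + b * twist \<psi> v" by (rule J_symmetric_form_span) blast
  have psN: "ps (N z t) x y = 3 * phi * (a * beta z t (x ## y ## (\<lambda>_. 0)) + b * beta (J z) t (x ## y ## (\<lambda>_. 0)))" for z t x y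
  proof -
    \<comment> \<open>The difference of the two sides. Contracting \<omega> \<and> \<psi> = 0 with N
      z t turns \<omega> \<and> \<psi>_{N z t} into products \<psi>_{zt} \<and> \<psi> that are
      known multiples of \<omega> \<and> \<beta>, so \<omega> \<and> \<gamma> = 0 and \<omega> can
      be cancelled.\<close>
    define \<gamma> where "\<gamma> = (\<lambda>v. contract (N z t) \<psi> v - (3 * phi * a * beta z t v + 3 * phi * b * beta (J z) t v))"
    have "contract (N z t) \<omega> = (\<lambda>w. a * contract t (contract z \<psi>) w + b * contract t (contract (J z) \<psi>) w)"
    proof (rule ext)
      fix w :: "nat \<Rightarrow> V"
      obtain x u where w: "w = x ## u" by (metis vcons_head_tail)
      show "contract (N z t) \<omega> w = a * contract t (contract z \<psi>) w + b * contract t (contract (J z) \<psi>) w"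
        using ab[of "z ## t ## x ## u"] unfolding T3 by (simp add: w om_eq twist_def)
    qed
    then have "wedge 2 2 \<omega> (contract (N z t) \<psi>) v
        = 3 * phi * a * wedge 2 2 \<omega> (beta z t) v + 3 * phi * b * wedge 2 2 \<omega> (beta (J z) t) v" for v
      by (simp add: omega_wedge_psi_contract wedge_add_left wedge_scale_left psi_contract_wedge_psi
          del: contract_apply One_nat_def)
    then have z\<gamma>: "wedge 2 2 \<omega> \<gamma> v = 0" for v
      by (simp add: \<gamma>_def wedge_diff_right wedge_add_right wedge_scale_right del: contract_apply)
    have a\<gamma>: "alt_form 2 \<gamma>"
      unfolding \<gamma>_def
      by (intro alt_form_diff alt_form_add alt_form_scale alt_form_beta alt_form_contract_3 \<psi>)
    have "\<gamma> (x ## y ## (\<lambda>_. 0)) = 0" by (rule omega_wedge_injective[OF a\<gamma> z\<gamma>])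
    then show ?thesis by (simp add: \<gamma>_def ps_eq algebra_simps)
  qed
  have anti: "ps (N x y) z t = - ps (N z t) x y" for x y z t
  proof -
    have "- ps (N x y) z t = - (- ps (N z t) x y)"
    proof (rule type_2_2_pair_antisym[where J = J and \<epsilon> = \<epsilon> and \<sigma> = "\<lambda>x y z t. \<sigma> (x ## y ## z ## t ## (\<lambda>_. 0))"
        and B = "\<lambda>x y z t. - ps (N x y) z t", OF J_J eps_square])
      show "\<sigma> (c *\<^sub>R x ## y ## z ## t ## (\<lambda>_. 0)) = c * \<sigma> (x ## y ## z ## t ## (\<lambda>_. 0))" for c x y z t
        using linear_scale[OF alt_form_linear_head[of 3 \<sigma>]] \<sigma> by simp
      show "\<sigma> (J x ## y ## z ## t ## (\<lambda>_. 0)) + \<sigma> (x ## J y ## z ## t ## (\<lambda>_. 0)) = - ps (N x y) z t" for x y z t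
        unfolding ps_def by (rule \<sigma>_N)
      show "- ps (N (J x) y) z t = - (- ps (N x y) (J z) t)" for x y z t
        by (simp add: N_J linear_neg[OF ps_linear1] ps_J12)
    qed (rule four_form_swaps[OF \<sigma>])+
    then show ?thesis by simp
  qed
  have psN2: "ps (N x y) z t = 3 * phi * a * beta x y (z ## t ## (\<lambda>_. 0))" for x y z t
    using anti[of x y z t] psN[of x y z t] psN[of z t x y]
      beta_pair_antisym[of z t x y "\<lambda>_. 0"] beta_J_pair_sym[of z t x y "\<lambda>_. 0"]
    by (simp add: algebra_simps)
  \<comment> \<open>Half of the coefficient in \<open>psN2\<close>, since inserting J into
    \<omega>^2 produces -2 \<beta>.\<close>
  define \<nu> where "\<nu> = 3 * phi * a / 2"
  have "\<sigma> v = \<nu> * wedge 2 2 \<omega> \<omega> v" for v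
  proof (rule four_form_eqI[OF \<sigma> alt_form_scale[OF alt_form_square[OF \<omega>]]])
    fix x y z t :: V and u :: "nat \<Rightarrow> V"
    have "\<psi> (N x y ## z ## t ## u) = 3 * phi * a * beta x y (z ## t ## u)"
      using psN2[of x y z t] unfolding ps_eq beta_eq .
    then show "\<sigma> (J x ## y ## z ## t ## u) + \<sigma> (x ## J y ## z ## t ## u)
      = \<nu> * wedge 2 2 \<omega> \<omega> (J x ## y ## z ## t ## u) + \<nu> * wedge 2 2 \<omega> \<omega> (x ## J y ## z ## t ## u)"
      unfolding \<sigma>_N distrib_left[symmetric] square_J by (simp add: \<nu>_def)
  qed
  then show ?thesis by blast
qed

end

end

section \<open>Smooth functions and exterior derivative\<close>

text \<open>Both functions have the same set of derivatives at x, so the chosen ones agree even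
  where there is none.\<close>

lemma frechet_derivative_cong:
  assumes S: "open S" "x \<in> S" and fg: "\<And>y. y \<in> S \<Longrightarrow> f y = g y"
  shows "frechet_derivative f (at x) = frechet_derivative g (at x)"
proof -
  have "(f has_derivative D) (at x) \<longleftrightarrow> (g has_derivative D) (at x)" for D
    by (rule iffI; erule has_derivative_transform_within_open[OF _ S]) (simp_all add: fg)
  then show ?thesis unfolding frechet_derivative_def by simp
qed

lemma differentiable_cong:
  assumes "f differentiable (at x)" "open S" "x \<in> S" "\<And>y. y \<in> S \<Longrightarrow> f y = g y"
  shows "g differentiable (at x)"
  using assms has_derivative_transform_within_open unfolding differentiable_def by blast

lemma frechet_derivative_eqI: "(f has_derivative D) (at x) \<Longrightarrow> frechet_derivative f (at x) = D"
  by (rule frechet_derivative_at[symmetric])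

lemma frechet_worksI: "f differentiable (at x) \<Longrightarrow> (f has_derivative frechet_derivative f (at x)) (at x)"
  by (simp add: frechet_derivative_works)

lemma Ck_on_cong:
  assumes S: "open S" and "Ck_on k S f" and fg: "\<And>y. y \<in> S \<Longrightarrow> f y = g y"
  shows "Ck_on k S g"
  using assms(2,3)
proof (induction k arbitrary: f g)
  case 0
  then show ?case using continuous_on_cong[of S S f g] by simp
next
  case (Suc k)
  have "Ck_on k S (\<lambda>x. frechet_derivative g (at x) v)" for v
    by (rule Suc.IH[of "\<lambda>x. frechet_derivative f (at x) v"])
      (use Suc.prems frechet_derivative_cong[OF S _ Suc.prems(2)] in auto)
  then show ?case using Suc.prems(1) differentiable_cong[OF _ S _ Suc.prems(2)] by auto
qed

lemma Ck_on_SucD: "Ck_on (Suc k) S f \<Longrightarrow> Ck_on k S f"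
proof (induction k arbitrary: f)
  case 0
  then show ?case
    by (auto intro!: continuous_at_imp_continuous_on differentiable_imp_continuous_within)
next
  case (Suc k)
  then show ?case by (metis Ck_on.simps(2))
qed

lemma Ck_on_const: "Ck_on k S (\<lambda>x. c)"
proof (induction k arbitrary: c)
  case (Suc k)
  have "frechet_derivative (\<lambda>x::'a. c) (at x) = (\<lambda>v. 0)" for x
    by (rule frechet_derivative_eqI) simp
  then show ?case using Suc[of 0] by simp
qed simp

lemma Ck_on_add:
  assumes S: "open S" and "Ck_on k S f" "Ck_on k S g"
  shows "Ck_on k S (\<lambda>x. f x + g x)"
  using assms(2,3)
proof (induction k arbitrary: f g)
  case 0 then show ?case by (simp add: continuous_on_add)
next
  case (Suc k)
  have d: "frechet_derivative f (at x) v + frechet_derivative g (at x) v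
      = frechet_derivative (\<lambda>x. f x + g x) (at x) v" if "x \<in> S" for x v
    using Suc.prems that by (subst frechet_derivative_eqI[OF has_derivative_add[OF frechet_worksI frechet_worksI]]) auto
  have "Ck_on k S (\<lambda>x. frechet_derivative (\<lambda>x. f x + g x) (at x) v)" for v
    by (rule Ck_on_cong[OF S Suc.IH d]) (use Suc.prems in auto)
  then show ?case using Suc.prems by auto
qed

lemma (in bounded_linear) Ck_on_compose:
  assumes S: "open S" and "Ck_on k S g"
  shows "Ck_on k S (\<lambda>x. f (g x))"
  using assms(2)
proof (induction k arbitrary: g)
  case 0 then show ?case by (simp add: continuous_on)
next
  case (Suc k)
  have h: "((\<lambda>x. f (g x)) has_derivative (\<lambda>v. f (frechet_derivative g (at x) v))) (at x)" if "x \<in> S" for x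
    using Suc.prems that by (intro has_derivative frechet_worksI) auto
  have "Ck_on k S (\<lambda>x. frechet_derivative (\<lambda>x. f (g x)) (at x) v)" for v
    by (rule Ck_on_cong[OF S Suc.IH, of "\<lambda>x. frechet_derivative g (at x) v"])
      (use Suc.prems frechet_derivative_eqI[OF h] in auto)
  then show ?case using h by (auto simp: differentiable_def)
qed

lemma (in bounded_bilinear) Ck_on_prod:
  assumes S: "open S" and "Ck_on k S f" "Ck_on k S g"
  shows "Ck_on k S (\<lambda>x. prod (f x) (g x))"
  using assms(2,3)
proof (induction k arbitrary: f g)
  case 0 then show ?case by (simp add: continuous_on)
next
  case (Suc k)
  have h: "((\<lambda>x. prod (f x) (g x)) has_derivative
     (\<lambda>v. prod (f x) (frechet_derivative g (at x) v) + prod (frechet_derivative f (at x) v) (g x))) (at x)"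
    if "x \<in> S" for x
    using Suc.prems that by (intro FDERIV frechet_worksI) auto
  have "Ck_on k S (\<lambda>x. prod (f x) (frechet_derivative g (at x) v) + prod (frechet_derivative f (at x) v) (g x))" for v
    using Suc.prems Ck_on_SucD[OF Suc.prems(1)] Ck_on_SucD[OF Suc.prems(2)]
    by (intro Ck_on_add[OF S] Suc.IH) auto
  then have "Ck_on k S (\<lambda>x. frechet_derivative (\<lambda>x. prod (f x) (g x)) (at x) v)" for v
    by (rule Ck_on_cong[OF S]) (simp add: frechet_derivative_eqI[OF h])
  then show ?case using h by (auto simp: differentiable_def)
qed

lemmas Ck_on_mult = bounded_bilinear.Ck_on_prod[OF bounded_bilinear_mult]
lemmas Ck_on_scaleR = bounded_bilinear.Ck_on_prod[OF bounded_bilinear_scaleR]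

text \<open>The exponent is arbitrary in the induction because differentiation lowers it. Real
  powers cover both the reciprocals and the inverse square root that occur in J.\<close>

lemma Ck_on_powr:
  fixes f :: "'a::real_normed_vector \<Rightarrow> real"
  assumes S: "open S" and "Ck_on k S f" and pos: "\<And>x. x \<in> S \<Longrightarrow> f x > 0"
  shows "Ck_on k S (\<lambda>x. f x powr a)"
  using assms(2)
proof (induction k arbitrary: a)
  case 0 then show ?case using less_imp_neq[OF pos] by (force intro!: continuous_on_powr continuous_on_const)
next
  case (Suc k)
  have h: "((\<lambda>x. f x powr a) has_derivative
     (\<lambda>v. frechet_derivative f (at x) v * (a * f x powr (a - 1)))) (at x)"
    if x: "x \<in> S" for x
  proof -
    have "((\<lambda>y. y powr a) has_real_derivative a * f x powr (a - 1)) (at (f x))"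
      using pos[OF x] by (rule has_real_derivative_powr)
    moreover have "(f has_derivative frechet_derivative f (at x)) (at x)"
      using Suc.prems x by (intro frechet_worksI) auto
    ultimately show ?thesis by (rule DERIV_compose_FDERIV)
  qed
  have ck: "Ck_on k S (\<lambda>x. frechet_derivative f (at x) v * (a * f x powr (a - 1)))" for v
    using Suc.prems Ck_on_SucD[OF Suc.prems]
    by (intro Ck_on_mult[OF S] Ck_on_const Suc.IH) auto
  have "Ck_on k S (\<lambda>x. frechet_derivative (\<lambda>x. f x powr a) (at x) v)" for v
    by (rule Ck_on_cong[OF S ck[of v]]) (simp add: frechet_derivative_eqI[OF h])
  then show ?case using h by (auto simp: differentiable_def)
qed

lemma smooth_on_cong: "open S \<Longrightarrow> smooth_on S f \<Longrightarrow> (\<And>y. y \<in> S \<Longrightarrow> f y = g y) \<Longrightarrow> smooth_on S g"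
  unfolding smooth_on_def using Ck_on_cong by blast

lemma smooth_on_const: "smooth_on S (\<lambda>x. c)"
  by (simp add: smooth_on_def Ck_on_const)

lemma smooth_on_add: "open S \<Longrightarrow> smooth_on S f \<Longrightarrow> smooth_on S g \<Longrightarrow> smooth_on S (\<lambda>x. f x + g x)"
  by (simp add: smooth_on_def Ck_on_add)

lemma smooth_on_mult:
  fixes f g :: "'a::real_normed_vector \<Rightarrow> real"
  shows "open S \<Longrightarrow> smooth_on S f \<Longrightarrow> smooth_on S g \<Longrightarrow> smooth_on S (\<lambda>x. f x * g x)"
  by (simp add: smooth_on_def Ck_on_mult)

lemma smooth_on_scaleR:
  "open S \<Longrightarrow> smooth_on S f \<Longrightarrow> smooth_on S g \<Longrightarrow> smooth_on S (\<lambda>x. f x *\<^sub>R g x)"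
  by (simp add: smooth_on_def Ck_on_scaleR)

lemma smooth_on_linear:
  "bounded_linear h \<Longrightarrow> open S \<Longrightarrow> smooth_on S f \<Longrightarrow> smooth_on S (\<lambda>x. h (f x))"
  by (simp add: smooth_on_def bounded_linear.Ck_on_compose)

lemma smooth_on_minus: "open S \<Longrightarrow> smooth_on S f \<Longrightarrow> smooth_on S (\<lambda>x. - f x)"
  by (rule smooth_on_linear[OF bounded_linear_minus[OF bounded_linear_ident]])

lemma smooth_on_diff: "open S \<Longrightarrow> smooth_on S f \<Longrightarrow> smooth_on S g \<Longrightarrow> smooth_on S (\<lambda>x. f x - g x)"
  using smooth_on_add[of S f "\<lambda>x. - g x"] smooth_on_minus[of S g] by simp

lemma smooth_on_sum:
  "open S \<Longrightarrow> (\<And>i. i \<in> I \<Longrightarrow> smooth_on S (f i)) \<Longrightarrow> smooth_on S (\<lambda>x. \<Sum>i\<in>I. f i x)"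
  by (induction I rule: infinite_finite_induct) (auto intro: smooth_on_const smooth_on_add)

lemma smooth_on_powr:
  fixes f :: "'a::real_normed_vector \<Rightarrow> real"
  shows "open S \<Longrightarrow> smooth_on S f \<Longrightarrow> (\<And>x. x \<in> S \<Longrightarrow> f x > 0) \<Longrightarrow> smooth_on S (\<lambda>x. f x powr a)"
  by (simp add: smooth_on_def Ck_on_powr)

lemma smooth_on_inverse:
  fixes f :: "'a::real_normed_vector \<Rightarrow> real"
  assumes S: "open S" and f: "smooth_on S f" and nz: "\<And>x. x \<in> S \<Longrightarrow> f x \<noteq> 0"
  shows "smooth_on S (\<lambda>x. 1 / f x)"
\<comment> \<open>f may be negative while powers need a positive base, so the reciprocal is taken of
  the square.\<close>
proof (rule smooth_on_cong[OF S, of "\<lambda>x. f x * (f x * f x) powr (- 1)"])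
  show "smooth_on S (\<lambda>x. f x * (f x * f x) powr (- 1))"
    by (intro smooth_on_mult smooth_on_powr S f) (use nz in \<open>metis mult_neg_neg mult_pos_pos linorder_neqE\<close>)
  show "f y * (f y * f y) powr (- 1) = 1 / f y" if "y \<in> S" for y
  proof -
    have "0 < f y * f y" using nz[OF that] by (metis mult_neg_neg mult_pos_pos linorder_neqE)
    then show ?thesis by (simp add: powr_neg_one)
  qed
qed

lemma smooth_on_frechet_derivative: "smooth_on S f \<Longrightarrow> smooth_on S (\<lambda>x. frechet_derivative f (at x) v)"
  unfolding smooth_on_def using Ck_on.simps(2) by blast

lemma smooth_on_differentiable: "smooth_on S f \<Longrightarrow> x \<in> S \<Longrightarrow> f differentiable (at x)"
  unfolding smooth_on_def using Ck_on.simps(2)[of 0] by blast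

lemma smooth_on_continuous: "smooth_on S f \<Longrightarrow> continuous_on S f"
  unfolding smooth_on_def using Ck_on.simps(1) by blast

lemma vec_expand: "(x :: real ^ 'n) = (\<Sum>j\<in>UNIV. x $ j *\<^sub>R axis j 1)"
  using basis_expansion[of x] by (simp add: scalar_mult_eq_scaleR)

lemma smooth_on_vecI:
  fixes f :: "'a::real_normed_vector \<Rightarrow> real ^ 'n"
  assumes S: "open S" and "\<And>j. smooth_on S (\<lambda>x. f x $ j)"
  shows "smooth_on S f"
proof (rule smooth_on_cong[OF S, of "\<lambda>x. \<Sum>j\<in>UNIV. f x $ j *\<^sub>R axis j 1"])
  show "smooth_on S (\<lambda>x. \<Sum>j\<in>UNIV. f x $ j *\<^sub>R axis j 1)"
    by (intro smooth_on_sum smooth_on_scaleR smooth_on_const S assms(2))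
qed (rule vec_expand[symmetric])

lemma smooth_on_nth:
  "open S \<Longrightarrow> smooth_on S f \<Longrightarrow> smooth_on S (\<lambda>x. (f x :: real ^ 'n) $ j)"
  by (rule smooth_on_linear[OF bounded_linear_vec_nth])

lemma smooth_on_wedge:
  assumes S: "open S" and "\<And>v. smooth_on S (\<lambda>x. \<alpha> x v)" "\<And>v. smooth_on S (\<lambda>x. \<beta> x v)"
  shows "smooth_on S (\<lambda>x. wedge k l (\<alpha> x) (\<beta> x) v)"
  unfolding wedge_def by (intro smooth_on_mult smooth_on_sum smooth_on_const S assms(2,3))

text \<open>By the mean value theorem, used twice, the second difference over a small parallelogram
  is h^2 times a mixed derivative at a nearby point. The difference is symmetric in the two
  directions, so continuity gives the claim as h tends to 0.\<close>

lemma second_derivative_symmetric: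
  fixes f :: "'a::real_normed_vector \<Rightarrow> real"
  assumes S: "open S" and x: "x \<in> S" and f: "smooth_on S f"
  shows "frechet_derivative (\<lambda>y. frechet_derivative f (at y) u) (at x) v
       = frechet_derivative (\<lambda>y. frechet_derivative f (at y) v) (at x) u"
proof -
  define D where "D w = (\<lambda>y. frechet_derivative f (at y) w)" for w
  define DD where "DD w z = (\<lambda>y. frechet_derivative (D w) (at y) z)" for w z
  have sD: "smooth_on S (D w)" for w unfolding D_def by (rule smooth_on_frechet_derivative[OF f])
  have sDD: "smooth_on S (DD w z)" for w z unfolding DD_def by (rule smooth_on_frechet_derivative[OF sD])
  have line: "((\<lambda>t. g (a + t *\<^sub>R w)) has_real_derivative frechet_derivative g (at (a + t *\<^sub>R w)) w) (at t)"
    if g: "smooth_on S g" and "a + t *\<^sub>R w \<in> S" for g :: "'a \<Rightarrow> real" and a w t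
  proof -
    have "(g has_derivative frechet_derivative g (at (a + t *\<^sub>R w))) (at (a + t *\<^sub>R w))"
      by (intro frechet_worksI smooth_on_differentiable[OF g] that)
    moreover have "((\<lambda>t. a + t *\<^sub>R w) has_derivative (\<lambda>h. h *\<^sub>R w)) (at t)"
      by (auto intro!: derivative_eq_intros)
    ultimately have "((\<lambda>t. g (a + t *\<^sub>R w)) has_derivative (\<lambda>h. frechet_derivative g (at (a + t *\<^sub>R w)) (h *\<^sub>R w))) (at t)"
      by (rule has_derivative_compose[rotated])
    moreover have "linear (frechet_derivative g (at (a + t *\<^sub>R w)))"
      by (intro linear_frechet_derivative smooth_on_differentiable[OF g] that)
    ultimately show ?thesis
      by (simp add: has_field_derivative_def linear_scale mult.commute[of _ "frechet_derivative _ _ _"])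
  qed
  obtain r where r: "r > 0" "ball x r \<subseteq> S" using S x open_contains_ball by blast
  have mvt: "\<exists>p. dist p x < h * (norm a + norm b + 1) \<and>
      f (x + h *\<^sub>R a + h *\<^sub>R b) - f (x + h *\<^sub>R a) - f (x + h *\<^sub>R b) + f x = h * h * DD a b p"
    if h: "h > 0" "h * (norm a + norm b + 1) < r" for h a b
  proof -
    have inS: "x + s *\<^sub>R a + t *\<^sub>R b \<in> S" and near: "dist (x + s *\<^sub>R a + t *\<^sub>R b) x < h * (norm a + norm b + 1)"
      if "0 \<le> s" "s \<le> h" "0 \<le> t" "t \<le> h" for s t
    proof -
      have "dist (x + s *\<^sub>R a + t *\<^sub>R b) x = norm (s *\<^sub>R a + t *\<^sub>R b)"
        by (simp add: dist_norm add.assoc)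
      also have "\<dots> \<le> s * norm a + t * norm b" using that by (intro norm_triangle_le) simp
      also have "\<dots> \<le> h * norm a + h * norm b" using that by (intro add_mono mult_right_mono) auto
      also have "\<dots> < h * (norm a + norm b + 1)" using h by (simp add: algebra_simps)
      finally show n: "dist (x + s *\<^sub>R a + t *\<^sub>R b) x < h * (norm a + norm b + 1)" .
      then show "x + s *\<^sub>R a + t *\<^sub>R b \<in> S" using h r by (auto simp: dist_commute subset_iff)
    qed
    define g where "g s = f (x + h *\<^sub>R b + s *\<^sub>R a) - f (x + s *\<^sub>R a)" for s
    have "\<exists>s. 0 < s \<and> s < h \<and> g h - g 0 = (h - 0) * (D a (x + h *\<^sub>R b + s *\<^sub>R a) - D a (x + s *\<^sub>R a))"
    proof (rule MVT2)
      fix s assume s: "0 \<le> s" "s \<le> h"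
      have "x + h *\<^sub>R b + s *\<^sub>R a \<in> S" "x + s *\<^sub>R a \<in> S"
        using inS[of s h] inS[of s 0] s h by (auto simp: algebra_simps)
      then show "(g has_real_derivative D a (x + h *\<^sub>R b + s *\<^sub>R a) - D a (x + s *\<^sub>R a)) (at s)"
        unfolding g_def D_def by (intro DERIV_diff line[OF f])
    qed (use h in simp)
    then obtain s where s: "0 < s" "s < h"
      "g h - g 0 = h * (D a (x + h *\<^sub>R b + s *\<^sub>R a) - D a (x + s *\<^sub>R a))" by auto
    have "\<exists>t. 0 < t \<and> t < h \<and> D a (x + s *\<^sub>R a + h *\<^sub>R b) - D a (x + s *\<^sub>R a + 0 *\<^sub>R b)
        = (h - 0) * DD a b (x + s *\<^sub>R a + t *\<^sub>R b)"
    proof (rule MVT2)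
      fix t assume t: "0 \<le> t" "t \<le> h"
      then show "((\<lambda>t. D a (x + s *\<^sub>R a + t *\<^sub>R b)) has_real_derivative DD a b (x + s *\<^sub>R a + t *\<^sub>R b)) (at t)"
        unfolding DD_def by (intro line[OF sD] inS) (use s in auto)
    qed (use h in simp)
    then obtain t where t: "0 < t" "t < h" "D a (x + s *\<^sub>R a + h *\<^sub>R b) - D a (x + s *\<^sub>R a)
        = h * DD a b (x + s *\<^sub>R a + t *\<^sub>R b)" by auto
    have "f (x + h *\<^sub>R a + h *\<^sub>R b) - f (x + h *\<^sub>R a) - f (x + h *\<^sub>R b) + f x = g h - g 0"
      by (simp add: g_def algebra_simps)
    also have "\<dots> = h * h * DD a b (x + s *\<^sub>R a + t *\<^sub>R b)"
      using s(3) t(3) by (simp add: algebra_simps)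
    finally show ?thesis using near[of s t] s t by (intro exI[of _ "x + s *\<^sub>R a + t *\<^sub>R b"]) auto
  qed
  define M where "M = norm u + norm v + 1"
  have M: "M > 0" unfolding M_def by (simp add: add_nonneg_pos)
  have close: "\<bar>DD u v x - DD v u x\<bar> < 2 * e" if e: "e > 0" for e
  proof -
    have "isCont (DD w z) x" for w z
      using continuous_on_interior[OF smooth_on_continuous[OF sDD]] S x by (simp add: interior_open)
    then obtain d1 d2 where d: "d1 > 0" "\<And>p. dist p x < d1 \<Longrightarrow> \<bar>DD u v p - DD u v x\<bar> < e"
      "d2 > 0" "\<And>p. dist p x < d2 \<Longrightarrow> \<bar>DD v u p - DD v u x\<bar> < e"
      using e unfolding continuous_at_eps_delta dist_real_def by meson
    define h where "h = min r (min d1 d2) / (2 * M)"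
    have h: "h > 0" using r d M by (simp add: h_def)
    have hM: "h * M < r" "h * M < d1" "h * M < d2"
      using r d M by (auto simp: h_def min_def)
    obtain p where p: "dist p x < h * M"
      "f (x + h *\<^sub>R u + h *\<^sub>R v) - f (x + h *\<^sub>R u) - f (x + h *\<^sub>R v) + f x = h * h * DD u v p"
      using mvt[of h u v] h hM by (auto simp: M_def)
    obtain q where q: "dist q x < h * M"
      "f (x + h *\<^sub>R v + h *\<^sub>R u) - f (x + h *\<^sub>R v) - f (x + h *\<^sub>R u) + f x = h * h * DD v u q"
      using mvt[of h v u] h hM by (auto simp: M_def add.commute[of "norm v"])
    have "h * h * DD u v p = h * h * DD v u q"
      using p(2) q(2) by (simp add: algebra_simps)
    then have "DD u v p = DD v u q" using h by simp
    moreover have "\<bar>DD u v p - DD u v x\<bar> < e" "\<bar>DD v u q - DD v u x\<bar> < e"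
      using d p(1) q(1) hM by (meson less_trans)+
    ultimately show ?thesis by linarith
  qed
  have "DD u v x = DD v u x"
  proof (rule ccontr)
    assume "DD u v x \<noteq> DD v u x"
    then show False using close[of "\<bar>DD u v x - DD v u x\<bar> / 2"] by simp
  qed
  then show ?thesis by (simp add: DD_def D_def)
qed

lemma frechet_derivative_nth:
  fixes f :: "'a::real_normed_vector \<Rightarrow> real ^ 'n"
  assumes "f differentiable (at x)"
  shows "frechet_derivative (\<lambda>y. f y $ j) (at x) u = frechet_derivative f (at x) u $ j"
proof -
  have "((\<lambda>y. f y $ j) has_derivative (\<lambda>u. frechet_derivative f (at x) u $ j)) (at x)"
    by (rule bounded_linear.has_derivative[OF bounded_linear_vec_nth frechet_worksI[OF assms]])
  then show ?thesis by (simp add: frechet_derivative_eqI)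
qed

lemma second_derivative_symmetric_vec:
  fixes f :: "'a::real_normed_vector \<Rightarrow> real ^ 'n"
  assumes S: "open S" and x: "x \<in> S" and f: "smooth_on S f"
  shows "frechet_derivative (\<lambda>y. frechet_derivative f (at y) u) (at x) v
       = frechet_derivative (\<lambda>y. frechet_derivative f (at y) v) (at x) u"
proof -
  have "frechet_derivative (\<lambda>y. frechet_derivative f (at y) u) (at x) v $ j
      = frechet_derivative (\<lambda>y. frechet_derivative (\<lambda>y. f y $ j) (at y) u) (at x) v" for u v j
  proof -
    have "frechet_derivative (\<lambda>y. frechet_derivative f (at y) u) (at x) v $ j
       = frechet_derivative (\<lambda>y. frechet_derivative f (at y) u $ j) (at x) v"
      by (rule frechet_derivative_nth[symmetric])
        (rule smooth_on_differentiable[OF smooth_on_frechet_derivative[OF f] x])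
    also have "\<dots> = frechet_derivative (\<lambda>y. frechet_derivative (\<lambda>y. f y $ j) (at y) u) (at x) v"
      by (subst frechet_derivative_cong[OF S x])
        (auto simp: frechet_derivative_nth[OF smooth_on_differentiable[OF f]])
    finally show ?thesis .
  qed
  then show ?thesis
    using second_derivative_symmetric[OF S x smooth_on_nth[OF S f]] by (simp add: vec_eq_iff)
qed

text \<open>The derivative of a form in direction \<open>u\<close> with respect to the flat
  connection of the chart; the exterior derivative is its alternation.\<close>

definition dform :: "('v::real_normed_vector \<Rightarrow> 'v form) \<Rightarrow> 'v \<Rightarrow> 'v \<Rightarrow> 'v form" where
  "dform \<alpha> x u = (\<lambda>v. frechet_derivative (\<lambda>y. \<alpha> y v) (at x) u)"

lemma ext_deriv_dform: "ext_deriv k \<alpha> x v = (\<Sum>i\<le>k. (- 1) ^ i * dform \<alpha> x (v i) (del i v))"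
  by (simp add: ext_deriv_def dform_def del_def)

text \<open>Cartan's formula for a constant vector field u, whose Lie derivative is
  \<open>dform\<close>. It allows induction on the degree.\<close>

lemma ext_deriv_Suc_vcons:
  "ext_deriv (Suc k) \<alpha> x (u ## v) = dform \<alpha> x u v - ext_deriv k (\<lambda>y. contract u (\<alpha> y)) x v"
proof -
  have "dform (\<lambda>y. contract u (\<alpha> y)) x w z = dform \<alpha> x w (u ## z)" for w z
    by (simp add: dform_def)
  then show ?thesis
    unfolding ext_deriv_dform sum.atMost_Suc_shift by (simp add: del_0 del_Suc sum_negf[symmetric])
qed

lemma alt_form_dform:
  assumes S: "open S" "x \<in> S" and alt: "\<And>y. y \<in> S \<Longrightarrow> alt_form k (\<alpha> y)"
    and diff: "\<And>v. (\<lambda>y. \<alpha> y v) differentiable (at x)"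
  shows "alt_form k (dform \<alpha> x u)"
  unfolding alt_form_def
proof (intro conjI allI impI)
  fix v w :: "nat \<Rightarrow> 'a" assume "\<forall>i<k. v i = w i"
  then have "\<And>y. y \<in> S \<Longrightarrow> \<alpha> y v = \<alpha> y w" using alt_form_cong[OF alt] by blast
  from frechet_derivative_cong[OF S this] show "dform \<alpha> x u v = dform \<alpha> x u w"
    by (simp add: dform_def)
next
  fix v :: "nat \<Rightarrow> 'a" and i assume i: "i < k"
  show "linear (\<lambda>z. dform \<alpha> x u (v(i := z)))"
  proof (rule linearI)
    fix a b :: 'a and c :: real
    have "frechet_derivative (\<lambda>y. \<alpha> y (v(i := a + b))) (at x)
        = frechet_derivative (\<lambda>y. \<alpha> y (v(i := a)) + \<alpha> y (v(i := b))) (at x)"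
      by (rule frechet_derivative_cong[OF S]) (rule linear_add[OF alt_form_linear[OF alt i]])
    also have "\<dots> = (\<lambda>u. dform \<alpha> x u (v(i := a)) + dform \<alpha> x u (v(i := b)))"
      unfolding dform_def by (intro frechet_derivative_eqI has_derivative_add frechet_worksI diff)
    finally show "dform \<alpha> x u (v(i := a + b)) = dform \<alpha> x u (v(i := a)) + dform \<alpha> x u (v(i := b))"
      by (simp add: dform_def)
    have "frechet_derivative (\<lambda>y. \<alpha> y (v(i := c *\<^sub>R a))) (at x)
        = frechet_derivative (\<lambda>y. c *\<^sub>R \<alpha> y (v(i := a))) (at x)"
      by (rule frechet_derivative_cong[OF S]) (rule linear_scale[OF alt_form_linear[OF alt i]])
    also have "\<dots> = (\<lambda>u. c *\<^sub>R dform \<alpha> x u (v(i := a)))"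
      unfolding dform_def by (intro frechet_derivative_eqI has_derivative_scaleR_right frechet_worksI diff)
    finally show "dform \<alpha> x u (v(i := c *\<^sub>R a)) = c *\<^sub>R dform \<alpha> x u (v(i := a))"
      by (simp add: dform_def)
  qed
next
  fix v :: "nat \<Rightarrow> 'a" and i j assume "i < k" "j < k" "i \<noteq> j \<and> v i = v j"
  then have "\<And>y. y \<in> S \<Longrightarrow> \<alpha> y v = 0" using alt_form_eq_0[OF alt, of _ i j] by blast
  from frechet_derivative_cong[OF S this] show "dform \<alpha> x u v = 0"
    by (simp add: dform_def)
qed

lemma alt_form_expand:
  fixes \<alpha> :: "(real ^ 'n) form"
  assumes \<alpha>: "alt_form k \<alpha>" and m: "m < k"
  shows "\<alpha> (v(m := z)) = (\<Sum>j\<in>UNIV. z $ j * \<alpha> (v(m := axis j 1)))"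
proof -
  note lin = alt_form_linear[OF \<alpha> m, of v]
  have "\<alpha> (v(m := z)) = \<alpha> (v(m := (\<Sum>j\<in>UNIV. z $ j *\<^sub>R axis j 1)))" using vec_expand[of z] by simp
  also have "\<dots> = (\<Sum>j\<in>UNIV. z $ j * \<alpha> (v(m := axis j 1)))"
    using linear_sum[OF lin, of "\<lambda>j. z $ j *\<^sub>R axis j 1" UNIV] linear_scale[OF lin] by simp
  finally show ?thesis .
qed

text \<open>Interpolates between constant arguments \<open>c\<close> and varying arguments
  \<open>a\<close>. Regularity of a form is given for constant arguments, and the varying ones are
  brought in one slot at a time.\<close>

definition mix :: "nat \<Rightarrow> (nat \<Rightarrow> 'v) \<Rightarrow> (nat \<Rightarrow> 'v) \<Rightarrow> nat \<Rightarrow> 'v" where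
  "mix m a c = (\<lambda>i. if i < m then a i else c i)"

lemma mix_upd: "mix m a (c(m := z)) = (mix m a c)(m := z)"
  by (auto simp: mix_def)

lemma mix_Suc: "mix (Suc m) a c = (mix m a c)(m := a m)"
  by (auto simp: mix_def less_Suc_eq)

lemma smooth_on_form_eval:
  fixes \<alpha> :: "'a::real_normed_vector \<Rightarrow> (real ^ 'n) form"
  assumes S: "open S" and alt: "\<And>x. x \<in> S \<Longrightarrow> alt_form k (\<alpha> x)"
    and \<alpha>: "\<And>v. smooth_on S (\<lambda>x. \<alpha> x v)" and w: "\<And>i. i < k \<Longrightarrow> smooth_on S (\<lambda>x. w x i)"
  shows "smooth_on S (\<lambda>x. \<alpha> x (w x))"
proof -
  have "m \<le> k \<Longrightarrow> smooth_on S (\<lambda>x. \<alpha> x (mix m (w x) c))" for m c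
  proof (induction m arbitrary: c)
    case 0
    then show ?case using \<alpha> by (simp add: mix_def)
  next
    case (Suc m)
    then have m: "m < k" by simp
    show ?case
    proof (rule smooth_on_cong[OF S])
      show "smooth_on S (\<lambda>x. \<Sum>j\<in>UNIV. w x m $ j * \<alpha> x (mix m (w x) (c(m := axis j 1))))"
        using Suc m by (intro smooth_on_sum smooth_on_mult smooth_on_nth S w) auto
      show "(\<Sum>j\<in>UNIV. w x m $ j * \<alpha> x (mix m (w x) (c(m := axis j 1)))) = \<alpha> x (mix (Suc m) (w x) c)"
        if "x \<in> S" for x
        unfolding mix_Suc mix_upd by (rule alt_form_expand[OF alt[OF that] m, symmetric])
    qed
  qed
  from this[of k] have 1: "smooth_on S (\<lambda>x. \<alpha> x (mix k (w x) undefined))" by simp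
  show ?thesis
    by (rule smooth_on_cong[OF S 1], rule alt_form_cong[OF alt]) (auto simp: mix_def)
qed

text \<open>Product rule for a form evaluated on moving vectors. The slot brought in last is
  expanded in the standard basis, so that it enters through products with scalar coordinate
  functions.\<close>

lemma has_derivative_form_eval:
  fixes \<alpha> :: "real ^ 'n \<Rightarrow> (real ^ 'n) form"
  assumes S: "open S" "x \<in> S" and alt: "\<And>y. y \<in> S \<Longrightarrow> alt_form k (\<alpha> y)"
    and diff: "\<And>v. (\<lambda>y. \<alpha> y v) differentiable (at x)"
    and w: "\<And>i. i < k \<Longrightarrow> ((\<lambda>y. w y i) has_derivative Dw i) (at x)"
  shows "((\<lambda>y. \<alpha> y (w y)) has_derivative
    (\<lambda>u. dform \<alpha> x u (w x) + (\<Sum>i<k. \<alpha> x ((w x)(i := Dw i u))))) (at x)"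
proof -
  note altx = alt[OF S(2)]
  note altd = alt_form_dform[OF S alt diff]
  have "m \<le> k \<Longrightarrow> ((\<lambda>y. \<alpha> y (mix m (w y) c)) has_derivative
    (\<lambda>u. dform \<alpha> x u (mix m (w x) c) + (\<Sum>i<m. \<alpha> x ((mix m (w x) c)(i := Dw i u))))) (at x)" for m c
  proof (induction m arbitrary: c)
    case 0
    then show ?case using frechet_worksI[OF diff[of c]] by (simp add: mix_def dform_def)
  next
    case (Suc m)
    then have m: "m < k" by simp
    define e where "e = (\<lambda>j. axis j 1 :: real ^ 'n)"
    define W where "W = mix m (w x) c"
    have "((\<lambda>y. \<Sum>j\<in>UNIV. w y m $ j * \<alpha> y (mix m (w y) (c(m := e j)))) has_derivative
       (\<lambda>u. \<Sum>j\<in>UNIV. w x m $ j * (dform \<alpha> x u (mix m (w x) (c(m := e j)))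
             + (\<Sum>i<m. \<alpha> x ((mix m (w x) (c(m := e j)))(i := Dw i u))))
           + Dw m u $ j * \<alpha> x (mix m (w x) (c(m := e j))))) (at x)"
      using m by (intro has_derivative_sum has_derivative_mult Suc.IH
          bounded_linear.has_derivative[OF bounded_linear_vec_nth] w) auto
    then have 1: "((\<lambda>y. \<alpha> y (mix (Suc m) (w y) c)) has_derivative
       (\<lambda>u. \<Sum>j\<in>UNIV. w x m $ j * (dform \<alpha> x u (mix m (w x) (c(m := e j)))
             + (\<Sum>i<m. \<alpha> x ((mix m (w x) (c(m := e j)))(i := Dw i u))))
           + Dw m u $ j * \<alpha> x (mix m (w x) (c(m := e j))))) (at x)"
    proof (rule has_derivative_transform_within_open[OF _ S])
      fix y assume y: "y \<in> S"
      show "(\<Sum>j\<in>UNIV. w y m $ j * \<alpha> y (mix m (w y) (c(m := e j)))) = \<alpha> y (mix (Suc m) (w y) c)"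
        unfolding mix_Suc mix_upd e_def by (rule alt_form_expand[OF alt[OF y] m, symmetric])
    qed
    have 2: "(\<Sum>j\<in>UNIV. w x m $ j * (dform \<alpha> x u (mix m (w x) (c(m := e j)))
             + (\<Sum>i<m. \<alpha> x ((mix m (w x) (c(m := e j)))(i := Dw i u))))
           + Dw m u $ j * \<alpha> x (mix m (w x) (c(m := e j))))
      = dform \<alpha> x u (mix (Suc m) (w x) c) + (\<Sum>i<Suc m. \<alpha> x ((mix (Suc m) (w x) c)(i := Dw i u)))" for u
    proof -
      have a: "(\<Sum>j\<in>UNIV. w x m $ j * dform \<alpha> x u (W(m := e j))) = dform \<alpha> x u (W(m := w x m))"
        unfolding e_def by (rule alt_form_expand[OF altd m, symmetric])
      have b: "(\<Sum>j\<in>UNIV. w x m $ j * (\<Sum>i<m. \<alpha> x (W(m := e j, i := Dw i u))))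
         = (\<Sum>i<m. \<alpha> x (W(m := w x m, i := Dw i u)))"
      proof -
        have "(\<Sum>j\<in>UNIV. w x m $ j * \<alpha> x (W(m := e j, i := Dw i u))) = \<alpha> x (W(m := w x m, i := Dw i u))"
          if "i < m" for i
          using alt_form_expand[OF altx m, of "W(i := Dw i u)" "w x m"] that
          by (simp add: fun_upd_twist e_def)
        then show ?thesis
          unfolding sum_distrib_left by (subst sum.swap) simp
      qed
      have c: "(\<Sum>j\<in>UNIV. Dw m u $ j * \<alpha> x (W(m := e j))) = \<alpha> x (W(m := Dw m u))"
        unfolding e_def by (rule alt_form_expand[OF altx m, symmetric])
      show ?thesis
        unfolding mix_Suc mix_upd W_def[symmetric]
        using a b c by (simp add: sum.distrib distrib_left)
    qed
    show ?case using 1 unfolding 2 .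
  qed
  from this[of k undefined] have 1: "((\<lambda>y. \<alpha> y (mix k (w y) undefined)) has_derivative
    (\<lambda>u. dform \<alpha> x u (mix k (w x) undefined) + (\<Sum>i<k. \<alpha> x ((mix k (w x) undefined)(i := Dw i u))))) (at x)"
    by simp
  have "dform \<alpha> x u (mix k (w x) undefined) = dform \<alpha> x u (w x)" for u
    by (rule alt_form_cong[OF altd]) (auto simp: mix_def)
  moreover have "\<alpha> x ((mix k (w x) undefined)(i := z)) = \<alpha> x ((w x)(i := z))" for i z
    by (rule alt_form_cong[OF altx]) (auto simp: mix_def)
  ultimately have "((\<lambda>y. \<alpha> y (mix k (w y) undefined)) has_derivative
    (\<lambda>u. dform \<alpha> x u (w x) + (\<Sum>i<k. \<alpha> x ((w x)(i := Dw i u))))) (at x)"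
    using 1 by simp
  then show ?thesis
    by (rule has_derivative_transform_within_open[OF _ S])
      (rule alt_form_cong[OF alt], auto simp: mix_def)
qed

lemma form_on_contract:
  assumes "form_on S (Suc k) \<alpha>"
  shows "form_on S k (\<lambda>y. contract u (\<alpha> y))"
  using assms by (auto simp: form_on_def alt_form_contract)

lemma form_on_dform:
  assumes S: "open S" and \<alpha>: "form_on S k \<alpha>"
  shows "form_on S k (\<lambda>y. dform \<alpha> y u)"
  unfolding form_on_def
proof (intro conjI ballI allI)
  fix x assume x: "x \<in> S"
  show "alt_form k (dform \<alpha> x u)"
    by (rule alt_form_dform[OF S x])
      (use \<alpha> in \<open>auto simp: form_on_def intro: smooth_on_differentiable[OF _ x]\<close>)
next
  fix v
  show "smooth_on S (\<lambda>x. dform \<alpha> x u v)"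
    unfolding dform_def using \<alpha> by (auto simp: form_on_def intro: smooth_on_frechet_derivative)
qed

lemma smooth_on_ext_deriv:
  assumes S: "open S" and \<alpha>: "form_on S k \<alpha>"
  shows "smooth_on S (\<lambda>x. ext_deriv k \<alpha> x v)"
  unfolding ext_deriv_dform using form_on_dform[OF S \<alpha>]
  by (intro smooth_on_sum smooth_on_mult smooth_on_const S) (auto simp: form_on_def)

lemma alt_form_ext_deriv:
  fixes \<alpha> :: "real ^ 'n \<Rightarrow> (real ^ 'n) form"
  assumes S: "open S" "x \<in> S" and \<alpha>: "form_on S k \<alpha>"
  shows "alt_form (Suc k) (ext_deriv k \<alpha> x)"
proof -
  have D: "alt_form k (dform \<alpha> x u)" for u
    using form_on_dform[OF S(1) \<alpha>] S(2) by (auto simp: form_on_def)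
  have lin: "linear (\<lambda>u. dform \<alpha> x u v)" for v
    unfolding dform_def using \<alpha> S(2)
    by (intro linear_frechet_derivative smooth_on_differentiable[of S]) (auto simp: form_on_def)
  have c: "linear (\<lambda>x::real ^ 'n. x $ j)" for j by (auto simp: linear_iff)
  \<comment> \<open>The coordinate formula d\<alpha> = \<Sum>dx^j \<and> D_j \<alpha>, which reduces
    alternation to that of wedge products.\<close>
  have eq: "ext_deriv k \<alpha> x v = (\<Sum>j\<in>UNIV. wedge 1 k (cov (\<lambda>x. x $ j)) (dform \<alpha> x (axis j 1)) v)" for v
  proof -
    have d: "dform \<alpha> x u w = (\<Sum>j\<in>UNIV. u $ j * dform \<alpha> x (axis j 1) w)" for u w
      using arg_cong[OF vec_expand[of u], of "\<lambda>u. dform \<alpha> x u w"]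
      by (simp add: linear_sum[OF lin] linear_scale[OF lin])
    have "ext_deriv k \<alpha> x v = (\<Sum>i\<le>k. \<Sum>j\<in>UNIV. (- 1) ^ i * v i $ j * dform \<alpha> x (axis j 1) (del i v))"
      unfolding ext_deriv_dform
      by (intro sum.cong refl) (simp add: d[of "v _"] sum_distrib_left mult.assoc)
    also have "\<dots> = (\<Sum>j\<in>UNIV. \<Sum>i\<le>k. (- 1) ^ i * v i $ j * dform \<alpha> x (axis j 1) (del i v))"
      by (rule sum.swap)
    finally show ?thesis unfolding wedge_cov_expand[OF c D] .
  qed
  have "alt_form (Suc k) (\<lambda>v. \<Sum>j\<in>UNIV. wedge 1 k (cov (\<lambda>x. x $ j)) (dform \<alpha> x (axis j 1)) v)"
    using alt_form_wedge[OF alt_form_cov[OF c] D] by (intro alt_form_sum) simp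
  then show ?thesis by (simp only: eq[symmetric])
qed

text \<open>Induction on the degree with Cartan's formula: contracting d(d\<alpha>) with u leaves
  the commutator of d with the derivative along u, which vanishes by symmetry of second derivatives,
  plus d(d(.)) of the contraction of \<alpha>.\<close>

lemma ext_deriv_ext_deriv:
  assumes S: "open S" "x \<in> S" and "form_on S k \<alpha>"
  shows "ext_deriv (Suc k) (ext_deriv k \<alpha>) x v = 0"
  using assms(3)
proof (induction k arbitrary: \<alpha> v)
  case 0
  have "frechet_derivative (\<lambda>y. dform \<alpha> y (v 1) (del 0 (del 0 v))) (at x) (v 0)
      = frechet_derivative (\<lambda>y. dform \<alpha> y (v 0) (del 0 (del 1 v))) (at x) (v 1)"
  proof -
    \<comment> \<open>The two leftover argument sequences differ formally, but a zero-form ignores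
      them.\<close>
    have eq: "\<alpha> y (del 0 (del 0 v)) = \<alpha> y (del 0 (del 1 v))" if "y \<in> S" for y
      by (rule alt_form_cong[of 0]) (use 0 that in \<open>auto simp: form_on_def\<close>)
    have "dform \<alpha> y (v 1) (del 0 (del 0 v)) = dform \<alpha> y (v 1) (del 0 (del 1 v))" if "y \<in> S" for y
      unfolding dform_def by (rule fun_cong[OF frechet_derivative_cong[OF S(1) that eq]])
    then have "frechet_derivative (\<lambda>y. dform \<alpha> y (v 1) (del 0 (del 0 v))) (at x)
        = frechet_derivative (\<lambda>y. dform \<alpha> y (v 1) (del 0 (del 1 v))) (at x)"
      by (rule frechet_derivative_cong[OF S])
    then show ?thesis
      unfolding dform_def
      using second_derivative_symmetric[OF S, of "\<lambda>y. \<alpha> y (del 0 (del 1 v))" "v 0" "v 1"] 0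
      by (simp add: form_on_def)
  qed
  then show ?case by (simp add: ext_deriv_dform dform_def del_def)
next
  case (Suc k)
  obtain u w where v: "v = u ## w" by (metis vcons_head_tail)
  note sm = Suc.prems[unfolded form_on_def]
  have d: "(\<lambda>y. contract u (ext_deriv (Suc k) \<alpha> y)) = (\<lambda>y w. dform \<alpha> y u w - ext_deriv k (\<lambda>y. contract u (\<alpha> y)) y w)"
    by (auto simp: ext_deriv_Suc_vcons fun_eq_iff)
  have 1: "dform (\<lambda>y w. dform \<alpha> y u w - ext_deriv k (\<lambda>y. contract u (\<alpha> y)) y w) x a b
     = dform (\<lambda>y. dform \<alpha> y u) x a b - dform (ext_deriv k (\<lambda>y. contract u (\<alpha> y))) x a b" for a b
  proof -
    have "(\<lambda>y. dform \<alpha> y u b) differentiable (at x)"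
      using form_on_dform[OF S(1) Suc.prems, of u] S by (auto simp: form_on_def intro: smooth_on_differentiable)
    moreover have "(\<lambda>y. ext_deriv k (\<lambda>y. contract u (\<alpha> y)) y b) differentiable (at x)"
      using smooth_on_ext_deriv[OF S(1) form_on_contract[OF Suc.prems]] S(2) by (rule smooth_on_differentiable)
    ultimately show ?thesis
      unfolding dform_def[of "\<lambda>y w. dform \<alpha> y u w - _ y w"] dform_def[of "\<lambda>y. dform \<alpha> y u"] dform_def[of "ext_deriv _ _"]
      by (subst frechet_derivative_eqI[OF has_derivative_diff[OF frechet_worksI frechet_worksI]]) auto
  qed
  have "ext_deriv (Suc k) (\<lambda>y. contract u (ext_deriv (Suc k) \<alpha> y)) x w
     = ext_deriv (Suc k) (\<lambda>y. dform \<alpha> y u) x w - ext_deriv (Suc k) (ext_deriv k (\<lambda>y. contract u (\<alpha> y))) x w"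
    unfolding d ext_deriv_dform[of "Suc k"] 1 by (simp only: right_diff_distrib sum_subtractf)
  also have "ext_deriv (Suc k) (ext_deriv k (\<lambda>y. contract u (\<alpha> y))) x w = 0"
    by (rule Suc.IH[OF form_on_contract[OF Suc.prems]])
  also have "ext_deriv (Suc k) (\<lambda>y. dform \<alpha> y u) x w = dform (ext_deriv (Suc k) \<alpha>) x u w"
  proof -
    have "((\<lambda>y. \<Sum>i\<le>Suc k. (- 1) ^ i * dform \<alpha> y (w i) (del i w)) has_derivative
        (\<lambda>u. \<Sum>i\<le>Suc k. (- 1) ^ i * frechet_derivative (\<lambda>y. dform \<alpha> y (w i) (del i w)) (at x) u)) (at x)"
      using form_on_dform[OF S(1) Suc.prems, unfolded form_on_def] S(2)
      by (intro has_derivative_sum has_derivative_mult_right frechet_worksI) (blast intro: smooth_on_differentiable)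
    then have "dform (ext_deriv (Suc k) \<alpha>) x u w
       = (\<Sum>i\<le>Suc k. (- 1) ^ i * frechet_derivative (\<lambda>y. dform \<alpha> y (w i) (del i w)) (at x) u)"
      unfolding dform_def[of "ext_deriv (Suc k) \<alpha>"] ext_deriv_dform[of "Suc k"]
      by (simp only: frechet_derivative_eqI)
    also have "\<dots> = (\<Sum>i\<le>Suc k. (- 1) ^ i * dform (\<lambda>y. dform \<alpha> y u) x (w i) (del i w))"
    proof (intro sum.cong refl arg_cong2[where f = "(*)"])
      fix i
      show "frechet_derivative (\<lambda>y. dform \<alpha> y (w i) (del i w)) (at x) u = dform (\<lambda>y. dform \<alpha> y u) x (w i) (del i w)"
        unfolding dform_def using second_derivative_symmetric[OF S, of "\<lambda>y. \<alpha> y (del i w)" "w i" u] sm by blast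
    qed
    finally show ?thesis unfolding ext_deriv_dform[of "Suc k" "\<lambda>y. dform \<alpha> y u"] by simp
  qed
  finally show ?case unfolding v ext_deriv_Suc_vcons[of "Suc k" "ext_deriv (Suc k) \<alpha>"]
    by (simp del: contract_apply)
qed

lemma alt_form_move_to_front:
  assumes "alt_form k \<alpha>" "i < k"
  shows "\<alpha> (a(i := w)) = (- 1) ^ i * \<alpha> (w ## del i a)"
  using assms
proof (induction i arbitrary: k \<alpha> a)
  case 0
  obtain u b where "a = u ## b" by (metis vcons_head_tail)
  then show ?case unfolding \<open>a = u ## b\<close> vcons_upd_0 del_0 by simp
next
  case (Suc i)
  obtain u b where a: "a = u ## b" by (metis vcons_head_tail)
  obtain k' where k: "k = Suc (Suc k')" using Suc.prems(2) by (cases k; cases "k - 1") auto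
  have "contract u \<alpha> (b(i := w)) = (- 1) ^ i * contract u \<alpha> (w ## del i b)"
  proof (rule Suc.IH)
    show "alt_form (Suc k') (contract u \<alpha>)" using Suc.prems(1) unfolding k by (rule alt_form_contract)
  qed (use Suc.prems k in simp)
  moreover have "\<alpha> (u ## w ## del i b) = - \<alpha> (w ## u ## del i b)"
    using alt_form_head_swap Suc.prems(1) unfolding k by blast
  ultimately show ?case unfolding a vcons_upd_Suc del_Suc by simp
qed

text \<open>This cancellation is what makes the exterior derivative natural: \<open>s i j\<close> plays the role of
  the second derivative of a change of coordinates in the directions \<open>v i\<close> and \<open>v j\<close>.\<close>

lemma alternating_symmetric_sum_zero:
  assumes "alt_form k \<alpha>" and "\<And>i j. s i j = s j i"
  shows "(\<Sum>i\<le>k. (- 1) ^ i * (\<Sum>j<k. \<alpha> ((del i a)(j := s i (if j < i then j else Suc j))))) = (0::real)"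
  using assms
proof (induction k arbitrary: \<alpha> a s)
  case 0 then show ?case by simp
next
  case (Suc k)
  obtain u b where a: "a = u ## b" by (metis vcons_head_tail)
  note alt = Suc.prems(1)
  define E where "E i = (\<Sum>j<k. contract u \<alpha> ((del i b)(j := s (Suc i) (Suc (if j < i then j else Suc j)))))" for i
  have IH: "(\<Sum>i\<le>k. (- 1) ^ i * E i) = 0"
    unfolding E_def by (rule Suc.IH[OF alt_form_contract[OF alt], of "\<lambda>i j. s (Suc i) (Suc j)"]) (rule Suc.prems(2))
  \<comment> \<open>The pairs of indices split into three kinds. Those of the form (0, j) and (i, 0)
    cancel by symmetry of s once the replaced slot is moved to the front; those with both indices
    positive are the induction hypothesis.\<close>
  have "(\<Sum>i\<le>Suc k. (- 1) ^ i * (\<Sum>j<Suc k. \<alpha> ((del i a)(j := s i (if j < i then j else Suc j)))))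
    = (\<Sum>j<Suc k. \<alpha> (b(j := s 0 (Suc j))))
      + (\<Sum>i\<le>k. - ((- 1) ^ i * (\<Sum>j<Suc k. \<alpha> ((u ## del i b)(j := s (Suc i) (if j < Suc i then j else Suc j))))))"
    unfolding sum.atMost_Suc_shift[of _ k] by (simp add: a del_0 del_Suc)
  also have "(\<Sum>i\<le>k. - ((- 1) ^ i * (\<Sum>j<Suc k. \<alpha> ((u ## del i b)(j := s (Suc i) (if j < Suc i then j else Suc j))))))
    = (\<Sum>i\<le>k. - ((- 1) ^ i * \<alpha> (s (Suc i) 0 ## del i b)) - (- 1) ^ i * E i)"
  proof (intro sum.cong refl)
    fix i
    have "(\<Sum>j<Suc k. \<alpha> ((u ## del i b)(j := s (Suc i) (if j < Suc i then j else Suc j))))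
       = \<alpha> (s (Suc i) 0 ## del i b) + E i"
      unfolding sum.lessThan_Suc_shift E_def by (auto simp: vcons_upd_0 vcons_upd_Suc intro!: sum.cong)
    then show "- ((- 1) ^ i * (\<Sum>j<Suc k. \<alpha> ((u ## del i b)(j := s (Suc i) (if j < Suc i then j else Suc j)))))
      = - ((- 1) ^ i * \<alpha> (s (Suc i) 0 ## del i b)) - (- 1) ^ i * E i"
      by (simp add: algebra_simps)
  qed
  also have "\<dots> = - (\<Sum>i\<le>k. (- 1) ^ i * \<alpha> (s (Suc i) 0 ## del i b))"
    using IH by (simp add: sum_subtractf sum_negf)
  also have "(\<Sum>j<Suc k. \<alpha> (b(j := s 0 (Suc j)))) = (\<Sum>i\<le>k. (- 1) ^ i * \<alpha> (s (Suc i) 0 ## del i b))"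
  proof -
    have "(\<Sum>j<Suc k. \<alpha> (b(j := s 0 (Suc j)))) = (\<Sum>j<Suc k. (- 1) ^ j * \<alpha> (s 0 (Suc j) ## del j b))"
      by (intro sum.cong refl alt_form_move_to_front[OF alt]) simp
    also have "\<dots> = (\<Sum>j<Suc k. (- 1) ^ j * \<alpha> (s (Suc j) 0 ## del j b))"
      by (simp only: Suc.prems(2)[of 0])
    finally show ?thesis by (simp only: lessThan_Suc_atMost)
  qed
  finally show ?case by simp
qed

lemma ext_deriv_pullback:
  fixes T :: "real ^ 'n \<Rightarrow> real ^ 'n"
  assumes S: "open S" "x \<in> S" and T: "smooth_on S T" and S': "open S'" "\<And>y. y \<in> S \<Longrightarrow> T y \<in> S'"
    and \<beta>: "form_on S' k \<beta>"
    and \<alpha>: "\<And>y. y \<in> S \<Longrightarrow> \<alpha> y = pullback (frechet_derivative T (at y)) (\<beta> (T y))"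
  shows "ext_deriv k \<alpha> x = pullback (frechet_derivative T (at x)) (ext_deriv k \<beta> (T x))"
proof (rule ext)
  fix v :: "nat \<Rightarrow> real ^ 'n"
  define P where "P = frechet_derivative T (at x)"
  define s where "s a u = frechet_derivative (\<lambda>y. frechet_derivative T (at y) a) (at x) u" for a u
  have Tx: "(T has_derivative P) (at x)"
    unfolding P_def by (rule frechet_worksI[OF smooth_on_differentiable[OF T S(2)]])
  have altb: "alt_form k (\<beta> (T y))" if "y \<in> S" for y using \<beta> S'(2)[OF that] by (simp add: form_on_def)
  have chain: "((\<lambda>y. \<beta> (T y) w) has_derivative (\<lambda>u. dform \<beta> (T x) (P u) w)) (at x)" for w
  proof -
    have "((\<lambda>z. \<beta> z w) has_derivative frechet_derivative (\<lambda>z. \<beta> z w) (at (T x))) (at (T x))"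
      using \<beta> S'(2)[OF S(2)] by (intro frechet_worksI) (auto simp: form_on_def intro: smooth_on_differentiable)
    from has_derivative_compose[OF Tx this] show ?thesis by (simp add: dform_def)
  qed
  \<comment> \<open>The first term alternates to the pullback of the exterior derivative. The sum
    contains the second derivative of T, which is symmetric and therefore disappears under
    alternation.\<close>
  have main: "dform \<alpha> x u w = dform \<beta> (T x) (P u) (\<lambda>i. P (w i))
      + (\<Sum>j<k. \<beta> (T x) ((\<lambda>i. P (w i))(j := s (w j) u)))" for u w
  proof -
    have "((\<lambda>y. \<beta> (T y) (\<lambda>i. frechet_derivative T (at y) (w i))) has_derivative
      (\<lambda>u. dform (\<lambda>y. \<beta> (T y)) x u (\<lambda>i. frechet_derivative T (at x) (w i))
        + (\<Sum>i<k. \<beta> (T x) ((\<lambda>i. frechet_derivative T (at x) (w i))(i := s (w i) u))))) (at x)"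
    proof (rule has_derivative_form_eval[OF S])
      show "alt_form k (\<beta> (T y))" if "y \<in> S" for y by (rule altb[OF that])
      show "(\<lambda>y. \<beta> (T y) w) differentiable (at x)" for w using chain by (auto simp: differentiable_def)
      show "((\<lambda>y. frechet_derivative T (at y) (w i)) has_derivative s (w i)) (at x)" for i
        unfolding s_def
        using frechet_worksI[OF smooth_on_differentiable[OF smooth_on_frechet_derivative[OF T] S(2)]] by simp
    qed
    then have "((\<lambda>y. \<alpha> y w) has_derivative
      (\<lambda>u. dform (\<lambda>y. \<beta> (T y)) x u (\<lambda>i. P (w i)) + (\<Sum>i<k. \<beta> (T x) ((\<lambda>i. P (w i))(i := s (w i) u))))) (at x)"
      unfolding P_def by (rule has_derivative_transform_within_open[OF _ S]) (simp add: \<alpha>)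
    moreover have "dform (\<lambda>y. \<beta> (T y)) x u z = dform \<beta> (T x) (P u) z" for z
      unfolding dform_def[of "\<lambda>y. \<beta> (T y)"] by (simp add: frechet_derivative_eqI[OF chain])
    ultimately show ?thesis by (simp add: dform_def[of \<alpha>] frechet_derivative_eqI)
  qed
  have Pdel: "(\<lambda>j. P (del i v j)) = del i (\<lambda>j. P (v j))" for i by (auto simp: del_def)
  have delv: "del i v j = v (if j < i then j else Suc j)" for i j by (simp add: del_def)
  have sym: "s a u = s u a" for a u
    unfolding s_def by (rule second_derivative_symmetric_vec[OF S T])
  have main': "dform \<alpha> x u w = dform \<beta> (T x) (P u) (\<lambda>i. P (w i))
      + (\<Sum>j<k. \<beta> (T x) ((\<lambda>i. P (w i))(j := s u (w j))))" for u w
  proof -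
    have "s (w j) u = s u (w j)" for j by (rule sym)
    then show ?thesis using main[of u w] by simp
  qed
  have "ext_deriv k \<alpha> x v = (\<Sum>i\<le>k. (- 1) ^ i * dform \<beta> (T x) (P (v i)) (del i (\<lambda>j. P (v j))))
    + (\<Sum>i\<le>k. (- 1) ^ i * (\<Sum>j<k. \<beta> (T x) ((del i (\<lambda>j. P (v j)))(j := s (v i) (v (if j < i then j else Suc j))))))"
    by (simp only: ext_deriv_dform main' Pdel) (simp only: delv sum.distrib distrib_left)
  also have "(\<Sum>i\<le>k. (- 1) ^ i * (\<Sum>j<k. \<beta> (T x) ((del i (\<lambda>j. P (v j)))(j := s (v i) (v (if j < i then j else Suc j)))))) = 0"
    by (rule alternating_symmetric_sum_zero[OF altb[OF S(2)], of "\<lambda>i j. s (v i) (v j)"]) (rule sym)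
  finally show "ext_deriv k \<alpha> x v = pullback (frechet_derivative T (at x)) (ext_deriv k \<beta> (T x)) v"
    by (simp add: ext_deriv_dform P_def)
qed

section \<open>Fields of compatible pairs\<close>

lemma contract_pullback: "linear P \<Longrightarrow> contract v (pullback P \<alpha>) = pullback P (contract (P v) \<alpha>)"
proof (rule ext)
  fix w
  have "(\<lambda>i. P ((v ## w) i)) = P v ## (\<lambda>i. P (w i))" by (auto split: nat.split)
  then show "contract v (pullback P \<alpha>) w = pullback P (contract (P v) \<alpha>) w" by (simp only: contract_apply pullback_apply)
qed

text \<open>Nondegeneracy of the pulled-back two-form makes P invertible, and K is natural because
  contraction and wedge are. The invariants \<lambda> are compared through K^2 = \<lambda> id on one
  nonzero vector rather than through traces.\<close>

lemma Jmap_pullback: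
  assumes 1: "su_pair \<omega> \<psi> \<epsilon>" and 2: "su_pair \<omega>' \<psi>' \<epsilon>" and P: "linear P"
    and \<omega>: "\<omega> = pullback P \<omega>'" and \<psi>: "\<psi> = pullback P \<psi>'"
  shows "P (Jmap \<omega> \<psi> v) = Jmap \<omega>' \<psi>' (P v)"
proof -
  interpret a: su_pair \<omega> \<psi> \<epsilon> by (rule 1)
  interpret b: su_pair \<omega>' \<psi>' \<epsilon> by (rule 2)
  have vcP: "(\<lambda>i. P ((x ## w) i)) = P x ## (\<lambda>i. P (w i))" for x w by (auto split: nat.split)
  have "inj P"
  proof (rule linear_injective_on_subspace_0[OF P subspace_UNIV, THEN iffD2], intro ballI impI)
    fix x assume "P x = 0"
    then have "\<omega> (x ## y ## (\<lambda>_. 0)) = 0" for y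
      unfolding \<omega> pullback_apply vcP using linear_0[OF b.omega_linear1] by simp
    then show "x = 0" by (rule a.omega_nondeg)
  qed
  then have "surj P" using linear_injective_imp_surjective[OF P] by simp
  have cube: "cube \<omega> = pullback P (cube \<omega>')"
    unfolding cube_def \<omega> pullback_wedge ..
  have K: "P (Kmap (cube \<omega>) \<psi> v) = Kmap (cube \<omega>') \<psi>' (P v)" for v
  proof -
    obtain z where z: "P z = Kmap (cube \<omega>') \<psi>' (P v)" using \<open>surj P\<close> by (metis surjD)
    have "contract z (cube \<omega>) = pullback P (contract (P z) (cube \<omega>'))"
      unfolding cube by (rule contract_pullback[OF P])
    also have "\<dots> = wedge 2 3 (contract v \<psi>) \<psi>"
      unfolding z b.contract_K pullback_wedge \<psi> contract_pullback[OF P] ..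
    finally have "Kmap (cube \<omega>) \<psi> v = z" by (rule a.K_eqI)
    then show ?thesis using z by simp
  qed
  have "lam (cube \<omega>) \<psi> = lam (cube \<omega>') \<psi>'"
  proof -
    define x :: V where "x = axis 1 1"
    have x: "x \<noteq> 0" by (simp add: x_def)
    then have Px: "P x \<noteq> 0" using \<open>inj P\<close> linear_0[OF P] by (metis injD)
    have "lam (cube \<omega>) \<psi> *\<^sub>R P x = P (Kmap (cube \<omega>) \<psi> (Kmap (cube \<omega>) \<psi> x))"
      unfolding a.K_K by (simp add: linear_scale[OF P])
    also have "\<dots> = lam (cube \<omega>') \<psi>' *\<^sub>R P x" unfolding K b.K_K ..
    finally show ?thesis using Px by simp
  qed
  then show ?thesis unfolding Jmap_def by (simp add: linear_scale[OF P] K)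
qed

section \<open>Compatible pairs varying smoothly over an open set\<close>

locale su_field =
  fixes S :: "V set" and w p :: "V \<Rightarrow> V form" and \<epsilon> :: real
  assumes S: "open S" and w: "form_on S 2 w" and p: "form_on S 3 p"
    and pair: "\<And>x. x \<in> S \<Longrightarrow> su_pair (w x) (p x) \<epsilon>"
begin

definition J :: "V \<Rightarrow> V \<Rightarrow> V" where "J x = Jmap (w x) (p x)"

lemma alt_w: "x \<in> S \<Longrightarrow> alt_form 2 (w x)" and smooth_w: "smooth_on S (\<lambda>x. w x v)"
  and alt_p: "x \<in> S \<Longrightarrow> alt_form 3 (p x)" and smooth_p: "smooth_on S (\<lambda>x. p x v)"
  using w p by (auto simp: form_on_def)

lemma smooth_square: "smooth_on S (\<lambda>x. wedge 2 2 (w x) (w x) v)"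
  by (intro smooth_on_wedge S smooth_w)

lemma smooth_cube: "smooth_on S (\<lambda>x. cube (w x) v)"
  unfolding cube_def by (intro smooth_on_wedge S smooth_w)

lemma linear_J: "x \<in> S \<Longrightarrow> linear (J x)"
  unfolding J_def using su_pair.linear_J[OF pair] .

lemma smooth_J: "smooth_on S (\<lambda>x. J x v)"
proof (cases "S = {}")
  case True
  then show ?thesis
  proof -
    have "Ck_on k {} f" for k and f :: "V \<Rightarrow> V" by (induction k arbitrary: f) auto
    then show ?thesis unfolding smooth_on_def True by blast
  qed
next
  case False
  then obtain x0 where x0: "x0 \<in> S" by blast
  \<comment> \<open>One argument \<open>b\<close> provides a denominator on all of S: top forms are
    proportional, so the cube could vanish on b only by vanishing identically, which nondegeneracy
    excludes.\<close>
  obtain b where b: "cube (w x0) b \<noteq> 0" using su_pair.cube_nz[OF pair[OF x0]] by blast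
  have nz: "cube (w x) b \<noteq> 0" if x: "x \<in> S" for x
  proof
    assume z: "cube (w x) b = 0"
    obtain v where v: "cube (w x) v \<noteq> 0" using su_pair.cube_nz[OF pair[OF x]] by blast
    have "cube (w x) v * cube (w x0) b = cube (w x) b * cube (w x0) v"
      by (rule alt_form_top_6[OF alt_form_cube[OF alt_w[OF x]] alt_form_cube[OF alt_w[OF x0]]])
    then show False using z v b by simp
  qed
  define K where "K x = Kmap (cube (w x)) (p x)" for x
  have K_nth: "K x v $ j = wedge 1 5 (cov (\<lambda>x. x $ j)) (wedge 2 3 (contract v (p x)) (p x)) b * (1 / cube (w x) b)"
    if x: "x \<in> S" for x v j
  proof -
    interpret P: su_pair "w x" "p x" \<epsilon> by (rule pair[OF x])
    have l: "linear (\<lambda>x::V. x $ j)" by (auto simp: linear_iff)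
    show ?thesis using P.K_wedge[OF l, of v b] nz[OF x] by (simp add: K_def)
  qed
  have smooth_K_nth: "smooth_on S (\<lambda>x. K x v $ j)" for v j
  proof (rule smooth_on_cong[OF S])
    have "smooth_on S (\<lambda>x. contract v (p x) u)" for u by (simp add: smooth_p)
    then show "smooth_on S (\<lambda>x. wedge 1 5 (cov (\<lambda>x. x $ j)) (wedge 2 3 (contract v (p x)) (p x)) b * (1 / cube (w x) b))"
      by (intro smooth_on_mult smooth_on_wedge smooth_on_inverse smooth_on_const S smooth_p smooth_cube nz)
  qed (rule K_nth[symmetric])
  have lin_K: "linear (K x)" if "x \<in> S" for x
    unfolding K_def
  proof -
    interpret P: su_pair "w x" "p x" \<epsilon> by (rule pair[OF that])
    show "linear (Kmap (cube (w x)) (p x))" by (rule P.linear_K)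
  qed
  have smooth_lam: "smooth_on S (\<lambda>x. lam (cube (w x)) (p x))"
  proof (rule smooth_on_cong[OF S])
    \<comment> \<open>Since K^2 = \<lambda> id, the function \<lambda> is the first diagonal entry
      of K^2, a polynomial in the entries of K.\<close>
    show "smooth_on S (\<lambda>x. \<Sum>j\<in>UNIV. K x (axis 1 1) $ j * K x (axis j 1) $ 1)"
      by (intro smooth_on_sum smooth_on_mult S smooth_K_nth)
    fix x assume x: "x \<in> S"
    have "lam (cube (w x)) (p x) = (lam (cube (w x)) (p x) *\<^sub>R axis 1 1 :: V) $ 1" by simp
    also have "\<dots> = K x (K x (axis 1 1)) $ 1" unfolding K_def su_pair.K_K[OF pair[OF x]] ..
    also have "\<dots> = K x (\<Sum>j\<in>UNIV. K x (axis 1 1) $ j *\<^sub>R axis j 1) $ 1" using vec_expand[of "K x (axis 1 1)"] by simp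
    also have "\<dots> = (\<Sum>j\<in>UNIV. K x (axis 1 1) $ j * K x (axis j 1) $ 1)"
      by (simp add: linear_sum[OF lin_K[OF x]] linear_scale[OF lin_K[OF x]])
    finally show "(\<Sum>j\<in>UNIV. K x (axis 1 1) $ j * K x (axis j 1) $ 1) = lam (cube (w x)) (p x)" ..
  qed
  \<comment> \<open>Multiplying by the constant sign \<epsilon> replaces the absolute value by a
    smooth positive function.\<close>
  have "smooth_on S (\<lambda>x. (\<epsilon> * lam (cube (w x)) (p x)) powr (- (1 / 2)) * K x v $ j)" for j
  proof (intro smooth_on_mult smooth_on_powr smooth_on_const S smooth_lam smooth_K_nth)
    fix x assume x: "x \<in> S"
    interpret P: su_pair "w x" "p x" \<epsilon> by (rule pair[OF x])
    show "0 < \<epsilon> * lam (cube (w x)) (p x)"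
      using P.sgn_lam P.\<epsilon> by (auto simp: sgn_real_def split: if_splits)
  qed
  note * = this
  show ?thesis
  proof (rule smooth_on_vecI[OF S], rule smooth_on_cong[OF S *])
    fix x j assume x: "x \<in> S"
    interpret P: su_pair "w x" "p x" \<epsilon> by (rule pair[OF x])
    have "\<epsilon> * lam (cube (w x)) (p x) = \<bar>lam (cube (w x)) (p x)\<bar>"
      using P.sgn_lam P.\<epsilon> by (auto simp: sgn_real_def split: if_splits)
    moreover have "\<bar>l\<bar> powr (- (1 / 2)) = 1 / sqrt \<bar>l\<bar>" for l :: real
      by (simp only: powr_minus powr_half_sqrt[OF abs_ge_zero] inverse_eq_divide)
    ultimately have "(\<epsilon> * lam (cube (w x)) (p x)) powr (- (1 / 2)) = 1 / sqrt \<bar>lam (cube (w x)) (p x)\<bar>"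
      by metis
    then show "(\<epsilon> * lam (cube (w x)) (p x)) powr (- (1 / 2)) * K x v $ j = J x v $ j"
      unfolding J_def Jmap_def K_def by (simp only: vector_scaleR_component real_scaleR_def)
  qed
qed

definition A :: "V \<Rightarrow> V \<Rightarrow> V \<Rightarrow> V" where
  "A x u v = frechet_derivative (\<lambda>y. J y v) (at x) u"

lemma J_expand: "x \<in> S \<Longrightarrow> J x z = (\<Sum>j\<in>UNIV. z $ j *\<^sub>R J x (axis j 1))"
  using arg_cong[OF vec_expand[of z], of "J x"]
  by (simp add: linear_sum[OF linear_J] linear_scale[OF linear_J])

lemma diff_J: "x \<in> S \<Longrightarrow> ((\<lambda>y. J y v) has_derivative (\<lambda>u. A x u v)) (at x)"
  unfolding A_def using frechet_worksI[OF smooth_on_differentiable[OF smooth_J]] by simp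

lemma has_derivative_J_field:
  assumes x: "x \<in> S" and X: "(X has_derivative DX) (at x)"
  shows "((\<lambda>y. J y (X y)) has_derivative (\<lambda>u. A x u (X x) + J x (DX u))) (at x)"
proof -
  have "((\<lambda>y. \<Sum>j\<in>UNIV. X y $ j *\<^sub>R J y (axis j 1)) has_derivative
     (\<lambda>u. \<Sum>j\<in>UNIV. X x $ j *\<^sub>R A x u (axis j 1) + DX u $ j *\<^sub>R J x (axis j 1))) (at x)"
    by (intro has_derivative_sum has_derivative_scaleR diff_J x
        bounded_linear.has_derivative[OF bounded_linear_vec_nth X])
  then have 1: "((\<lambda>y. J y (X y)) has_derivative
     (\<lambda>u. \<Sum>j\<in>UNIV. X x $ j *\<^sub>R A x u (axis j 1) + DX u $ j *\<^sub>R J x (axis j 1))) (at x)"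
    by (rule has_derivative_transform_within_open[OF _ S x]) (rule J_expand[symmetric])
  have "((\<lambda>y. \<Sum>j\<in>UNIV. z $ j *\<^sub>R J y (axis j 1)) has_derivative (\<lambda>u. \<Sum>j\<in>UNIV. z $ j *\<^sub>R A x u (axis j 1))) (at x)" for z
    by (intro has_derivative_sum has_derivative_scaleR_right diff_J x)
  then have "((\<lambda>y. J y z) has_derivative (\<lambda>u. \<Sum>j\<in>UNIV. z $ j *\<^sub>R A x u (axis j 1))) (at x)" for z
    by (rule has_derivative_transform_within_open[OF _ S x]) (rule J_expand[symmetric])
  from frechet_derivative_eqI[OF this]
  have A: "A x u z = (\<Sum>j\<in>UNIV. z $ j *\<^sub>R A x u (axis j 1))" for u z
    unfolding A_def[of x u z] by simp
  have "(\<Sum>j\<in>UNIV. X x $ j *\<^sub>R A x u (axis j 1) + DX u $ j *\<^sub>R J x (axis j 1)) = A x u (X x) + J x (DX u)" for u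
    unfolding sum.distrib A[of u "X x"] J_expand[OF x, of "DX u"] ..
  then show ?thesis using 1 by (simp only:)
qed

lemma A_linear1: "x \<in> S \<Longrightarrow> linear (\<lambda>u. A x u v)"
  by (rule has_derivative_linear[OF diff_J])

lemma A_linear2:
  assumes x: "x \<in> S"
  shows "linear (A x u)"
proof (rule linearI)
  fix a b :: V and c :: real
  have "((\<lambda>y. J y a + J y b) has_derivative (\<lambda>u. A x u a + A x u b)) (at x)"
    by (intro has_derivative_add diff_J x)
  then have "((\<lambda>y. J y (a + b)) has_derivative (\<lambda>u. A x u a + A x u b)) (at x)"
    by (rule has_derivative_transform_within_open[OF _ S x]) (simp add: linear_add[OF linear_J])
  then show "A x u (a + b) = A x u a + A x u b" by (simp add: A_def[of x u "a + b"] frechet_derivative_eqI)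
  have "((\<lambda>y. c *\<^sub>R J y a) has_derivative (\<lambda>u. c *\<^sub>R A x u a)) (at x)"
    by (intro has_derivative_scaleR_right diff_J x)
  then have "((\<lambda>y. J y (c *\<^sub>R a)) has_derivative (\<lambda>u. c *\<^sub>R A x u a)) (at x)"
    by (rule has_derivative_transform_within_open[OF _ S x]) (simp add: linear_scale[OF linear_J])
  then show "A x u (c *\<^sub>R a) = c *\<^sub>R A x u a" by (simp add: A_def[of x u "c *\<^sub>R a"] frechet_derivative_eqI)
qed

lemma J_J: "x \<in> S \<Longrightarrow> J x (J x v) = \<epsilon> *\<^sub>R v"
  unfolding J_def using su_pair.J_J[OF pair] .

text \<open>Differentiate J^2 = \<epsilon>, whose right-hand side is constant.\<close>

lemma A_J: 
  assumes x: "x \<in> S"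
  shows "A x u (J x v) = - J x (A x u v)"
proof -
  have "((\<lambda>y. J y (J y v)) has_derivative (\<lambda>u. A x u (J x v) + J x (A x u v))) (at x)"
    by (rule has_derivative_J_field[OF x diff_J[OF x]])
  then have "((\<lambda>y. \<epsilon> *\<^sub>R v) has_derivative (\<lambda>u. A x u (J x v) + J x (A x u v))) (at x)"
    by (rule has_derivative_transform_within_open[OF _ S x]) (rule J_J)
  moreover have "((\<lambda>y. \<epsilon> *\<^sub>R v) has_derivative (\<lambda>u. 0)) (at x)" by simp
  ultimately have "(\<lambda>u. A x u (J x v) + J x (A x u v)) = (\<lambda>u. 0)" by (rule has_derivative_unique)
  from fun_cong[OF this, of u] show ?thesis by (simp add: eq_neg_iff_add_eq_0)
qed

text \<open>The Nijenhuis tensor in terms of the flat derivative of J. The derivatives of the vector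
  fields in the four brackets cancel, which is its tensoriality.\<close>

definition N :: "V \<Rightarrow> V \<Rightarrow> V \<Rightarrow> V" where
  "N x X Y = - A x (J x X) Y + A x (J x Y) X + J x (A x X Y) - J x (A x Y X)"

lemma nijenhuis_eq_N:
  assumes x: "x \<in> S" and X: "smooth_on S X" and Y: "smooth_on S Y"
  shows "nijenhuis \<epsilon> (\<lambda>y. Jmap (w y) (p y)) X Y x = N x (X x) (Y x)"
proof -
  define DX where "DX = frechet_derivative X (at x)"
  define DY where "DY = frechet_derivative Y (at x)"
  have DX: "(X has_derivative DX) (at x)" and DY: "(Y has_derivative DY) (at x)"
    unfolding DX_def DY_def using frechet_worksI smooth_on_differentiable[OF _ x] X Y by auto
  note J' = J_def[symmetric]
  note dJ = frechet_derivative_eqI[OF has_derivative_J_field[OF x DX]]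
    frechet_derivative_eqI[OF has_derivative_J_field[OF x DY]]
  note l = linear_add[OF linear_J[OF x]] linear_diff[OF linear_J[OF x]]
  show ?thesis
    unfolding nijenhuis_def lie_bracket_def J' dJ DX_def[symmetric] DY_def[symmetric] N_def
    by (simp add: l J_J[OF x] algebra_simps)
qed

lemma N_linear: "x \<in> S \<Longrightarrow> linear (N x X)"
  unfolding N_def using linear_J[of x] A_linear1[of x] A_linear2[of x]
  by (auto simp: linear_iff algebra_simps)

lemma N_anti: "N x X Y = - N x Y X"
  by (simp add: N_def)

lemma N_J: 
  assumes x: "x \<in> S"
  shows "N x (J x X) Y = - J x (N x X Y)"
  unfolding N_def using x
  by (simp add: J_J A_J linear_add[OF linear_J] linear_diff[OF linear_J] linear_neg[OF linear_J]
      linear_scale[OF A_linear1] linear_scale[OF linear_J] algebra_simps)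

definition tw :: "V \<Rightarrow> V form" where
  "tw x v = p x (J x (v 0) ## (\<lambda>i. v (Suc i)))"

lemma tw_eq: "x \<in> S \<Longrightarrow> tw x = su_pair.twist (w x) (p x) (p x)"
  by (rule ext) (simp add: tw_def J_def su_pair.twist_def[OF pair])

lemma smooth_slots: "smooth_on S X \<Longrightarrow> smooth_on S (\<lambda>x. (X x ## v) i)"
  by (cases i) (auto intro: smooth_on_const)

lemma form_on_tw: "form_on S 3 tw"
  unfolding form_on_def
proof (intro conjI ballI allI)
  fix x assume x: "x \<in> S"
  interpret P: su_pair "w x" "p x" \<epsilon> by (rule pair[OF x])
  show "alt_form 3 (tw x)" unfolding tw_eq[OF x] by (rule P.alt_form_twist[OF P.J_symmetric_psi])
next
  fix v
  show "smooth_on S (\<lambda>x. tw x v)"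
    unfolding tw_def by (rule smooth_on_form_eval[OF S alt_p smooth_p smooth_slots[OF smooth_J]])
qed

lemma dform_tw:
  assumes x: "x \<in> S"
  shows "dform tw x u (a ## v) = dform p x u (J x a ## v) + p x (A x u a ## v)"
proof -
  define D where "D i = (\<lambda>u. if i = 0 then A x u a else 0)" for i :: nat
  have "((\<lambda>y. p y (J y a ## v)) has_derivative
    (\<lambda>u. dform p x u (J x a ## v) + (\<Sum>i<3. p x ((J x a ## v)(i := D i u))))) (at x)"
  proof (rule has_derivative_form_eval[OF S x alt_p])
    show "(\<lambda>y. p y v) differentiable (at x)" for v by (rule smooth_on_differentiable[OF smooth_p x])
    show "((\<lambda>y. (J y a ## v) i) has_derivative D i) (at x)" for i
      using diff_J[OF x, of a] by (cases i) (auto simp: D_def)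
  qed
  moreover have "(\<Sum>i<3. p x ((J x a ## v)(i := D i u))) = p x (A x u a ## v)" for u
  proof -
    have "p x ((J x a ## v)(i := D i u)) = 0" if "i < 3" "i \<noteq> 0" for i
      using linear_0[OF alt_form_linear[OF alt_p[OF x] that(1), of "J x a ## v"]] that(2) by (simp add: D_def)
    then have "(\<Sum>i<3. p x ((J x a ## v)(i := D i u))) = (\<Sum>i\<in>{0}. p x ((J x a ## v)(i := D i u)))"
      by (intro sum.mono_neutral_right) auto
    then show ?thesis by (simp add: D_def vcons_upd_0)
  qed
  ultimately have "((\<lambda>y. tw y (a ## v)) has_derivative (\<lambda>u. dform p x u (J x a ## v) + p x (A x u a ## v))) (at x)"
    by (simp add: tw_def)
  then show ?thesis by (simp add: dform_def[of tw] frechet_derivative_eqI)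
qed

lemma ext_deriv_3_eq:
  fixes x :: V
  shows "ext_deriv 3 \<beta> x (a ## b ## c ## d ## t) = dform \<beta> x a (b ## c ## d ## t) - dform \<beta> x b (a ## c ## d ## t)
     + dform \<beta> x c (a ## b ## d ## t) - dform \<beta> x d (a ## b ## c ## t)"
proof -
  have c: "dform (\<lambda>y. contract a (\<beta> y)) x u v = dform \<beta> x u (a ## v)" for a \<beta> and u :: V and v
    by (simp add: dform_def)
  have 0: "ext_deriv 0 \<beta> x (d ## t) = dform \<beta> x d t" for \<beta> and d :: V and t
    by (simp add: ext_deriv_dform del_0)
  show ?thesis
    unfolding numeral_3_eq_3 ext_deriv_Suc_vcons 0 c by simp
qed

text \<open>The \<open>(2,2)\<close> part of \<open>d\<Psi>\<close> is the contraction of \<open>\<Psi>\<close> with the Nijenhuis tensor; \<open>tw\<close> is \<open>\<epsilon> \<psi>\<^sup>-\<close>.\<close>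

lemma nijenhuis_identity:
  assumes x: "x \<in> S" and d: "\<And>v. ext_deriv 3 p x v = 0"
  shows "ext_deriv 3 tw x (J x X ## Y ## Z ## W ## t) + ext_deriv 3 tw x (X ## J x Y ## Z ## W ## t)
    = - p x (N x X Y ## Z ## W ## t)"
proof -
  interpret P: su_pair "w x" "p x" \<epsilon> by (rule pair[OF x])
  have alt: "alt_form 3 (dform p x u)" for u
    by (rule alt_form_dform[OF S x alt_p smooth_on_differentiable[OF smooth_p x]])
  have l: "linear (\<lambda>z. dform p x u (z ## v))" "linear (\<lambda>z. p x (z ## v))" for u v
    using alt_form_linear_head[of 2] alt alt_p[OF x] by auto
  have J': "Jmap (w x) (p x) = J x" by (simp add: J_def)
  have pJ: "p x (J x a ## b ## c ## t) = p x (a ## J x b ## c ## t)" for a b c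
    using P.psi_J12[of a b c t] unfolding J' .
  note ld = linear_add[OF l(2)] linear_diff[OF l(2)] linear_neg[OF l(2)] linear_scale[OF l(1)] linear_scale[OF l(2)]
  \<comment> \<open>On the left-hand side of the claim, the derivatives of p add up to precisely
    this combination.\<close>
  have e1: "\<epsilon> * ext_deriv 3 p x (X ## Y ## Z ## W ## t) + ext_deriv 3 p x (J x X ## J x Y ## Z ## W ## t) = 0"
    by (simp add: d)
  \<comment> \<open>Derivatives of J in the directions Z and W cancel: A anticommutes with J, while
    J moves freely between the slots of p. What is left are the four terms of N.\<close>
  have zz: "p x (A x u (J x X) ## Y ## v) + p x (A x u X ## J x Y ## v) = 0" if "v = Z ## t \<or> v = W ## t" for u v
  proof -
    have "p x (J x (A x u X) ## Y ## v) = p x (A x u X ## J x Y ## v)" using that pJ by auto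
    then show ?thesis by (simp add: A_J[OF x] ld)
  qed
  have N': "p x (N x X Y ## Z ## W ## t) = - p x (A x (J x X) Y ## Z ## W ## t) + p x (A x (J x Y) X ## Z ## W ## t)
      + p x (J x (A x X Y) ## Z ## W ## t) - p x (J x (A x Y X) ## Z ## W ## t)"
    by (simp add: N_def ld)
  show ?thesis
    using e1 zz[of "W ## t" Z] zz[of "Z ## t" W]
    unfolding ext_deriv_3_eq dform_tw[OF x] N' J_J[OF x] A_J[OF x] ld
    by (simp add: algebra_simps)
qed

definition psim :: "V \<Rightarrow> V form" where "psim x = pullback (J x) (p x)"

lemma psim_eq:
  assumes x: "x \<in> S"
  shows "psim x v = \<epsilon> * tw x v"
proof -
  interpret P: su_pair "w x" "p x" \<epsilon> by (rule pair[OF x])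
  have J': "Jmap (w x) (p x) = J x" by (simp add: J_def)
  obtain a b c u where v: "v = a ## b ## c ## u" using P.vcons3 by blast
  have "(\<lambda>i. J x (v i)) = J x a ## J x b ## J x c ## (\<lambda>i. J x (u i))"
    unfolding v by (auto split: nat.split)
  then have "psim x v = p x (J x a ## J x b ## J x c ## (\<lambda>i. J x (u i)))" by (simp add: psim_def)
  also have "\<dots> = p x (J x a ## J x b ## J x c ## u)"
    by (rule alt_form_cong[OF alt_p[OF x]]) (auto split: nat.split simp: less_Suc_eq numeral_3_eq_3)
  also have "\<dots> = p x (J x (J x a) ## J x b ## c ## u)"
    using P.psi_J13[of "J x a" "J x b" c u] unfolding J' .
  also have "\<dots> = \<epsilon> * p x (J x a ## b ## c ## u)"
    using P.psi_J12[of a b c u] unfolding J' J_J[OF x] linear_scale[OF P.psi_linear1] by simp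
  finally show ?thesis by (simp add: tw_def v)
qed

lemma form_on_psim: "form_on S 3 psim"
  unfolding form_on_def
proof (intro conjI ballI allI)
  fix x assume x: "x \<in> S"
  have "psim x = (\<lambda>v. \<epsilon> * tw x v)" by (rule ext) (rule psim_eq[OF x])
  then show "alt_form 3 (psim x)" using alt_form_scale form_on_tw x by (metis form_on_def)
next
  fix v
  show "smooth_on S (\<lambda>x. psim x v)"
    by (rule smooth_on_cong[OF S, of "\<lambda>x. \<epsilon> * tw x v"])
      (use form_on_tw psim_eq S in \<open>auto simp: form_on_def intro: smooth_on_mult smooth_on_const\<close>)
qed

lemma ext_deriv_psim:
  assumes x: "x \<in> S"
  shows "ext_deriv 3 psim x v = \<epsilon> * ext_deriv 3 tw x v"
proof -
  have "dform psim x u z = \<epsilon> * dform tw x u z" for u z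
  proof -
    have "((\<lambda>y. \<epsilon> * tw y z) has_derivative (\<lambda>u. \<epsilon> * dform tw x u z)) (at x)"
      unfolding dform_def using form_on_tw x
      by (intro has_derivative_mult_right frechet_worksI) (auto simp: form_on_def intro: smooth_on_differentiable)
    then have "((\<lambda>y. psim y z) has_derivative (\<lambda>u. \<epsilon> * dform tw x u z)) (at x)"
      by (rule has_derivative_transform_within_open[OF _ S x]) (rule psim_eq[symmetric])
    then show ?thesis by (simp add: dform_def[of psim] frechet_derivative_eqI)
  qed
  then show ?thesis by (simp add: ext_deriv_dform sum_distrib_left algebra_simps)
qed

lemma metric_N: "x \<in> S \<Longrightarrow> metric \<epsilon> (w x) (p x) a b = \<epsilon> * w x (a ## J x b ## (\<lambda>_. 0))"
  unfolding J_def by (rule su_pair.metric_eq[OF pair])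

lemma alt_form_ext_deriv_tw: "x \<in> S \<Longrightarrow> alt_form 4 (ext_deriv 3 tw x)"
  using alt_form_ext_deriv[OF S _ form_on_tw] by simp

lemma skew_iff_square:
  assumes x: "x \<in> S" and d: "\<And>v. ext_deriv 3 p x v = 0"
  shows "(\<forall>X Y. w x (X ## N x X Y ## (\<lambda>_. 0)) = 0)
    \<longleftrightarrow> (\<exists>\<nu>. \<forall>v. ext_deriv 3 psim x v = \<nu> * wedge 2 2 (w x) (w x) v)"
proof -
  interpret P: su_pair "w x" "p x" \<epsilon> by (rule pair[OF x])
  have J': "Jmap (w x) (p x) = J x" by (simp add: J_def)
  note id = nijenhuis_identity[OF x d]
  note prem = alt_form_ext_deriv_tw[OF x] N_linear[OF x] N_anti N_J[OF x, folded J'] id[folded J']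
  show ?thesis
  proof
    assume "\<forall>X Y. w x (X ## N x X Y ## (\<lambda>_. 0)) = 0"
    then have "P.om X (N x X Y) = 0" for X Y by (simp add: P.om_def)
    then obtain \<nu> where "\<And>v. ext_deriv 3 tw x v = \<nu> * wedge 2 2 (w x) (w x) v"
      using P.square_if_N_skew[OF prem] by blast
    then show "\<exists>\<nu>. \<forall>v. ext_deriv 3 psim x v = \<nu> * wedge 2 2 (w x) (w x) v"
      unfolding ext_deriv_psim[OF x] by (metis mult.assoc)
  next
    assume "\<exists>\<nu>. \<forall>v. ext_deriv 3 psim x v = \<nu> * wedge 2 2 (w x) (w x) v"
    then obtain \<nu> where \<nu>: "\<And>v. \<epsilon> * ext_deriv 3 tw x v = \<nu> * wedge 2 2 (w x) (w x) v"
      unfolding ext_deriv_psim[OF x] by blast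
    have "ext_deriv 3 tw x v = (\<epsilon> * \<nu>) * wedge 2 2 (w x) (w x) v" for v
      using arg_cong[OF \<nu>[of v], of "(*) \<epsilon>"] P.eps_square by (simp add: mult.assoc[symmetric])
    then have "P.om X (N x X Y) = 0" for X Y by (rule P.N_skew_if_square[OF prem])
    then show "\<forall>X Y. w x (X ## N x X Y ## (\<lambda>_. 0)) = 0" by (simp add: P.om_def)
  qed
qed

end

text \<open>Every covector is \<omega>(y, .) for some y. Its product with \<omega>^2 is then a third
  of the contraction of \<omega>^3 with y, which vanishes only for y = 0.\<close>

lemma (in su_pair) wedge_square_injective:
  assumes \<phi>: "linear \<phi>" and z: "\<And>v. wedge 1 4 (cov \<phi>) (wedge 2 2 \<omega> \<omega>) v = 0"
  shows "\<phi> x = 0"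
proof -
  define B :: "V \<Rightarrow> V" where "B y = (\<chi> j. om y (axis j 1))" for y
  have B: "linear B" unfolding B_def by (rule linearI) (auto simp: vec_eq_iff om_lin)
  have lin: "f z = (\<Sum>j\<in>UNIV. z $ j * f (axis j 1))" if f: "linear f" for f :: "V \<Rightarrow> real" and z
  proof -
    have "f z = f (\<Sum>j\<in>UNIV. z $ j *\<^sub>R axis j 1)" using vec_expand[of z] by simp
    then show ?thesis by (simp add: linear_sum[OF f] linear_scale[OF f])
  qed
  have "inj B"
  proof (rule linear_injective_on_subspace_0[OF B subspace_UNIV, THEN iffD2], intro ballI impI)
    fix y assume "B y = 0"
    then have "om y (axis j 1) = 0" for j by (simp add: B_def vec_eq_iff)
    then have "om y z = 0" for z using lin[OF om_linear2, of y z] by simp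
    then show "y = 0" by (rule om_nondeg)
  qed
  then have "surj B" using linear_injective_imp_surjective[OF B] by simp
  then obtain y where y: "B y = (\<chi> j. \<phi> (axis j 1))" by (metis surjD)
  then have ax: "om y (axis j 1) = \<phi> (axis j 1)" for j by (simp add: B_def vec_eq_iff)
  have om_y: "om y = \<phi>"
  proof (rule ext)
    fix z
    show "om y z = \<phi> z" unfolding lin[OF om_linear2, of y z] lin[OF \<phi>, of z] ax ..
  qed
  have "contract y (cube \<omega>) v = 0" for v
    unfolding cube_contract[OF \<omega>] om_cov om_y z by simp
  then have "contract y (cube \<omega>) = (\<lambda>v. 0)" by blast
  moreover obtain v where v: "cube \<omega> v \<noteq> 0" using cube_nz by blast
  ultimately have "f y = 0" if "linear f" for f :: "V \<Rightarrow> real"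
    using wedge_cov_contract_top[OF that vol, of y v] by (simp add: wedge_zero_right)
  then have "y = 0" by (intro eq_by_functionals) (simp add: linear_0)
  then show ?thesis using om_y by (metis linear_0[OF om_linear1])
qed

lemma (in su_pair) square_nz: "\<exists>v. wedge 2 2 \<omega> \<omega> v \<noteq> 0"
proof (rule ccontr)
  assume "\<not> ?thesis"
  then have "wedge 2 2 \<omega> \<omega> = (\<lambda>v. 0)" by auto
  then have "cube \<omega> v = 0" for v by (simp add: cube_def wedge_zero_left)
  then show False using cube_nz by blast
qed

section \<open>Skewness tested on vector fields, and constancy of the coefficient\<close>

context su_field
begin

lemma smooth_J_field: "smooth_on S X \<Longrightarrow> smooth_on S (\<lambda>x. J x (X x))"
proof (rule smooth_on_cong[OF S])
  assume X: "smooth_on S X"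
  show "smooth_on S (\<lambda>x. \<Sum>j\<in>UNIV. X x $ j *\<^sub>R J x (axis j 1))"
    by (intro smooth_on_sum smooth_on_scaleR smooth_on_nth smooth_J X S)
qed (rule J_expand[symmetric])

lemma smooth_A_field: "smooth_on S X \<Longrightarrow> smooth_on S (\<lambda>x. A x (X x) v)"
proof (rule smooth_on_cong[OF S])
  assume X: "smooth_on S X"
  have "smooth_on S (\<lambda>x. A x u v)" for u
    unfolding A_def by (rule smooth_on_frechet_derivative[OF smooth_J])
  then show "smooth_on S (\<lambda>x. \<Sum>j\<in>UNIV. X x $ j *\<^sub>R A x (axis j 1) v)"
    by (intro smooth_on_sum smooth_on_scaleR smooth_on_nth X S)
  show "(\<Sum>j\<in>UNIV. X x $ j *\<^sub>R A x (axis j 1) v) = A x (X x) v" if "x \<in> S" for x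
    using arg_cong[OF vec_expand[of "X x"], of "\<lambda>u. A x u v"]
    by (simp only: linear_sum[OF A_linear1[OF that]] linear_scale[OF A_linear1[OF that]])
qed

lemma smooth_N: "smooth_on S (\<lambda>x. N x a b)"
  unfolding N_def
  by (intro smooth_on_add smooth_on_diff smooth_on_minus S smooth_A_field smooth_J_field smooth_J smooth_on_const)

text \<open>The metric contains a J, since g(a,b) = \<epsilon> \<omega>(a,Jb). Both directions move
  this J through \<omega> and N, using N(JX,Y) = -J N(X,Y), to reach the condition without
  J.\<close>

lemma skew_iff_three_form:
  "(\<forall>x\<in>S. \<forall>X Y. w x (X ## N x X Y ## (\<lambda>_. 0)) = 0)
  \<longleftrightarrow> (\<exists>\<tau>. form_on S 3 \<tau> \<and> (\<forall>X Y Z. smooth_on S X \<and> smooth_on S Y \<and> smooth_on S Z \<longrightarrow>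
           (\<forall>x\<in>S. metric \<epsilon> (w x) (p x) (nijenhuis \<epsilon> (\<lambda>y. Jmap (w y) (p y)) X Y x) (Z x)
              = \<tau> x ((!) [X x, Y x, Z x]))))"
  (is "?L \<longleftrightarrow> ?R")
proof
  assume L: ?L
  define \<tau> where "\<tau> x v = \<epsilon> * w x (N x (v 0) (v 1) ## J x (v 2) ## (\<lambda>_. 0))"
    for x and v :: "nat \<Rightarrow> V"
  have alt: "alt_form 3 (\<tau> x)" if x: "x \<in> S" for x
    unfolding alt_form_def
  proof (intro conjI allI impI)
    interpret P: su_pair "w x" "p x" \<epsilon> by (rule pair[OF x])
    have J': "Jmap (w x) (p x) = J x" by (simp add: J_def)
    note l1 = P.omega_linear1 and l2 = P.omega_linear2 and lN = N_linear[OF x] and lJ = linear_J[OF x]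
    {
      fix v v' :: "nat \<Rightarrow> V" assume "\<forall>i<3. v i = v' i"
      then show "\<tau> x v = \<tau> x v'" by (simp add: \<tau>_def)
    next
      fix v :: "nat \<Rightarrow> V" and i :: nat assume "i < 3"
      then consider "i = 0" | "i = 1" | "i = 2" by linarith
      then show "linear (\<lambda>z. \<tau> x (v(i := z)))"
      proof cases
        case 1
        have "linear (\<lambda>z. N x z b)" for b
          using lN[of b] N_anti[of x _ b] by (auto simp: linear_iff)
        note l0 = this
        show ?thesis unfolding 1 \<tau>_def
          by (rule linearI) (simp_all add: linear_add[OF l0] linear_scale[OF l0] linear_add[OF l1] linear_scale[OF l1] algebra_simps)
      next
        case 2
        show ?thesis unfolding 2 \<tau>_def
          by (rule linearI) (simp_all add: linear_add[OF lN] linear_scale[OF lN] linear_add[OF l1] linear_scale[OF l1] algebra_simps)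
      next
        case 3
        show ?thesis unfolding 3 \<tau>_def
          by (rule linearI) (simp_all add: linear_add[OF lJ] linear_scale[OF lJ] linear_add[OF l2] linear_scale[OF l2] algebra_simps)
      qed
    next
      have 1: "P.om X (N x X Y) = 0" for X Y using L x by (simp add: P.om_def)
      have N0: "N x X X = 0" for X
        by (simp add: N_def)
      \<comment> \<open>J is moved from the second argument of \<omega> into N and from there onto
        Y, which turns the expression into an instance of \<open>1\<close> up to sign.\<close>
      have 2: "P.om (N x X Y) (J x X) = 0" for X Y
      proof -
        have "P.om (N x X Y) (J x X) = P.om (N x (J x X) Y) X"
          using P.om_J[of "N x X Y" X] by (simp add: J' N_J[OF x] P.om_lin)
        also have "\<dots> = - P.om X (N x (J x X) Y)" by (rule P.om_anti)
        also have "N x (J x X) Y = - J x (N x X Y)" by (rule N_J[OF x])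
        also have "- J x (N x X Y) = N x X (J x Y)"
          using N_anti[of x X "J x Y"] N_J[OF x, of Y X] N_anti[of x X Y] by (simp add: linear_neg[OF lJ])
        finally show ?thesis using 1 by simp
      qed
      have 3: "P.om (N x X Y) (J x Y) = 0" for X Y
        using 2[of Y X] N_anti[of x X Y] by (simp add: P.om_lin)
      fix v :: "nat \<Rightarrow> V" and i j :: nat assume "i < 3" "j < 3" "i \<noteq> j \<and> v i = v j"
      then have "v 0 = v 1 \<or> v 0 = v 2 \<or> v 1 = v 2" by (auto simp: less_Suc_eq numeral_eq_Suc One_nat_def)
      moreover have "\<tau> x v = \<epsilon> * P.om (N x (v 0) (v 1)) (J x (v 2))" by (simp add: \<tau>_def P.om_def)
      ultimately show "\<tau> x v = 0" using N0 2 3 by (auto simp: P.om_lin)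
    }
  qed
  have "smooth_on S (\<lambda>x. \<tau> x v)" for v
    unfolding \<tau>_def
  proof (intro smooth_on_mult S smooth_on_const smooth_on_form_eval[OF S alt_w smooth_w])
    fix i :: nat assume "i < 2"
    then consider "i = 0" | "i = 1" by linarith
    then show "smooth_on S (\<lambda>x. (N x (v 0) (v 1) ## J x (v 2) ## (\<lambda>_. 0)) i)"
      by cases (auto intro: smooth_N smooth_J)
  qed
  then have "form_on S 3 \<tau>" using alt by (simp add: form_on_def)
  moreover have "metric \<epsilon> (w x) (p x) (nijenhuis \<epsilon> (\<lambda>y. Jmap (w y) (p y)) X Y x) (Z x)
              = \<tau> x ((!) [X x, Y x, Z x])"
    if "smooth_on S X" "smooth_on S Y" "x \<in> S" for X Y Z x
    unfolding nijenhuis_eq_N[OF that(3,1,2)] metric_N[OF that(3)] \<tau>_def by simp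
  ultimately show ?R by blast
next
  assume ?R
  then obtain \<tau> where \<tau>: "form_on S 3 \<tau>" and eq: "\<And>X Y Z x. smooth_on S X \<Longrightarrow> smooth_on S Y \<Longrightarrow> smooth_on S Z
     \<Longrightarrow> x \<in> S \<Longrightarrow> metric \<epsilon> (w x) (p x) (nijenhuis \<epsilon> (\<lambda>y. Jmap (w y) (p y)) X Y x) (Z x)
              = \<tau> x ((!) [X x, Y x, Z x])" by blast
  show ?L
  proof (intro ballI allI)
    fix x X Y assume x: "x \<in> S"
    interpret P: su_pair "w x" "p x" \<epsilon> by (rule pair[OF x])
    have J': "Jmap (w x) (p x) = J x" by (simp add: J_def)
    have 0: "P.om (N x X Y) (J x X) = 0" for X Y
    proof -
      have "\<tau> x ((!) [X, Y, X]) = 0"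
        by (rule alt_form_eq_0[of 3 _ 0 2]) (use \<tau> x in \<open>auto simp: form_on_def\<close>)
      then have "metric \<epsilon> (w x) (p x) (N x X Y) X = 0"
        \<comment> \<open>N is tensorial, so constant vector fields reach every triple of tangent
          vectors at x.\<close>
        using eq[OF smooth_on_const smooth_on_const smooth_on_const x, of X Y X]
        unfolding nijenhuis_eq_N[OF x smooth_on_const smooth_on_const] by simp
      then show ?thesis unfolding metric_N[OF x] using P.eps_nz by (simp add: P.om_def)
    qed
    have "N x X (J x Y) = - J x (N x X Y)"
      using N_anti[of x X "J x Y"] N_J[OF x, of Y X] N_anti[of x X Y] by (simp add: linear_neg[OF linear_J[OF x]])
    then have "P.om (J x (N x X Y)) (J x X) = 0"
      using 0[of X "J x Y"] by (simp add: P.om_lin)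
    then have "\<epsilon> * P.om (N x X Y) X = 0"
      using P.om_J[of "N x X Y" "J x X"] unfolding J' J_J[OF x] by (simp add: P.om_lin)
    then have "P.om X (N x X Y) = 0" using P.eps_nz P.om_anti[of X "N x X Y"] by simp
    then show "w x (X ## N x X Y ## (\<lambda>_. 0)) = 0" by (simp add: P.om_def)
  qed
qed

lemma square_coefficient_constant:
  assumes d4: "\<And>x v. x \<in> S \<Longrightarrow> ext_deriv 4 (\<lambda>x. wedge 2 2 (w x) (w x)) x v = 0"
    and \<nu>: "\<And>x v. x \<in> S \<Longrightarrow> ext_deriv 3 psim x v = \<nu> x * wedge 2 2 (w x) (w x) v"
    and ball: "ball x0 r \<subseteq> S" and x: "x \<in> ball x0 r"
  shows "\<nu> x = \<nu> x0"
proof -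
  have der: "(\<nu> has_derivative (\<lambda>u. 0)) (at x)" if x: "x \<in> S" for x
  proof -
    interpret P: su_pair "w x" "p x" \<epsilon> by (rule pair[OF x])
    \<comment> \<open>Nothing is assumed about the regularity of \<nu>. Near x it is the quotient of
      two smooth functions, obtained by evaluating both four-forms on b, and this gives
      differentiability.\<close>
    obtain b where b: "wedge 2 2 (w x) (w x) b \<noteq> 0" using P.square_nz by blast
    define U where "U = {y \<in> S. wedge 2 2 (w y) (w y) b \<noteq> 0}"
    have "open U"
    proof -
      have "open (S \<inter> (\<lambda>y. wedge 2 2 (w y) (w y) b) -` (- {0}))"
        using continuous_open_preimage[OF smooth_on_continuous[OF smooth_square] S, of "- {0}" b] by auto
      moreover have "U = S \<inter> (\<lambda>y. wedge 2 2 (w y) (w y) b) -` (- {0})" by (auto simp: U_def)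
      ultimately show ?thesis by simp
    qed
    have xU: "x \<in> U" using x b by (simp add: U_def)
    have US: "U \<subseteq> S" by (auto simp: U_def)
    note sm = smooth_on_ext_deriv[OF S form_on_psim, of b]
    have "(\<lambda>y. ext_deriv 3 psim y b / wedge 2 2 (w y) (w y) b) differentiable (at x)"
      by (intro differentiable_divide smooth_on_differentiable[OF sm x] smooth_on_differentiable[OF smooth_square x] b)
    then have "\<nu> differentiable (at x)"
      by (rule differentiable_cong[OF _ \<open>open U\<close> xU]) (use \<nu> in \<open>auto simp: U_def\<close>)
    define D where "D = frechet_derivative \<nu> (at x)"
    have D: "(\<nu> has_derivative D) (at x)" unfolding D_def by (rule frechet_worksI) fact
    have dform_eq: "dform (ext_deriv 3 psim) x u v = D u * wedge 2 2 (w x) (w x) v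
        + \<nu> x * dform (\<lambda>x. wedge 2 2 (w x) (w x)) x u v" for u v
    proof -
      have "((\<lambda>y. \<nu> y * wedge 2 2 (w y) (w y) v) has_derivative (\<lambda>u. \<nu> x * dform (\<lambda>x. wedge 2 2 (w x) (w x)) x u v
         + D u * wedge 2 2 (w x) (w x) v)) (at x)"
        unfolding dform_def
        by (intro has_derivative_mult D frechet_worksI smooth_on_differentiable[OF smooth_square x])
      then have "((\<lambda>y. ext_deriv 3 psim y v) has_derivative (\<lambda>u. \<nu> x * dform (\<lambda>x. wedge 2 2 (w x) (w x)) x u v
         + D u * wedge 2 2 (w x) (w x) v)) (at x)"
        by (rule has_derivative_transform_within_open[OF _ S x]) (rule \<nu>[symmetric])
      then show ?thesis by (simp add: dform_def[of "ext_deriv 3 psim"] frechet_derivative_eqI)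
    qed
    have lD: "linear D" by (rule has_derivative_linear[OF D])
    have "wedge 1 4 (cov D) (wedge 2 2 (w x) (w x)) v = 0" for v
    proof -
      \<comment> \<open>From d(d psi^-) = 0 and the Leibniz rule, with D for the differential of
        \<nu>.\<close>
      have "0 = ext_deriv 4 (ext_deriv 3 psim) x v"
        using ext_deriv_ext_deriv[OF S x form_on_psim, of v] by simp
      also have "\<dots> = wedge 1 4 (cov D) (wedge 2 2 (w x) (w x)) v
          + \<nu> x * ext_deriv 4 (\<lambda>x. wedge 2 2 (w x) (w x)) x v"
        unfolding ext_deriv_dform[of 4] dform_eq wedge_cov_expand[OF lD alt_form_square[OF alt_w[OF x]]]
        by (simp only: distrib_left sum.distrib sum_distrib_left mult.assoc mult.left_commute)
      finally show ?thesis using d4[OF x] by simp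
    qed
    then have "D u = 0" for u by (rule P.wedge_square_injective[OF lD])
    then have "D = (\<lambda>u. 0)" by blast
    then show ?thesis using D by simp
  qed
  have "\<exists>c. \<forall>y\<in>ball x0 r. \<nu> y = c"
    by (rule has_derivative_zero_constant[OF convex_ball]) (use der ball in \<open>blast intro: has_derivative_at_withinI\<close>)
  moreover have "0 < r" using x zero_le_dist[of x0 x] unfolding mem_ball by linarith
  then have "x0 \<in> ball x0 r" by simp
  ultimately show ?thesis using x by metis
qed

end

section \<open>Half-flat structures on a manifold\<close>

lemma connected_space_locally_constant:
  assumes M: "connected_space M" and loc: "\<And>p. p \<in> topspace M \<Longrightarrow> \<exists>U. openin M U \<and> p \<in> U \<and> (\<forall>q\<in>U. f q = f p)"
    and pq: "p \<in> topspace M" "q \<in> topspace M"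
  shows "f p = f q"
proof (rule ccontr)
  assume ne: "f p \<noteq> f q"
  have op: "openin M {x \<in> topspace M. P (f x)}" for P
  proof (subst openin_subopen, intro ballI)
    fix x assume x: "x \<in> {x \<in> topspace M. P (f x)}"
    then obtain U where U: "openin M U" "x \<in> U" "\<forall>q\<in>U. f q = f x" using loc by blast
    have "U \<subseteq> {x \<in> topspace M. P (f x)}"
    proof
      fix y assume y: "y \<in> U"
      then have "f y = f x" using U(3) by blast
      then have "P (f y)" using x by (metis (mono_tags, lifting) mem_Collect_eq)
      then show "y \<in> {x \<in> topspace M. P (f x)}" using y openin_subset[OF U(1)] by blast
    qed
    then show "\<exists>T. openin M T \<and> x \<in> T \<and> T \<subseteq> {x \<in> topspace M. P (f x)}"
      using U(1,2) by (intro exI[of _ U]) simp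
  qed
  have "openin M {x \<in> topspace M. f x = f p}" "openin M {x \<in> topspace M. f x \<noteq> f p}"
    using op[of "\<lambda>y. y = f p"] op[of "\<lambda>y. y \<noteq> f p"] by simp_all
  moreover have "topspace M \<subseteq> {x \<in> topspace M. f x = f p} \<union> {x \<in> topspace M. f x \<noteq> f p}" by auto
  moreover have "{x \<in> topspace M. f x = f p} \<inter> {x \<in> topspace M. f x \<noteq> f p} = {}" by auto
  moreover have "p \<in> {x \<in> topspace M. f x = f p}" "q \<in> {x \<in> topspace M. f x \<noteq> f p}" using pq ne by auto
  ultimately show False using M unfolding connected_space_def by blast
qed

lemma SU_structure_su_field:
  assumes M: "six_manifold M \<A>" and SU: "SU_structure \<A> \<epsilon> p q \<omega> \<psi>" and C: "C \<in> \<A>"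
  shows "su_field (chart_image C) (\<omega> C) (\<psi> C) \<epsilon>"
proof (rule su_field.intro)
  show "open (chart_image C)" using M C by (auto simp: six_manifold_def smooth_atlas_def)
  have dw: "diff_form \<A> 2 \<omega>" and dp: "diff_form \<A> 3 \<psi>" using SU by (auto simp: SU_structure_def)
  then show fw: "form_on (chart_image C) 2 (\<omega> C)" and fp: "form_on (chart_image C) 3 (\<psi> C)"
    using C by (auto simp: diff_form_def)
  fix x assume x: "x \<in> chart_image C"
  show "su_pair (\<omega> C x) (\<psi> C x) \<epsilon>"
  proof (rule su_pair.intro)
    show "alt_form 2 (\<omega> C x)" "alt_form 3 (\<psi> C x)" using fw fp x by (auto simp: form_on_def)
    show "\<epsilon> = 1 \<or> \<epsilon> = - 1" using SU by (simp add: SU_structure_def)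
    have "form_eq \<A> (mwedge 2 3 \<omega> \<psi>) mzero" using SU by (simp add: SU_structure_def)
    then have "wedge 2 3 (\<omega> C x) (\<psi> C x) = (\<lambda>v. 0)" using C x by (simp add: form_eq_def mwedge_def mzero_def)
    then show "wedge 2 3 (\<omega> C x) (\<psi> C x) v = 0" for v by simp
    show "sgn (lam (cube (\<omega> C x)) (\<psi> C x)) = \<epsilon>" using SU C x by (simp add: SU_structure_def)
    have "if \<epsilon> = - 1 then has_signature (metric \<epsilon> (\<omega> C x) (\<psi> C x)) (2 * p) (2 * q)
        else has_signature (metric \<epsilon> (\<omega> C x) (\<psi> C x)) 3 3"
      using SU C x unfolding SU_structure_def by blast
    then show "\<exists>a b. has_signature (metric \<epsilon> (\<omega> C x) (\<psi> C x)) a b" by (auto split: if_splits)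
  qed
qed

theorem corollary3p12:
  fixes M :: "'a topology" and \<A> :: "'a chart set"
    and \<omega> \<psi> :: "'a mform" and \<epsilon> :: real and p q :: nat
  assumes "six_manifold M \<A>" and "connected_space M"
    and "SU_structure \<A> \<epsilon> p q \<omega> \<psi>"
    and "half_flat \<A> \<omega> \<psi>"
  shows "nijenhuis_skew \<A> \<epsilon> \<omega> \<psi> \<longleftrightarrow> nearly_half_flat \<A> \<omega> (psi_minus \<omega> \<psi>)"
proof -
  note F = SU_structure_su_field[OF assms(1,3)]
  have psim: "psi_minus \<omega> \<psi> C = su_field.psim (\<omega> C) (\<psi> C)" if "C \<in> \<A>" for C
    by (rule ext) (simp add: psi_minus_def su_field.psim_def[OF F[OF that]] su_field.J_def[OF F[OF that]] fun_eq_iff)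
  have d3: "ext_deriv 3 (\<psi> C) x v = 0" if "C \<in> \<A>" "x \<in> chart_image C" for C x v
    using assms(4) that by (auto simp: half_flat_def form_eq_def mderiv_def mzero_def fun_eq_iff)
  have d4: "ext_deriv 4 (\<lambda>x. wedge 2 2 (\<omega> C x) (\<omega> C x)) x v = 0" if "C \<in> \<A>" "x \<in> chart_image C" for C x v
  proof -
    have "form_eq \<A> (mderiv 4 (mwedge 2 2 \<omega> \<omega>)) mzero" using assms(4) by (simp add: half_flat_def)
    then have "ext_deriv 4 (mwedge 2 2 \<omega> \<omega> C) x = (\<lambda>v. 0)"
      using that by (simp add: form_eq_def mderiv_def mzero_def)
    then show ?thesis by (simp add: mwedge_def[abs_def])
  qed
  \<comment> \<open>Both conditions of the theorem are statements about \<open>Q\<close> that differ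
    in the quantifiers: for the skewness of N the coefficient may depend on chart and point, for the
    nearly half-flat condition it may not.\<close>
  define Q where "Q C x \<nu> \<longleftrightarrow> (\<forall>v. ext_deriv 3 (psi_minus \<omega> \<psi> C) x v = \<nu> * wedge 2 2 (\<omega> C x) (\<omega> C x) v)" for C x \<nu>
  have skew_iff: "nijenhuis_skew \<A> \<epsilon> \<omega> \<psi> \<longleftrightarrow> (\<forall>C\<in>\<A>. \<forall>x\<in>chart_image C. \<exists>\<nu>. Q C x \<nu>)"
    unfolding nijenhuis_skew_def
  proof (rule ball_cong[OF refl])
    fix C assume C: "C \<in> \<A>"
    interpret su_field "chart_image C" "\<omega> C" "\<psi> C" \<epsilon> by (rule F[OF C])
    show "(\<exists>\<tau>. form_on (chart_image C) 3 \<tau> \<and>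
        (\<forall>X Y Z. smooth_on (chart_image C) X \<and> smooth_on (chart_image C) Y \<and> smooth_on (chart_image C) Z \<longrightarrow>
           (\<forall>x\<in>chart_image C. metric \<epsilon> (\<omega> C x) (\<psi> C x)
                (nijenhuis \<epsilon> (\<lambda>y. Jmap (\<omega> C y) (\<psi> C y)) X Y x) (Z x) = \<tau> x ((!) [X x, Y x, Z x]))))
      \<longleftrightarrow> (\<forall>x\<in>chart_image C. \<exists>\<nu>. Q C x \<nu>)"
      unfolding skew_iff_three_form[symmetric] Q_def psim[OF C]
      by (rule ball_cong[OF refl]) (rule skew_iff_square[OF _ d3[OF C]])
  qed
  have flat_iff: "nearly_half_flat \<A> \<omega> (psi_minus \<omega> \<psi>) \<longleftrightarrow> (\<exists>\<nu>. \<forall>C\<in>\<A>. \<forall>x\<in>chart_image C. Q C x \<nu>)"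
    by (simp add: nearly_half_flat_def form_eq_def mderiv_def mscale_def mwedge_def Q_def fun_eq_iff)
  have atlas: "smooth_atlas M \<A>" using assms(1) by (simp add: six_manifold_def)
  have "\<exists>\<nu>. \<forall>C\<in>\<A>. \<forall>x\<in>chart_image C. Q C x \<nu>" if ex: "\<forall>C\<in>\<A>. \<forall>x\<in>chart_image C. \<exists>\<nu>. Q C x \<nu>"
  proof -
    define nu where "nu C x = (SOME \<nu>. Q C x \<nu>)" for C x
    have nu: "Q C x (nu C x)" if "C \<in> \<A>" "x \<in> chart_image C" for C x
      unfolding nu_def using ex that by (metis someI_ex)
    have open_img: "open (snd C ` W)" if C: "C \<in> \<A>" and W: "openin M W" "W \<subseteq> fst C" for C W
    proof -
      have h: "homeomorphic_map (subtopology M (fst C)) (top_of_set (chart_image C)) (snd C)"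
        and o: "open (chart_image C)" using atlas C by (auto simp: smooth_atlas_def)
      have "openin (subtopology M (fst C)) W" using W by (auto simp: openin_subtopology)
      then have "openin (top_of_set (chart_image C)) (snd C ` W)"
        using homeomorphic_imp_open_map[OF h] by (auto simp: open_map_def)
      then show ?thesis using o openin_open_trans by blast
    qed
    have inj: "inj_on (snd C) (fst C)" if C: "C \<in> \<A>" for C
    proof -
      have "homeomorphic_map (subtopology M (fst C)) (top_of_set (chart_image C)) (snd C)"
        and "fst C \<subseteq> topspace M" using atlas C by (auto simp: smooth_atlas_def dest: openin_subset)
      then show ?thesis using homeomorphic_imp_injective_map by (metis topspace_subtopology_subset)
    qed
    \<comment> \<open>Under a transition map d psi^- and \<omega>^2 transform by the same pullback.
      As \<omega>^2 is nonzero, the coefficient is the same number in both charts.\<close>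
    have glue: "nu C (snd C a) = nu D (snd D a)" if C: "C \<in> \<A>" and D: "D \<in> \<A>" and a: "a \<in> fst C" "a \<in> fst D" for C D a
    proof -
      interpret C: su_field "chart_image C" "\<omega> C" "\<psi> C" \<epsilon> by (rule F[OF C])
      interpret D: su_field "chart_image D" "\<omega> D" "\<psi> D" \<epsilon> by (rule F[OF D])
      define S where "S = snd C ` (fst C \<inter> fst D)"
      define T where "T = transition C D"
      have oS: "open S" unfolding S_def
        by (rule open_img[OF C]) (use atlas C D in \<open>auto simp: smooth_atlas_def intro: openin_Int\<close>)
      have sT: "smooth_on S T" using atlas C D by (auto simp: smooth_atlas_def S_def T_def)
      have T: "T (snd C b) = snd D b" if "b \<in> fst C" for b
        unfolding T_def transition_def using inj[OF C] that by simp
      have Simg: "y \<in> chart_image C" "T y \<in> chart_image D" if "y \<in> S" for y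
        using that T unfolding S_def chart_image_def by auto
      have P_lin: "linear (frechet_derivative T (at y))" if "y \<in> S" for y
        by (rule linear_frechet_derivative[OF smooth_on_differentiable[OF sT that]])
      have tr: "\<alpha> C y = pullback (frechet_derivative T (at y)) (\<alpha> D (T y))"
        if \<alpha>: "diff_form \<A> k \<alpha>" and y: "y \<in> S" for k \<alpha> y
      proof -
        obtain b where b: "b \<in> fst C \<inter> fst D" "y = snd C b" using y by (auto simp: S_def)
        then have "T y = snd D b" using T by simp
        then show ?thesis using \<alpha> C D b unfolding diff_form_def T_def by metis
      qed
      have diff: "diff_form \<A> 2 \<omega>" "diff_form \<A> 3 \<psi>" using assms(3) by (auto simp: SU_structure_def)
      have pw: "\<omega> C y = pullback (frechet_derivative T (at y)) (\<omega> D (T y))"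
        and pp: "\<psi> C y = pullback (frechet_derivative T (at y)) (\<psi> D (T y))" if "y \<in> S" for y
        by (rule tr[OF diff(1) that], rule tr[OF diff(2) that])
      have ppsi: "C.psim y = pullback (frechet_derivative T (at y)) (D.psim (T y))" if y: "y \<in> S" for y
      proof -
        note J = Jmap_pullback[OF C.pair[OF Simg(1)[OF y]] D.pair[OF Simg(2)[OF y]] P_lin[OF y] pw[OF y] pp[OF y]]
        show ?thesis
          by (rule ext) (simp add: C.psim_def D.psim_def C.J_def D.J_def J[symmetric] pp[OF y])
      qed
      define x where "x = snd C a"
      have x: "x \<in> S" using a by (simp add: x_def S_def)
      have "ext_deriv 3 C.psim x = pullback (frechet_derivative T (at x)) (ext_deriv 3 D.psim (T x))"
        by (rule ext_deriv_pullback[OF oS x sT D.S Simg(2) D.form_on_psim ppsi])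
      moreover have "wedge 2 2 (\<omega> C x) (\<omega> C x) = pullback (frechet_derivative T (at x)) (wedge 2 2 (\<omega> D (T x)) (\<omega> D (T x)))"
        unfolding pullback_wedge pw[OF x] ..
      moreover have "Q C x (nu C x)" "Q D (T x) (nu D (T x))"
        using nu[OF C Simg(1)[OF x]] nu[OF D Simg(2)[OF x]] by auto
      ultimately have "nu C x * wedge 2 2 (\<omega> C x) (\<omega> C x) v = nu D (T x) * wedge 2 2 (\<omega> C x) (\<omega> C x) v" for v
        unfolding Q_def psim[OF C] psim[OF D] by (metis pullback_apply)
      moreover obtain v where "wedge 2 2 (\<omega> C x) (\<omega> C x) v \<noteq> 0"
        using su_pair.square_nz[OF C.pair[OF Simg(1)[OF x]]] by blast
      ultimately have "nu C x = nu D (T x)" by (metis mult_cancel_right)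
      then show ?thesis using T[OF a(1)] by (simp add: x_def)
    qed
    \<comment> \<open>The coefficient as a function on M, read in an arbitrarily chosen chart around
      each point; by \<open>glue\<close> the choice does not matter.\<close>
    define f where "f a = (let C = (SOME C. C \<in> \<A> \<and> a \<in> fst C) in nu C (snd C a))" for a
    have f: "f a = nu C (snd C a)" if C: "C \<in> \<A>" "a \<in> fst C" for C a
    proof -
      have "\<exists>C. C \<in> \<A> \<and> a \<in> fst C" using C by blast
      from someI_ex[OF this] show ?thesis unfolding f_def Let_def using glue[OF _ C(1) _ C(2)] by blast
    qed
    have loc: "\<exists>U. openin M U \<and> a \<in> U \<and> (\<forall>b\<in>U. f b = f a)" if a: "a \<in> topspace M" for a
    proof -
      have "a \<in> (\<Union>C\<in>\<A>. fst C)" using a atlas unfolding smooth_atlas_def by blast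
      then obtain C where C: "C \<in> \<A>" "a \<in> fst C" by blast
      interpret C: su_field "chart_image C" "\<omega> C" "\<psi> C" \<epsilon> by (rule F[OF C(1)])
      have "snd C a \<in> chart_image C" using C by (simp add: chart_image_def)
      then obtain r where r: "r > 0" "ball (snd C a) r \<subseteq> chart_image C"
        using C.S open_contains_ball by blast
      define U where "U = {b \<in> fst C. snd C b \<in> ball (snd C a) r}"
      have h: "homeomorphic_map (subtopology M (fst C)) (top_of_set (chart_image C)) (snd C)"
        and oC: "openin M (fst C)" using atlas C by (auto simp: smooth_atlas_def)
      have cont: "continuous_map (subtopology M (fst C)) (top_of_set (chart_image C)) (snd C)"
        by (rule homeomorphic_imp_continuous_map[OF h])
      have "openin (top_of_set (chart_image C)) (ball (snd C a) r)"
        using r(2) by (simp add: open_subset)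
      from openin_continuous_map_preimage[OF cont this]
      have "openin (subtopology M (fst C)) U"
        unfolding U_def topspace_subtopology_subset[OF openin_subset[OF oC]] .
      then have "openin M U" using oC openin_open_subtopology by blast
      moreover have "a \<in> U" using C r by (simp add: U_def)
      moreover have "f b = f a" if b: "b \<in> U" for b
      proof -
        have "nu C (snd C b) = nu C (snd C a)"
        proof (rule C.square_coefficient_constant[where \<nu> = "nu C", OF d4[OF C(1)] _ r(2)])
          show "ext_deriv 3 C.psim x v = nu C x * wedge 2 2 (\<omega> C x) (\<omega> C x) v" if "x \<in> chart_image C" for x v
            using nu[OF C(1) that] unfolding Q_def psim[OF C(1)] by blast
        qed (use b in \<open>auto simp: U_def\<close>)
        then show ?thesis using f[OF C(1)] C(2) b by (simp add: U_def)
      qed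
      ultimately show ?thesis by blast
    qed
    show ?thesis
    \<comment> \<open>On the empty manifold there is no point at which to read off the constant, but
      every chart image is empty and any value will do.\<close>
    proof (cases "topspace M = {}")
      case True
      then have "chart_image C = {}" if "C \<in> \<A>" for C
        using that atlas by (auto simp: smooth_atlas_def chart_image_def)
      then show ?thesis by auto
    next
      case False
      then obtain a where a: "a \<in> topspace M" by blast
      have "Q C x (f a)" if C: "C \<in> \<A>" and x: "x \<in> chart_image C" for C x
      proof -
        obtain b where b: "b \<in> fst C" "x = snd C b" using x by (auto simp: chart_image_def)
        have "fst C \<subseteq> topspace M" using atlas C by (auto simp: smooth_atlas_def dest: openin_subset)
        then have "b \<in> topspace M" using b by blast
        have "f b = f a"
        proof (rule connected_space_locally_constant[OF assms(2)])
          show "\<exists>U. openin M U \<and> a \<in> U \<and> (\<forall>b\<in>U. f b = f a)" if "a \<in> topspace M" for a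
            using that by (rule loc)
        qed fact+
        then show ?thesis using nu[OF C x] f[OF C b(1)] b(2) by simp
      qed
      then show ?thesis by blast
    qed
  qed
  then show ?thesis unfolding skew_iff flat_iff by blast
qed

end
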